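(* Let $d,n,t\in\mathbb{N}$ and let $Y\subseteq\mathbb{T}^d$ be an order $2$ digital $(t,n,d)$-net (in base $2$) of cardinality $N=2^n$. Let $X=\mathcal{R}Y=\{(|2y_1-1|,\dots,|2y_d-1|):(y_1,\dots,y_d)\in Y\}\subseteq[0,1]^d$ be the tent transformed point (multi)set, with $\#X=N$ counted with multiplicity. Then $$ e^{\mathrm{QMC}}(X,H^2_{\mathrm{mix}}([0,1]^d))\le C\,2^t N^{-2}(\log N)^{2d-1}, $$ where $C>0$ depends only on $d$.
   Context: $\mathbb{T}^d$ is identified with $[0,1)^d$. $H^2_{\mathrm{mix}}([0,1]^d)$ is the $d$-fold Hilbert tensor product of $H^2([0,1])=\{f\in L_2([0,1]):f''\in L_2([0,1])\}$ (weak derivative) with norm $\|f\|^2=\|f\|^2_{L_2}+\|f''\|^2_{L_2}$; equivalently the real functions $f$ on $[0,1]^d$ with $\big(\prod_{i\in e}\partial^2/\partial x_i^2\big)f\in L_2([0,1]^d)$ for all $e\subseteq\{1,\dots,d\}$, normed by the square root of the sum of the squared $L_2$-norms of these derivatives (any equivalent norm changes only the constant). For a finite multiset $X\subseteq[0,1]^d$ of $N$ points, $e^{\mathrm{QMC}}(X,H^2_{\mathrm{mix}}([0,1]^d))=\sup_{\|f\|\le1}\big|\frac1N\sum_{\mathbf{x}\in X}f(\mathbf{x})-\int_{[0,1]^d}f(\mathbf{x})\,d\mathbf{x}\big|$. Order $\alpha$ digital nets: let $C_1,\dots,C_d\in\{0,1\}^{\alpha n\times n}$ be matrices over the field $\mathbb{Z}/2\mathbb{Z}$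 with rows $c_{i,1}^\top,\dots,c_{i,\alpha n}^\top$. For $k=\kappa_0+2\kappa_1+\dots+2^{n-1}\kappa_{n-1}\in\{0,\dots,2^n-1\}$ with $\kappa=(\kappa_0,\dots,\kappa_{n-1})^\top$, compute $C_i\kappa=(\kappa^{(i)}_1,\dots,\kappa^{(i)}_{\alpha n})^\top$ over $\mathbb{Z}/2\mathbb{Z}$ and set $y^k_i=\sum_{\ell=1}^{\alpha n}\kappa^{(i)}_\ell 2^{-\ell}$; the digital net is $Y=\{\mathbf{y}^0,\dots,\mathbf{y}^{2^n-1}\}$. It is an order $\alpha$ digital $(t,n,d)$-net if for all choices of integers $0\le\nu_i\le n$ and indices $1\le j_{i,\nu_i}<\dots<j_{i,1}\le\alpha n$ ($i=1,\dots,d$) with $\sum_{i=1}^d\sum_{\ell=1}^{\min\{\alpha,\nu_i\}}j_{i,\ell}\le\alpha n-t$, the row vectors $c_{1,j_{1,\nu_1}},\dots,c_{1,j_{1,1}},\dots,c_{d,j_{d,\nu_d}},\dots,c_{d,j_{d,1}}\in\{0,1\}^n$ are linearly independent over $\mathbb{Z}/2\mathbb{Z}$. Here $\alpha=2$. *)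

theory Defs
  imports "HOL-Analysis.Analysis" "HOL-Library.Multiset"
begin

definition unit_cube :: "(real^'d) set" where
  "unit_cube = cbox 0 1"

definition pd :: "'d::finite \<Rightarrow> (real^'d \<Rightarrow> real) \<Rightarrow> real^'d \<Rightarrow> real" where
  "pd i g x = deriv (\<lambda>s. g (x + s *\<^sub>R axis i 1)) 0"

fun iter_pd :: "'d::finite list \<Rightarrow> (real^'d \<Rightarrow> real) \<Rightarrow> real^'d \<Rightarrow> real" where
  "iter_pd [] g = g"
| "iter_pd (i # is) g = pd i (iter_pd is g)"

definition test_fn :: "(real^'d::finite \<Rightarrow> real) \<Rightarrow> bool" where
  "test_fn \<phi> \<longleftrightarrow>
     (\<forall>is. continuous_on UNIV (iter_pd is \<phi>) \<and>
           (\<forall>i x. (\<lambda>s. iter_pd is \<phi> (x + s *\<^sub>R axis i 1)) field_differentiable (at 0))) \<and>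
     (\<exists>K. compact K \<and> K \<subseteq> box 0 1 \<and> (\<forall>x. x \<notin> K \<longrightarrow> \<phi> x = 0))"

definition in_L2 :: "(real^'d::finite \<Rightarrow> real) \<Rightarrow> bool" where
  "in_L2 g \<longleftrightarrow> g \<in> borel_measurable (lebesgue_on unit_cube) \<and>
                integrable (lebesgue_on unit_cube) (\<lambda>x. (g x)^2)"

text \<open>g is the weak derivative (\<Prod>_{i\<in>e} \<partial>^2/\<partial>x_i^2) f on (0,1)^d
  (the sign (-1)^(2|e|) is 1). Any ordering of the differentiations is allowed.\<close>
definition is_weak_mixed2 :: "'d::finite set \<Rightarrow> (real^'d \<Rightarrow> real) \<Rightarrow> (real^'d \<Rightarrow> real) \<Rightarrow> bool" where
  "is_weak_mixed2 e f g \<longleftrightarrow>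
     (\<forall>\<phi>. test_fn \<phi> \<longrightarrow>
        (\<forall>is. (\<forall>i. count (mset is) i = (if i \<in> e then 2 else 0)) \<longrightarrow>
           (LINT x|lebesgue_on unit_cube. f x * iter_pd is \<phi> x) =
           (LINT x|lebesgue_on unit_cube. g x * \<phi> x)))"

definition H2mix :: "(real^'d::finite \<Rightarrow> real) set" where
  "H2mix = {f. \<forall>e. \<exists>g. in_L2 g \<and> is_weak_mixed2 e f g}"

definition weak_D :: "'d::finite set \<Rightarrow> (real^'d \<Rightarrow> real) \<Rightarrow> (real^'d \<Rightarrow> real)" where
  "weak_D e f = (SOME g. in_L2 g \<and> is_weak_mixed2 e f g)"

definition H2mix_norm :: "(real^'d::finite \<Rightarrow> real) \<Rightarrow> real" where
  "H2mix_norm f = sqrt (\<Sum>e\<in>(UNIV :: 'd set set). LINT x|lebesgue_on unit_cube. (weak_D e f x)^2)"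

text \<open>Point evaluation is taken for the continuous representative on [0,1]^d.\<close>
definition qmc_wce :: "(real^'d::finite) multiset \<Rightarrow> ereal" where
  "qmc_wce X = (SUP f \<in> {f. f \<in> H2mix \<and> continuous_on unit_cube f \<and> H2mix_norm f \<le> 1}.
      ereal \<bar>(\<Sum>x\<in>#X. f x) / real (size X) - (LINT x|lebesgue_on unit_cube. f x)\<bar>)"

text \<open>Generating matrices: Cm i l r is the entry of C_i in row l (1-based, 1..alpha*n)
  and column r (0-based, 0..n-1, multiplying kappa_r).\<close>

definition digit :: "nat \<Rightarrow> ('d \<Rightarrow> nat \<Rightarrow> nat \<Rightarrow> bool) \<Rightarrow> 'd \<Rightarrow> nat \<Rightarrow> nat \<Rightarrow> bool" where
  "digit n Cm i l k = odd (card {r. r < n \<and> Cm i l r \<and> odd (k div 2 ^ r)})"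

definition net_point :: "nat \<Rightarrow> nat \<Rightarrow> ('d::finite \<Rightarrow> nat \<Rightarrow> nat \<Rightarrow> bool) \<Rightarrow> nat \<Rightarrow> real^'d" where
  "net_point \<alpha> n Cm k = (\<chi> i. \<Sum>l=1..\<alpha>*n. (if digit n Cm i l k then 1 else 0) * (1/2) ^ l)"

definition digital_net :: "nat \<Rightarrow> nat \<Rightarrow> ('d::finite \<Rightarrow> nat \<Rightarrow> nat \<Rightarrow> bool) \<Rightarrow> (real^'d) multiset" where
  "digital_net \<alpha> n Cm = image_mset (net_point \<alpha> n Cm) (mset_set {..<2^n})"

definition top_sum :: "nat \<Rightarrow> nat set \<Rightarrow> nat" where
  "top_sum \<alpha> J = (\<Sum>j\<in>{j\<in>J. card {k\<in>J. j < k} < \<alpha>}. j)"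

definition rows_independent :: "nat \<Rightarrow> ('d \<Rightarrow> nat \<Rightarrow> nat \<Rightarrow> bool) \<Rightarrow> ('d \<times> nat) set \<Rightarrow> bool" where
  "rows_independent n Cm S \<longleftrightarrow>
     (\<forall>T. T \<subseteq> S \<and> T \<noteq> {} \<longrightarrow> (\<exists>r<n. odd (card {p\<in>T. Cm (fst p) (snd p) r})))"

definition is_order_digital_net :: "nat \<Rightarrow> nat \<Rightarrow> nat \<Rightarrow> ('d::finite \<Rightarrow> nat \<Rightarrow> nat \<Rightarrow> bool) \<Rightarrow> bool" where
  "is_order_digital_net \<alpha> t n Cm \<longleftrightarrow>
     (\<forall>J :: 'd \<Rightarrow> nat set.
        (\<forall>i. J i \<subseteq> {1..\<alpha>*n} \<and> card (J i) \<le> n) \<longrightarrow>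
        int (\<Sum>i\<in>UNIV. top_sum \<alpha> (J i)) \<le> int (\<alpha>*n) - int t \<longrightarrow>
        rows_independent n Cm (SIGMA i:UNIV. J i))"

definition tent :: "real^'d \<Rightarrow> real^'d" where
  "tent y = (\<chi> i. \<bar>2 * y$i - 1\<bar>)"

end

theory Submission
  imports Defs "HOL-Real_Asymp.Real_Asymp"
begin

text \<open>
  Smooth test functions of product form give, for a mollification of \<open>f\<close>, a representation
  \<open>f(x) = \<Sum>\<^sub>e \<integral> g\<^sub>e(s) \<Prod>\<^sub>i K\<^sub>e\<^sub>,\<^sub>i(x\<^sub>i, s\<^sub>i) ds\<close> by the weak derivatives \<open>g\<^sub>e\<close>, in which every kernel is
  smooth and convex in \<open>x\<^sub>i\<close> with uniformly bounded value and slope. So it suffices to bound the error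
  for products of such univariate functions. On the grid of dyadic midpoints of level \<open>L\<close>, finite Walsh
  inversion expresses the difference of the net average and the grid average as the sum of the Walsh
  coefficients over the nonzero elements of the dual net. A univariate coefficient of a convex function
  composed with the tent map is \<open>O(2\<^bsup>-a-b\<^esup>)\<close>, where \<open>a > b\<close> are the two leading digit positions; summing
  over the dual net, whose elements have weight larger than \<open>2n - t\<close>, gives the rate. Letting the
  mollification parameter tend to 0 and then \<open>L\<close> to infinity yields the integration error of \<open>f\<close>.
\<close>

text \<open>No bound on second derivatives is available: the natural kernel is the ramp
  \<open>max (s - x) 0\<close>, whose second derivative is a point mass, and its smoothed versions
  have second derivatives of size 1/\<epsilon>. What survives the limit is a monotone slope with
  bounded range, and this is why the univariate estimates are stated for convex functions. Midpoint
  grids serve two purposes. Inversion on them is a finite identity, and after the tent every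
  evaluation point, even one coming from a net point that is sent to the boundary, has distance at
  least (1/2)^L from the boundary. This leaves room for mollifiers and compactly supported test
  functions, and it forces \<epsilon> to vanish before L grows. The exponent 2d - 1 of the logarithm
  counts the choices of 2d leading positions with prescribed sum. Many dual elements may share their
  leading positions, but the minimal distance allows only about 2^(j/2) of them at excess weight j,
  against a decay of 2^(-j), so a convergent series remains.\<close>

section \<open>Walsh coefficients of univariate functions\<close>

text \<open>\<^term>\<open>pt L A\<close> is the midpoint of the dyadic interval of length $2^{-L}$ whose binary digits
  equal to 1 sit at the positions \<open>l + 1\<close> with \<open>l \<in> A\<close>; digit positions are 0-based from here on.\<close>

definition pt :: "nat \<Rightarrow> nat set \<Rightarrow> real" where
  "pt L A = (\<Sum>l\<in>A. (1/2) ^ Suc l) + (1/2) ^ Suc L"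

definition walsh_coeff :: "nat \<Rightarrow> nat set \<Rightarrow> (real \<Rightarrow> real) \<Rightarrow> real" where
  "walsh_coeff L J h = (\<Sum>A\<in>Pow {..<L}. (-1) ^ card (A \<inter> J) * h (pt L A)) / 2 ^ L"

lemma pt_shift:
  assumes "finite B"
  shows "pt (Suc L) (Suc ` B) = pt L B / 2" "pt (Suc L) (insert 0 (Suc ` B)) = (pt L B + 1) / 2"
proof -
  have *: "(\<Sum>l\<in>Suc ` B. (1/2::real) ^ Suc l) = (\<Sum>l\<in>B. (1/2) ^ Suc l) / 2"
    by (simp add: sum.reindex sum_divide_distrib)
  show "pt (Suc L) (Suc ` B) = pt L B / 2"
    unfolding pt_def * by (simp add: field_simps)
  have "0 \<notin> Suc ` B" by auto
  then show "pt (Suc L) (insert 0 (Suc ` B)) = (pt L B + 1) / 2"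
    unfolding pt_def using assms * by (simp add: field_simps)
qed

lemma sum_Pow_lessThan_Suc:
  fixes F :: "nat set \<Rightarrow> real"
  shows "(\<Sum>A\<in>Pow {..<Suc L}. F A) = (\<Sum>B\<in>Pow {..<L}. F (Suc ` B) + F (insert 0 (Suc ` B)))"
proof -
  have P: "Pow {..<Suc L} = (`) Suc ` Pow {..<L} \<union> (\<lambda>B. insert 0 (Suc ` B)) ` Pow {..<L}"
    unfolding lessThan_Suc_eq_insert_0 Pow_insert image_Pow_surj[OF refl, symmetric] image_image ..
  have disj: "(`) Suc ` Pow {..<L} \<inter> (\<lambda>B. insert 0 (Suc ` B)) ` Pow {..<L} = {}"
    by auto
  have i1: "inj_on ((`) Suc) (Pow {..<L})"
    by (auto intro!: inj_onI simp: inj_image_eq_iff)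
  have i2: "inj_on (\<lambda>B. insert 0 (Suc ` B)) (Pow {..<L})"
  proof (rule inj_onI)
    fix B B' :: "nat set" assume "insert 0 (Suc ` B) = insert 0 (Suc ` B')"
    then have "Suc ` B = Suc ` B'" by (metis Diff_insert_absorb image_iff nat.distinct(1))
    then show "B = B'" by (simp add: inj_image_eq_iff)
  qed
  show ?thesis
    unfolding P by (subst sum.union_disjoint[OF _ _ disj]) (simp_all add: sum.reindex i1 i2 sum.distrib)
qed

definition shift_set :: "nat set \<Rightarrow> nat set" where
  "shift_set J = {l. Suc l \<in> J}"

lemma walsh_coeff_0: "walsh_coeff 0 J h = h (1/2)"
  by (simp add: walsh_coeff_def pt_def)

text \<open>Splitting by the first binary digit restricts \<open>h\<close> to the two halves of the
  interval, rescaled to unit length; the digit contributes a sign exactly if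
  \<open>0 \<in> J\<close>. All univariate estimates are inductions along this recursion.\<close>

lemma walsh_coeff_Suc:
  "walsh_coeff (Suc L) J h =
     (walsh_coeff L (shift_set J) (\<lambda>x. h (x / 2))
      + (if 0 \<in> J then -1 else 1) * walsh_coeff L (shift_set J) (\<lambda>x. h ((x + 1) / 2))) / 2"
proof -
  have c1: "card (Suc ` B \<inter> J) = card (B \<inter> shift_set J)" for B
  proof -
    have "Suc ` B \<inter> J = Suc ` (B \<inter> shift_set J)" by (auto simp: shift_set_def)
    then show ?thesis by (simp add: card_image)
  qed
  have c2: "(-1::real) ^ card (insert 0 (Suc ` B) \<inter> J)
      = (if 0 \<in> J then -1 else 1) * (-1) ^ card (B \<inter> shift_set J)" if "finite B" for B
  proof (cases "0 \<in> J")
    case True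
    then have "insert 0 (Suc ` B) \<inter> J = insert 0 (Suc ` B \<inter> J)" by auto
    moreover have "card (insert 0 (Suc ` B \<inter> J)) = Suc (card (Suc ` B \<inter> J))"
      using that by (subst card_insert_disjoint) auto
    ultimately show ?thesis using True c1 by simp
  next
    case False
    then have "insert 0 (Suc ` B) \<inter> J = Suc ` B \<inter> J" by auto
    then show ?thesis using False c1 by simp
  qed
  have fin: "finite B" if "B \<in> Pow {..<L}" for B :: "nat set"
    using that finite_subset by auto
  have "(\<Sum>A\<in>Pow {..<Suc L}. (-1) ^ card (A \<inter> J) * h (pt (Suc L) A))
      = (\<Sum>B\<in>Pow {..<L}. (-1) ^ card (B \<inter> shift_set J) * h (pt L B / 2)
          + (if 0 \<in> J then -1 else 1) * ((-1) ^ card (B \<inter> shift_set J) * h ((pt L B + 1) / 2)))"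
    unfolding sum_Pow_lessThan_Suc
    by (rule sum.cong) (use fin in \<open>simp_all only: pt_shift c1 c2 mult.assoc\<close>)
  then show ?thesis
    unfolding walsh_coeff_def by (simp add: sum.distrib sum_distrib_left field_simps flip: sum_negf)
qed

lemma walsh_coeff_Suc_le:
  "\<bar>walsh_coeff (Suc L) J h\<bar> \<le>
     (\<bar>walsh_coeff L (shift_set J) (\<lambda>x. h (x / 2))\<bar> + \<bar>walsh_coeff L (shift_set J) (\<lambda>x. h ((x + 1) / 2))\<bar>) / 2"
  unfolding walsh_coeff_Suc by auto

lemma walsh_coeff_diff:
  "walsh_coeff L J (\<lambda>x. f x - g x) = walsh_coeff L J f - walsh_coeff L J g"
  by (simp add: walsh_coeff_def algebra_simps sum_subtractf diff_divide_distrib)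

text \<open>All points \<open>pt L A\<close> lie in the unit interval. This matters because the
  absolute value in the tent can be resolved on each half only there.\<close>

lemma walsh_coeff_cong:
  assumes "\<And>x. 0 \<le> x \<Longrightarrow> x \<le> 1 \<Longrightarrow> f x = g x"
  shows "walsh_coeff L J f = walsh_coeff L J g"
  using assms
proof (induction L arbitrary: J f g)
  case 0
  then show ?case by (simp add: walsh_coeff_0)
next
  case (Suc L)
  show ?case
    unfolding walsh_coeff_Suc
    by (subst Suc.IH[of "\<lambda>x. f (x/2)" "\<lambda>x. g (x/2)"], use Suc.prems in force,
        subst Suc.IH[of "\<lambda>x. f ((x+1)/2)" "\<lambda>x. g ((x+1)/2)"], use Suc.prems in force, rule refl)
qed

lemma walsh_coeff_bound:
  assumes "\<And>x. 0 \<le> x \<Longrightarrow> x \<le> 1 \<Longrightarrow> \<bar>h x\<bar> \<le> M"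
  shows "\<bar>walsh_coeff L J h\<bar> \<le> M"
  using assms
proof (induction L arbitrary: J h)
  case 0
  then show ?case by (simp add: walsh_coeff_0)
next
  case (Suc L)
  have "\<bar>walsh_coeff L (shift_set J) (\<lambda>x. h (x/2))\<bar> \<le> M"
    "\<bar>walsh_coeff L (shift_set J) (\<lambda>x. h ((x+1)/2))\<bar> \<le> M"
    by (rule Suc.IH, use Suc.prems in force)+
  then show ?case using walsh_coeff_Suc_le[of L J h] by simp
qed

text \<open>Each digit before \<open>a\<close> halves the Lipschitz constant, since the function is
  restricted to a half interval. At \<open>a\<close> the sign is negative, and the two halves,
  compared at points 1/2 apart, differ by at most half of the current constant.\<close>

lemma walsh_coeff_Lipschitz:
  assumes "a \<in> J" "a < L"
    and "\<And>x y. 0 \<le> x \<Longrightarrow> x \<le> y \<Longrightarrow> y \<le> 1 \<Longrightarrow> \<bar>h x - h y\<bar> \<le> K * (y - x)"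
  shows "\<bar>walsh_coeff L J h\<bar> \<le> K * (1/2) ^ Suc a"
  using assms
proof (induction L arbitrary: a J h K)
  case 0
  then show ?case by simp
next
  case (Suc L)
  have K0: "K \<ge> 0" using order_trans[OF abs_ge_zero Suc.prems(3)[of 0 1]] by simp
  show ?case
  proof (cases a)
    case 0
    have "\<bar>walsh_coeff L (shift_set J) (\<lambda>x. h (x/2) - h ((x+1)/2))\<bar> \<le> K / 2"
    proof (rule walsh_coeff_bound)
      fix x :: real assume "0 \<le> x" "x \<le> 1"
      then show "\<bar>h (x/2) - h ((x+1)/2)\<bar> \<le> K / 2"
        using Suc.prems(3)[of "x/2" "(x+1)/2"] by (simp add: field_simps)
    qed
    then show ?thesis
      using 0 Suc.prems(1) K0 unfolding walsh_coeff_Suc walsh_coeff_diff by auto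
  next
    case (Suc b)
    then have b: "b \<in> shift_set J" "b < L"
      using Suc.prems by (auto simp: shift_set_def)
    have "\<bar>walsh_coeff L (shift_set J) (\<lambda>x. h (x/2))\<bar> \<le> K/2 * (1/2) ^ Suc b"
      using b
    proof (rule Suc.IH)
      fix x y :: real assume "0 \<le> x" "x \<le> y" "y \<le> 1"
      then show "\<bar>h (x/2) - h (y/2)\<bar> \<le> K/2 * (y - x)"
        using Suc.prems(3)[of "x/2" "y/2"] by (simp add: field_simps)
    qed
    moreover have "\<bar>walsh_coeff L (shift_set J) (\<lambda>x. h ((x+1)/2))\<bar> \<le> K/2 * (1/2) ^ Suc b"
      using b
    proof (rule Suc.IH)
      fix x y :: real assume "0 \<le> x" "x \<le> y" "y \<le> 1"
      then show "\<bar>h ((x+1)/2) - h ((y+1)/2)\<bar> \<le> K/2 * (y - x)"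
        using Suc.prems(3)[of "(x+1)/2" "(y+1)/2"] by (simp add: field_simps)
    qed
    ultimately show ?thesis
      using walsh_coeff_Suc_le[of L J h] unfolding Suc by simp
  qed
qed

lemma Lipschitz_from_deriv:
  fixes h :: "real \<Rightarrow> real"
  assumes "\<And>x. (h has_real_derivative h' x) (at x)"
    and "\<And>x. 0 \<le> x \<Longrightarrow> x \<le> 1 \<Longrightarrow> \<bar>h' x\<bar> \<le> K"
    and "0 \<le> x" "x \<le> y" "y \<le> 1"
  shows "\<bar>h x - h y\<bar> \<le> K * (y - x)"
proof (cases "x = y")
  case False
  then have "x < y" using assms by simp
  then obtain z where z: "z > x" "z < y" "h y - h x = (y - x) * h' z"
    using MVT2[of x y h h'] assms(1) by blast
  then have "\<bar>h x - h y\<bar> = (y - x) * \<bar>h' z\<bar>"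
    using \<open>x < y\<close> by (subst abs_minus_commute) (simp add: abs_mult)
  also have "\<dots> \<le> (y - x) * K"
    using assms z by (intro mult_left_mono) auto
  finally show ?thesis by (simp add: mult.commute)
qed simp

text \<open>Halving the interval halves the slopes, and the slope variations of the two halves add up to
  at most half the total variation. Hence the bound is stable under consuming a digit; consuming the
  digit \<open>b\<close> turns convexity into a Lipschitz bound for the difference of the two halves.\<close>

lemma walsh_coeff_convex:
  assumes "a \<in> J" "b \<in> J" "b < a" "a < L"
    and "\<And>x. (h has_real_derivative h' x) (at x)" "mono h'"
  shows "\<bar>walsh_coeff L J h\<bar> \<le> (h' 1 - h' 0) * (1/2) ^ Suc a * (1/2) ^ Suc b"
  using assms
proof (induction L arbitrary: a b J h h')
  case 0
  then show ?case by simp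
next
  case (Suc L)
  note deriv = Suc.prems(5)
  have m: "h' x \<le> h' y" if "x \<le> y" for x y using Suc.prems(6) that by (rule monoD)
  obtain c where c: "a = Suc c" using Suc.prems(3) not0_implies_Suc by fastforce
  have cJ: "c \<in> shift_set J" "c < L" using Suc.prems c by (auto simp: shift_set_def)
  have d0: "((\<lambda>x. h (x/2)) has_real_derivative h' (x/2) / 2) (at x)" for x
    by (rule DERIV_chain2[OF deriv, of "\<lambda>x. x/2" "1/2" x, simplified]) (auto intro!: derivative_eq_intros)
  have d1: "((\<lambda>x. h ((x+1)/2)) has_real_derivative h' ((x+1)/2) / 2) (at x)" for x
    by (rule DERIV_chain2[OF deriv, of "\<lambda>x. (x+1)/2" "1/2" x, simplified]) (auto intro!: derivative_eq_intros)
  show ?case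
  proof (cases b)
    case 0
    have "\<bar>walsh_coeff L (shift_set J) (\<lambda>x. h (x/2) - h ((x+1)/2))\<bar> \<le> (h' 1 - h' 0) / 2 * (1/2) ^ Suc c"
    proof (rule walsh_coeff_Lipschitz[OF cJ Lipschitz_from_deriv])
      show "((\<lambda>x. h (x/2) - h ((x+1)/2)) has_real_derivative h' (x/2) / 2 - h' ((x+1)/2) / 2) (at x)" for x
        by (rule DERIV_diff[OF d0 d1])
      fix x :: real assume "0 \<le> x" "x \<le> 1"
      then show "\<bar>h' (x/2) / 2 - h' ((x+1)/2) / 2\<bar> \<le> (h' 1 - h' 0) / 2"
        using m[of 0 "x/2"] m[of "x/2" "(x+1)/2"] m[of "(x+1)/2" 1] by auto
    qed
    then show ?thesis
      using 0 c Suc.prems(2) unfolding walsh_coeff_Suc walsh_coeff_diff by (auto simp: field_simps)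
  next
    case (Suc b')
    then have b: "b' \<in> shift_set J" "b' < c"
      using Suc.prems c by (auto simp: shift_set_def)
    have "\<bar>walsh_coeff L (shift_set J) (\<lambda>x. h (x/2))\<bar> \<le> (h' (1/2) / 2 - h' (0/2) / 2) * (1/2) ^ Suc c * (1/2) ^ Suc b'"
      by (rule Suc.IH[OF cJ(1) b cJ(2) d0]) (auto intro!: monoI m)
    moreover have "\<bar>walsh_coeff L (shift_set J) (\<lambda>x. h ((x+1)/2))\<bar> \<le> (h' ((1+1)/2) / 2 - h' ((0+1)/2) / 2) * (1/2) ^ Suc c * (1/2) ^ Suc b'"
      by (rule Suc.IH[OF cJ(1) b cJ(2) d1]) (auto intro!: monoI m)
    ultimately have "\<bar>walsh_coeff L (shift_set J) (\<lambda>x. h (x/2))\<bar> + \<bar>walsh_coeff L (shift_set J) (\<lambda>x. h ((x+1)/2))\<bar>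
       \<le> (h' 1 - h' 0) / 2 * (1/2) ^ Suc c * (1/2) ^ Suc b'"
      by (simp add: field_simps)
    then show ?thesis
      using walsh_coeff_Suc_le[of L J h] unfolding Suc c by simp
  qed
qed

text \<open>With order 2 only the two largest elements count. In the last case
  \<open>J \<subseteq> insert a {..b}\<close> records that \<open>a\<close> and \<open>b\<close> are
  these two.\<close>

lemma top_sum_cases:
  assumes "finite J"
  obtains "J = {}" "top_sum 2 J = 0"
  | a where "J = {a}" "top_sum 2 J = a"
  | a b where "a \<in> J" "b \<in> J" "b < a" "J \<subseteq> insert a {..b}" "top_sum 2 J = a + b"
proof -
  consider "J = {}" | a where "J = {a}" | "J \<noteq> {}" "J - {Max J} \<noteq> {}" by blast
  then show thesis
  proof cases
    case 1
    then show thesis using that(1) by (simp add: top_sum_def)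
  next
    case 2
    moreover have "{k. k = a \<and> a < k} = {}" by auto
    ultimately have "{j \<in> J. card {k \<in> J. j < k} < 2} = {a}" by (auto simp del: Collect_empty_eq)
    then show thesis using that(2)[OF 2] by (simp add: top_sum_def del: Collect_empty_eq)
  next
    case 3
    define a where "a = Max J"
    define b where "b = Max (J - {a})"
    have a: "a \<in> J" "\<And>c. c \<in> J \<Longrightarrow> c \<le> a" using assms 3 by (auto simp: a_def)
    have b: "b \<in> J - {a}" "\<And>c. c \<in> J - {a} \<Longrightarrow> c \<le> b"
      using assms 3 unfolding b_def a_def by (auto intro!: Max_in Max_ge simp del: Diff_iff)
    have ba: "b < a" using a b by (metis Diff_iff insertCI le_neq_implies_less)
    have "{j \<in> J. card {k \<in> J. j < k} < 2} = {a, b}"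
    proof (intro equalityI subsetI)
      fix j assume j: "j \<in> {j \<in> J. card {k \<in> J. j < k} < 2}"
      show "j \<in> {a, b}"
      proof (rule ccontr)
        assume "j \<notin> {a, b}"
        then have "{a, b} \<subseteq> {k \<in> J. j < k}"
          using a b j by (auto simp: order.not_eq_order_implies_strict)
        then have "card {a, b} \<le> card {k \<in> J. j < k}"
          using assms by (intro card_mono) auto
        then show False using j ba by simp
      qed
    next
      fix j assume "j \<in> {a, b}"
      moreover have "{k \<in> J. a < k} = {}" using a(2) by force
      then have "card {k \<in> J. a < k} = 0" by (simp only: card.empty)
      moreover have "{k \<in> J. b < k} \<subseteq> {a}" using b(2) by force
      then have "card {k \<in> J. b < k} \<le> 1" using card_mono[of "{a}"] by fastforce
      ultimately show "j \<in> {j \<in> J. card {k \<in> J. j < k} < 2}"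
        using a b by auto
    qed
    then have "top_sum 2 J = a + b" using ba by (simp add: top_sum_def)
    moreover have "J \<subseteq> insert a {..b}" using b(2) by auto
    ultimately show thesis using that(3)[of a b] a b ba by auto
  qed
qed

text \<open>Convexity is expressed by a monotone derivative, and nothing is asked of a second
  derivative. On the unit interval the slope then has total variation at most \<open>2 * C\<close>,
  a bound that stays uniform as the smoothing parameter of the kernels tends to 0.\<close>

definition smooth_convex :: "real \<Rightarrow> (real \<Rightarrow> real) \<Rightarrow> bool" where
  "smooth_convex C h \<longleftrightarrow> (\<exists>h'. (\<forall>x. (h has_real_derivative h' x) (at x)) \<and> mono h' \<and>
     (\<forall>x. 0 \<le> x \<longrightarrow> x \<le> 1 \<longrightarrow> \<bar>h x\<bar> \<le> C \<and> \<bar>h' x\<bar> \<le> C))"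

text \<open>No digit: sup bound; one digit: Lipschitz bound for the folded function. With two digits
  the first position is split off: on the two halves the tent is \<open>1 - x\<close> and
  \<open>x\<close>, so \<open>h\<close> and its reflection remain, both convex. Moving both leading
  digits down by one position costs a factor 4 and the slope range is at most \<open>2 * C\<close>,
  which gives the 8.\<close>

lemma walsh_coeff_tent:
  assumes h: "smooth_convex C h" and J: "J \<subseteq> {..<L}"
  shows "\<bar>walsh_coeff L J (\<lambda>y. h \<bar>2 * y - 1\<bar>)\<bar> \<le> 8 * C * (1/2) ^ top_sum 2 (Suc ` J)"
proof -
  obtain h' where d: "\<And>x. (h has_real_derivative h' x) (at x)" and mono: "mono h'"
    and bd: "\<And>x. 0 \<le> x \<Longrightarrow> x \<le> 1 \<Longrightarrow> \<bar>h x\<bar> \<le> C" "\<And>x. 0 \<le> x \<Longrightarrow> x \<le> 1 \<Longrightarrow> \<bar>h' x\<bar> \<le> C"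
    using h unfolding smooth_convex_def by blast
  have C: "C \<ge> 0" using bd(1)[of 0] by simp
  have fin: "finite (Suc ` J)" using J finite_subset by blast
  have tent_Lip: "\<bar>h \<bar>2 * x - 1\<bar> - h \<bar>2 * y - 1\<bar>\<bar> \<le> 2 * C * (y - x)" if "0 \<le> x" "x \<le> y" "y \<le> 1" for x y
  proof -
    have "\<bar>h u - h v\<bar> \<le> C * \<bar>u - v\<bar>" if "0 \<le> u" "u \<le> 1" "0 \<le> v" "v \<le> 1" for u v
      using Lipschitz_from_deriv[OF d bd(2), of u v] Lipschitz_from_deriv[OF d bd(2), of v u] that
      by (cases "u \<le> v") (auto simp: abs_minus_commute)
    from this[of "\<bar>2 * x - 1\<bar>" "\<bar>2 * y - 1\<bar>"]
    have "\<bar>h \<bar>2 * x - 1\<bar> - h \<bar>2 * y - 1\<bar>\<bar> \<le> C * \<bar>\<bar>2 * x - 1\<bar> - \<bar>2 * y - 1\<bar>\<bar>"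
      using that by auto
    also have "\<dots> \<le> C * (2 * (y - x))"
      using that C by (intro mult_left_mono) auto
    finally show ?thesis by (simp add: algebra_simps)
  qed
  show ?thesis
    using fin
  proof (cases rule: top_sum_cases)
    case 1
    have "\<bar>walsh_coeff L J (\<lambda>y. h \<bar>2 * y - 1\<bar>)\<bar> \<le> C"
      by (rule walsh_coeff_bound) (use bd in auto)
    then show ?thesis using 1 C by simp
  next
    case (2 a)
    then obtain c where c: "c \<in> J" "a = Suc c" by auto
    have "\<bar>walsh_coeff L J (\<lambda>y. h \<bar>2 * y - 1\<bar>)\<bar> \<le> 2 * C * (1/2) ^ Suc c"
      by (rule walsh_coeff_Lipschitz) (use c J tent_Lip in auto)
    also have "\<dots> \<le> 8 * C * (1/2) ^ Suc c" using C by (intro mult_right_mono) auto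
    finally show ?thesis using 2 c by simp
  next
    case (3 a' b')
    from 3(1,2) obtain a b where ab: "a \<in> J" "b \<in> J" "a' = Suc a" "b' = Suc b" by blast
    then have "b < a" using 3(3) by simp
    note ab = this ab
    obtain K c where c: "L = Suc K" "a = Suc c" "c < K"
    proof (cases a)
      case (Suc c)
      then show thesis using that[of "L - 1" c] ab(2) J by (cases L) auto
    qed (use ab in simp)
    have cJ: "c \<in> shift_set J" using ab c by (auto simp: shift_set_def)
    have dr: "((\<lambda>x. h (1 - x)) has_real_derivative - h' (1 - x)) (at x)" for x
      by (rule DERIV_chain2[OF d, of "\<lambda>x. 1 - x" "-1" x, simplified]) (auto intro!: derivative_eq_intros)
    have mr: "mono (\<lambda>x. - h' (1 - x))" using mono by (auto simp: mono_def)
    have e0: "walsh_coeff K (shift_set J) (\<lambda>x. h \<bar>2 * (x/2) - 1\<bar>) = walsh_coeff K (shift_set J) (\<lambda>x. h (1 - x))"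
      by (rule walsh_coeff_cong) auto
    have e1: "walsh_coeff K (shift_set J) (\<lambda>x. h \<bar>2 * ((x+1)/2) - 1\<bar>) = walsh_coeff K (shift_set J) h"
      by (rule walsh_coeff_cong) (simp add: add_divide_distrib)
    have "\<bar>walsh_coeff K (shift_set J) (\<lambda>x. h (1 - x))\<bar> \<le> 8 * C * (1/2) ^ Suc a * (1/2) ^ Suc b \<and>
          \<bar>walsh_coeff K (shift_set J) h\<bar> \<le> 8 * C * (1/2) ^ Suc a * (1/2) ^ Suc b"
    proof (cases b)
      case 0
      \<comment> \<open>Here \<open>b\<close> is the digit already consumed by the fold. It accounts
        only for a constant factor, so the Lipschitz bound at the remaining digit is enough.\<close>
      have "\<bar>walsh_coeff K (shift_set J) (\<lambda>x. h (1 - x))\<bar> \<le> C * (1/2) ^ Suc c"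
        by (rule walsh_coeff_Lipschitz[OF cJ c(3) Lipschitz_from_deriv[OF dr]]) (use bd in auto)
      moreover have "\<bar>walsh_coeff K (shift_set J) h\<bar> \<le> C * (1/2) ^ Suc c"
        by (rule walsh_coeff_Lipschitz[OF cJ c(3) Lipschitz_from_deriv[OF d]]) (use bd in auto)
      ultimately show ?thesis using 0 c C by (simp add: field_simps)
    next
      case (Suc e)
      then have e: "e \<in> shift_set J" "e < c" using ab c by (auto simp: shift_set_def)
      have S: "h' 1 - h' 0 \<le> 2 * C" using bd(2)[of 0] bd(2)[of 1] by auto
      have up: "(h' 1 - h' 0) * (1/2) ^ Suc c * (1/2) ^ Suc e \<le> 2 * C * (1/2) ^ Suc c * (1/2) ^ Suc e"
        using S by (intro mult_right_mono) auto
      have "\<bar>walsh_coeff K (shift_set J) (\<lambda>x. h (1 - x))\<bar> \<le> (h' 1 - h' 0) * (1/2) ^ Suc c * (1/2) ^ Suc e"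
        using walsh_coeff_convex[OF cJ e c(3) dr mr] by simp
      then have "\<bar>walsh_coeff K (shift_set J) (\<lambda>x. h (1 - x))\<bar> \<le> 2 * C * (1/2) ^ Suc c * (1/2) ^ Suc e"
        using up by (rule order_trans)
      moreover have "\<bar>walsh_coeff K (shift_set J) h\<bar> \<le> 2 * C * (1/2) ^ Suc c * (1/2) ^ Suc e"
        using walsh_coeff_convex[OF cJ e c(3) d mono] up by (rule order_trans)
      moreover have "8 * C * (1/2) ^ Suc a * (1/2) ^ Suc b = 2 * C * (1/2) ^ Suc c * (1/2) ^ Suc e"
        by (simp add: Suc c)
      ultimately show ?thesis by (simp only: simp_thms)
    qed
    note b01 = conjunct1[OF this] conjunct2[OF this]
    have "\<bar>walsh_coeff L J (\<lambda>y. h \<bar>2 * y - 1\<bar>)\<bar> \<le> 8 * C * (1/2) ^ Suc a * (1/2) ^ Suc b"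
      using b01 walsh_coeff_Suc_le[of K J "\<lambda>y. h \<bar>2 * y - 1\<bar>"] unfolding c(1) e0 e1 by simp
    then show ?thesis using 3 ab by (simp add: power_add)
  qed
qed

section \<open>The dual net\<close>

definition digit_sets :: "nat \<Rightarrow> ('d::finite \<Rightarrow> nat set) set" where
  "digit_sets L = PiE UNIV (\<lambda>_. Pow {..<L})"

lemma digit_sets_iff: "A \<in> digit_sets L \<longleftrightarrow> (\<forall>i. A i \<subseteq> {..<L})"
  by (auto simp: digit_sets_def PiE_iff)

lemma finite_digit_sets: "finite (digit_sets L :: ('d::finite \<Rightarrow> nat set) set)"
  by (simp add: digit_sets_def finite_PiE)

section \<open>Finite Walsh inversion and characters of the net\<close>

lemma sum_Pow_prod:
  fixes \<epsilon> :: "'a \<Rightarrow> real"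
  assumes "finite U"
  shows "(\<Sum>T\<in>Pow U. \<Prod>l\<in>T. \<epsilon> l) = (\<Prod>l\<in>U. 1 + \<epsilon> l)"
  using prod_add[OF assms, of \<epsilon> "\<lambda>_. 1"] by (simp add: add.commute[of 1])

lemma sign_card_Int:
  assumes "finite T"
  shows "(-1) ^ card (A \<inter> T) = (\<Prod>l\<in>T. if l \<in> A then -1 else (1::real))"
  using prod.inter_restrict[OF assms, of "\<lambda>_. -1::real" A] by (simp add: Int_commute)

text \<open>The sum over \<open>T\<close> factorises over positions; a position where
  \<open>A\<close> and \<open>B\<close> differ contributes 1 - 1 = 0, every other position
  contributes 2.\<close>

lemma walsh_orthogonal:
  assumes "A \<subseteq> {..<L}" "B \<subseteq> {..<L}"
  shows "(\<Sum>T\<in>Pow {..<L}. (-1) ^ card (A \<inter> T) * (-1) ^ card (B \<inter> T)) = (if A = B then 2 ^ L else (0::real))"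
proof -
  have "(\<Sum>T\<in>Pow {..<L}. (-1) ^ card (A \<inter> T) * (-1) ^ card (B \<inter> T))
      = (\<Sum>T\<in>Pow {..<L}. \<Prod>l\<in>T. (if l \<in> A then -1 else 1) * (if l \<in> B then -1 else (1::real)))"
  proof (rule sum.cong[OF refl])
    fix T assume "T \<in> Pow {..<L}"
    then have "finite T" using finite_subset by auto
    then show "(-1) ^ card (A \<inter> T) * (-1) ^ card (B \<inter> T) = (\<Prod>l\<in>T. (if l \<in> A then -1 else 1) * (if l \<in> B then -1 else (1::real)))"
      by (simp only: sign_card_Int prod.distrib)
  qed
  also have "\<dots> = (\<Prod>l<L. 1 + (if l \<in> A then -1 else 1) * (if l \<in> B then -1 else (1::real)))"
    by (rule sum_Pow_prod) simp
  also have "\<dots> = (if A = B then 2 ^ L else 0)"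
  proof (cases "A = B")
    case True
    have "(\<Prod>l<L. 1 + (if l \<in> A then -1 else 1) * (if l \<in> A then -1 else (1::real))) = (\<Prod>l<L. 2)"
      by (rule prod.cong) auto
    then show ?thesis using True by simp
  next
    case False
    then obtain l where "(l \<in> A) \<noteq> (l \<in> B)" by blast
    then have z: "l < L" "1 + (if l \<in> A then -1 else 1) * (if l \<in> B then -1 else (1::real)) = 0"
      using assms by auto
    have "\<exists>l\<in>{..<L}. 1 + (if l \<in> A then -1 else 1) * (if l \<in> B then -1 else (1::real)) = 0"
      using z by (intro bexI[of _ l]) auto
    then show ?thesis using False prod_zero[OF finite_lessThan] by simp
  qed
  finally show ?thesis .
qed

text \<open>Exact at the \<open>2 ^ L\<close> midpoints for an arbitrary \<open>h\<close>, so no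
  convergence of Walsh series has to be discussed.\<close>

lemma walsh_inversion:
  assumes "A \<subseteq> {..<L}"
  shows "h (pt L A) = (\<Sum>T\<in>Pow {..<L}. walsh_coeff L T h * (-1) ^ card (A \<inter> T))"
proof -
  have "(\<Sum>T\<in>Pow {..<L}. walsh_coeff L T h * (-1) ^ card (A \<inter> T))
     = (\<Sum>T\<in>Pow {..<L}. \<Sum>B\<in>Pow {..<L}. h (pt L B) / 2 ^ L * ((-1) ^ card (B \<inter> T) * (-1) ^ card (A \<inter> T)))"
    unfolding walsh_coeff_def sum_divide_distrib sum_distrib_right
    by (intro sum.cong refl) (simp add: algebra_simps)
  also have "\<dots> = (\<Sum>B\<in>Pow {..<L}. h (pt L B) / 2 ^ L * (\<Sum>T\<in>Pow {..<L}. (-1) ^ card (B \<inter> T) * (-1) ^ card (A \<inter> T)))"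
    by (subst sum.swap) (simp add: sum_distrib_left)
  also have "\<dots> = (\<Sum>B\<in>Pow {..<L}. if B = A then h (pt L B) else 0)"
    by (rule sum.cong[OF refl]) (use assms in \<open>simp add: walsh_orthogonal\<close>)
  also have "\<dots> = h (pt L A)"
    using assms by (simp add: sum.delta')
  finally show ?thesis by simp
qed

definition net_row :: "nat \<Rightarrow> ('d \<Rightarrow> nat \<Rightarrow> nat \<Rightarrow> bool) \<Rightarrow> nat \<Rightarrow> 'd \<times> nat \<Rightarrow> bool" where
  "net_row n Cm r p \<longleftrightarrow> snd p < 2 * n \<and> Cm (fst p) (Suc (snd p)) r"

text \<open>Rows beyond \<open>2 * n\<close> are treated as zero, since net points have no digits there.\<close>

definition dual_net :: "nat \<Rightarrow> ('d::finite \<Rightarrow> nat \<Rightarrow> nat \<Rightarrow> bool) \<Rightarrow> nat \<Rightarrow> ('d \<Rightarrow> nat set) set" where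
  "dual_net n Cm L = {T \<in> digit_sets L. \<forall>r<n. even (card {p \<in> Sigma UNIV T. net_row n Cm r p})}"

definition net_digits :: "nat \<Rightarrow> ('d \<Rightarrow> nat \<Rightarrow> nat \<Rightarrow> bool) \<Rightarrow> nat \<Rightarrow> 'd \<Rightarrow> nat set" where
  "net_digits n Cm k i = {l. l < 2 * n \<and> digit n Cm i (Suc l) k}"

lemma net_digits_in: "2 * n \<le> L \<Longrightarrow> net_digits n Cm k \<in> digit_sets L"
  by (auto simp: digit_sets_iff net_digits_def)

text \<open>Turns a sum over indices \<open>k\<close> into a sum over subsets of binary digits,
  which then factorises.\<close>

lemma bij_betw_set_decode: "bij_betw set_decode {..<2 ^ n} (Pow {..<n})"
proof -
  have inj: "inj_on set_decode {..<2 ^ n}" by (metis inj_onI set_decode_inverse)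
  have sub: "set_decode ` {..<2 ^ n} \<subseteq> Pow {..<n}"
  proof clarify
    fix k r assume k: "k < 2 ^ n" and r: "r \<in> set_decode k"
    have "k div 2 ^ r \<noteq> 0" using r by (intro notI) (simp add: set_decode_def)
    then have "2 ^ r \<le> k" by (metis div_less not_le)
    then have "(2::nat) ^ r < 2 ^ n" using k by (rule le_less_trans)
    then show "r < n" by simp
  qed
  have "set_decode ` {..<2 ^ n} = Pow {..<n}"
    by (rule card_subset_eq[OF _ sub]) (simp_all add: card_image[OF inj] card_Pow)
  with inj show ?thesis by (simp add: bij_betw_def)
qed

text \<open>The digits of net points depend linearly on the binary digits of \<open>k\<close>, so
  the character of \<open>T\<close> is the product of signs \<open>\<epsilon> r\<close> over the
  digits \<open>r\<close> set in \<open>k\<close>. The sum becomes the product of the factors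
  \<open>1 + \<epsilon> r\<close>, which vanishes unless the rows selected by \<open>T\<close> add
  up to zero in every column.\<close>

lemma net_character_sum:
  fixes Cm :: "'d::finite \<Rightarrow> nat \<Rightarrow> nat \<Rightarrow> bool"
  assumes T: "T \<in> digit_sets L"
  shows "(\<Sum>k<2 ^ n. \<Prod>i\<in>UNIV. (-1) ^ card (net_digits n Cm k i \<inter> T i)) = (if T \<in> dual_net n Cm L then 2 ^ n else (0::real))"
proof -
  have fT: "finite (T i)" for i using T finite_subset[of "T i" "{..<L}"] by (simp add: digit_sets_iff)
  have fS: "finite (Sigma UNIV T)" using fT by auto
  define \<epsilon> :: "nat \<Rightarrow> real" where "\<epsilon> r = (\<Prod>p\<in>Sigma UNIV T. if net_row n Cm r p then -1 else 1)" for r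
  have eps: "\<epsilon> r = (-1) ^ card {p \<in> Sigma UNIV T. net_row n Cm r p}" for r
    unfolding \<epsilon>_def using sign_card_Int[OF fS, of "{p. net_row n Cm r p}"]
    by (simp add: Int_def conj_commute)
  have dig: "(if l \<in> net_digits n Cm k i then -1 else (1::real)) = (\<Prod>r\<in>set_decode k. if net_row n Cm r (i, l) then -1 else 1)"
    if "k < 2 ^ n" for k i l
  proof (cases "l < 2 * n")
    case False
    then show ?thesis by (simp add: net_digits_def net_row_def)
  next
    case True
    have sub: "set_decode k \<subseteq> {..<n}" using that bij_betw_set_decode[of n] by (auto simp: bij_betw_def)
    have "(\<Prod>r\<in>set_decode k. if net_row n Cm r (i, l) then -1 else 1) = (-1::real) ^ card ({r. net_row n Cm r (i, l)} \<inter> set_decode k)"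
      by (subst sign_card_Int) auto
    also have "{r. net_row n Cm r (i, l)} \<inter> set_decode k = {r. r < n \<and> Cm i (Suc l) r \<and> odd (k div 2 ^ r)}"
      using sub True by (auto simp: net_row_def set_decode_def)
    finally show ?thesis using True by (simp add: net_digits_def digit_def)
  qed
  have "(\<Prod>i\<in>UNIV. (-1::real) ^ card (net_digits n Cm k i \<inter> T i)) = (\<Prod>r\<in>set_decode k. \<epsilon> r)" if "k < 2 ^ n" for k
  proof -
    have "(\<Prod>i\<in>UNIV. (-1::real) ^ card (net_digits n Cm k i \<inter> T i))
        = (\<Prod>i\<in>UNIV. \<Prod>l\<in>T i. \<Prod>r\<in>set_decode k. if net_row n Cm r (i, l) then -1 else 1)"
      by (simp only: sign_card_Int[OF fT] dig[OF that])
    also have "\<dots> = (\<Prod>p\<in>Sigma UNIV T. \<Prod>r\<in>set_decode k. if net_row n Cm r p then -1 else 1)"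
      by (subst prod.Sigma) (use fT in \<open>auto simp: split_def\<close>)
    also have "\<dots> = (\<Prod>r\<in>set_decode k. \<epsilon> r)"
      unfolding \<epsilon>_def by (rule prod.swap)
    finally show ?thesis .
  qed
  then have "(\<Sum>k<2 ^ n. \<Prod>i\<in>UNIV. (-1) ^ card (net_digits n Cm k i \<inter> T i)) = (\<Sum>k<2 ^ n. \<Prod>r\<in>set_decode k. \<epsilon> r)"
    by simp
  also have "\<dots> = (\<Sum>K\<in>Pow {..<n}. \<Prod>r\<in>K. \<epsilon> r)"
    by (rule sum.reindex_bij_betw[OF bij_betw_set_decode])
  also have "\<dots> = (\<Prod>r<n. 1 + \<epsilon> r)"
    by (rule sum_Pow_prod) simp
  also have "\<dots> = (if T \<in> dual_net n Cm L then 2 ^ n else 0)"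
  proof (cases "T \<in> dual_net n Cm L")
    case True
    then have "(\<Prod>r<n. 1 + \<epsilon> r) = (\<Prod>r<n. 2)"
      by (intro prod.cong) (auto simp: eps dual_net_def)
    then show ?thesis using True by simp
  next
    case False
    then obtain r where "r < n" "odd (card {p \<in> Sigma UNIV T. net_row n Cm r p})"
      using T by (auto simp: dual_net_def)
    then have "r < n" "1 + \<epsilon> r = 0" by (auto simp: eps)
    then show ?thesis using False by (auto intro!: prod_zero)
  qed
  finally show ?thesis .
qed

text \<open>Inversion is inserted in every coordinate and the product of sums is expanded; by
  \<open>net_character_sum\<close> only dual elements survive. The term of the zero element is
  exactly the grid average, so subtracting that average removes it.\<close>

lemma net_error_expansion:
  fixes Cm :: "'d::finite \<Rightarrow> nat \<Rightarrow> nat \<Rightarrow> bool" and h :: "'d \<Rightarrow> real \<Rightarrow> real"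
  assumes L: "2 * n \<le> L"
  shows "(\<Sum>k<2 ^ n. \<Prod>i\<in>UNIV. h i (pt L (net_digits n Cm k i))) / 2 ^ n
       - (\<Sum>A\<in>digit_sets L. \<Prod>i\<in>UNIV. h i (pt L (A i))) / 2 ^ (L * CARD('d))
       = (\<Sum>T\<in>dual_net n Cm L - {\<lambda>_. {}}. \<Prod>i\<in>UNIV. walsh_coeff L (T i) (h i))"
proof -
  define w where "w T = (\<Prod>i\<in>UNIV. walsh_coeff L (T i) (h i))" for T
  have "(\<Sum>k<2 ^ n. \<Prod>i\<in>UNIV. h i (pt L (net_digits n Cm k i)))
      = (\<Sum>k<2 ^ n. \<Sum>T\<in>digit_sets L. w T * (\<Prod>i\<in>UNIV. (-1) ^ card (net_digits n Cm k i \<inter> T i)))"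
  proof (rule sum.cong[OF refl])
    fix k
    have "h i (pt L (net_digits n Cm k i)) = (\<Sum>T\<in>Pow {..<L}. walsh_coeff L T (h i) * (-1) ^ card (net_digits n Cm k i \<inter> T))" for i
      by (rule walsh_inversion) (use net_digits_in[OF L, of Cm k] in \<open>auto simp: digit_sets_iff\<close>)
    then show "(\<Prod>i\<in>UNIV. h i (pt L (net_digits n Cm k i))) = (\<Sum>T\<in>digit_sets L. w T * (\<Prod>i\<in>UNIV. (-1) ^ card (net_digits n Cm k i \<inter> T i)))"
      by (simp add: prod_sum_PiE digit_sets_def w_def prod.distrib)
  qed
  also have "\<dots> = (\<Sum>T\<in>digit_sets L. w T * (\<Sum>k<2 ^ n. \<Prod>i\<in>UNIV. (-1) ^ card (net_digits n Cm k i \<inter> T i)))"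
    by (subst sum.swap) (simp add: sum_distrib_left)
  also have "\<dots> = (\<Sum>T\<in>digit_sets L. if T \<in> dual_net n Cm L then w T * 2 ^ n else 0)"
    by (rule sum.cong[OF refl]) (simp add: net_character_sum)
  also have "\<dots> = (\<Sum>T\<in>dual_net n Cm L. w T) * 2 ^ n"
    by (subst sum.inter_restrict[symmetric])
      (auto simp: finite_digit_sets sum_distrib_right dual_net_def intro!: sum.cong)
  finally have 1: "(\<Sum>k<2 ^ n. \<Prod>i\<in>UNIV. h i (pt L (net_digits n Cm k i))) / 2 ^ n = (\<Sum>T\<in>dual_net n Cm L. w T)"
    by simp
  have "w (\<lambda>_. {}) = (\<Prod>i\<in>UNIV. (\<Sum>A\<in>Pow {..<L}. h i (pt L A))) / 2 ^ (L * CARD('d))"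
    by (simp add: w_def walsh_coeff_def prod_dividef power_mult)
  also have "(\<Prod>i\<in>UNIV. (\<Sum>A\<in>Pow {..<L}. h i (pt L A))) = (\<Sum>A\<in>digit_sets L. \<Prod>i\<in>UNIV. h i (pt L (A i)))"
    by (simp add: prod_sum_PiE digit_sets_def)
  finally have 2: "(\<Sum>A\<in>digit_sets L. \<Prod>i\<in>UNIV. h i (pt L (A i))) / 2 ^ (L * CARD('d)) = w (\<lambda>_. {})" by simp
  have "(\<lambda>_. {}) \<in> dual_net n Cm L" "finite (dual_net n Cm L)"
    using finite_digit_sets[where 'd = 'd, of L] by (simp_all add: dual_net_def) (simp add: digit_sets_iff)
  then show ?thesis
    unfolding 1 2 by (simp add: sum_diff1 w_def)
qed

text \<open>The order 2 digit weight, a higher order relative of the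
  Niederreiter-Rosenbloom-Tsfasman weight. \<open>Suc\<close> returns to the 1-based positions in
  which \<open>top_sum\<close> is formulated.\<close>

definition weight2 :: "('d::finite \<Rightarrow> nat set) \<Rightarrow> nat" where
  "weight2 T = (\<Sum>i\<in>UNIV. top_sum 2 (Suc ` T i))"

text \<open>Addition over the two-element field, with digit vectors encoded as sets.\<close>

definition symdiff :: "('d \<Rightarrow> nat set) \<Rightarrow> ('d \<Rightarrow> nat set) \<Rightarrow> 'd \<Rightarrow> nat set" where
  "symdiff S T i = (S i - T i) \<union> (T i - S i)"

lemma even_card_symdiff:
  assumes "finite A" "finite B" "even (card A)" "even (card B)"
  shows "even (card ((A - B) \<union> (B - A)))"
proof -
  have "card A = card (A - B) + card (A \<inter> B)" "card B = card (B - A) + card (A \<inter> B)"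
    using card_Diff_subset_Int[of A B] card_Diff_subset_Int[of B A] card_mono[of A "A \<inter> B"] card_mono[of B "A \<inter> B"] assms
    by (simp_all add: Int_commute)
  moreover have "card ((A - B) \<union> (B - A)) = card (A - B) + card (B - A)"
    using assms by (intro card_Un_disjoint) auto
  ultimately show ?thesis using assms(3,4) by presburger
qed

text \<open>Linearity of the dual net. It upgrades a minimal weight to a minimal distance between
  distinct elements.\<close>

lemma symdiff_dual_net:
  assumes "S \<in> dual_net n Cm L" "T \<in> dual_net n Cm L"
  shows "symdiff S T \<in> dual_net n Cm L"
proof -
  have dig: "S \<in> digit_sets L" "T \<in> digit_sets L" using assms by (auto simp: dual_net_def)
  then have fin: "finite (Sigma UNIV S)" "finite (Sigma UNIV T)"
    unfolding digit_sets_iff by (intro finite_SigmaI finite; blast intro: finite_subset[OF _ finite_lessThan])+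
  have "even (card {p \<in> Sigma UNIV (symdiff S T). net_row n Cm r p})" if "r < n" for r
  proof -
    let ?A = "{p \<in> Sigma UNIV S. net_row n Cm r p}" and ?B = "{p \<in> Sigma UNIV T. net_row n Cm r p}"
    have "{p \<in> Sigma UNIV (symdiff S T). net_row n Cm r p} = (?A - ?B) \<union> (?B - ?A)"
      by (auto simp: symdiff_def)
    then show ?thesis
      using even_card_symdiff[of ?A ?B] fin assms that by (auto simp: dual_net_def)
  qed
  moreover have "symdiff S T \<in> digit_sets L"
    using dig unfolding digit_sets_iff symdiff_def by blast
  ultimately show ?thesis by (simp add: dual_net_def)
qed

lemma le_top_sum:
  assumes "finite J" "l \<in> J"
  shows "l \<le> top_sum 2 J"
  using assms(1)
proof (cases rule: top_sum_cases)
  case (3 a b)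
  then show ?thesis using assms(2) by auto
qed (use assms(2) in auto)

text \<open>All elements but the largest lie in \<open>{1..b}\<close>, and \<open>b < a\<close> with
  \<open>a + b \<le> 2 * n\<close> forces \<open>b < n\<close>. This supplies the cardinality
  condition in the definition of a net.\<close>

lemma top_sum_ge_card:
  assumes "finite J" "0 \<notin> J" "top_sum 2 J \<le> 2 * n"
  shows "card J \<le> n"
  using assms(1)
proof (cases rule: top_sum_cases)
  case (2 a)
  then show ?thesis using assms by auto
next
  case (3 a b)
  have "J \<subseteq> insert a {1..b}"
  proof
    fix x assume "x \<in> J"
    then have "x \<in> insert a {..b}" "x \<noteq> 0" using 3(4) assms(2) by (blast, metis)
    then show "x \<in> insert a {1..b}" by auto
  qed
  then have "card J \<le> card (insert a {1..b})" by (intro card_mono) auto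
  also have "\<dots> \<le> Suc b" by (simp add: card_insert_if)
  finally show ?thesis using 3 assms(3) by linarith
qed simp

text \<open>A nonzero dual element of small weight would select an admissible, hence independent,
  family of rows, while duality says that these rows add up to zero.\<close>

lemma dual_net_weight:
  fixes Cm :: "'d::finite \<Rightarrow> nat \<Rightarrow> nat \<Rightarrow> bool"
  assumes net: "is_order_digital_net 2 t n Cm" and T: "T \<in> dual_net n Cm L" "T \<noteq> (\<lambda>_. {})"
  shows "weight2 T > 2 * n - t"
proof (rule ccontr)
  assume "\<not> weight2 T > 2 * n - t"
  then have le: "weight2 T \<le> 2 * n - t" by simp
  define J where "J i = Suc ` T i" for i
  have fT: "finite (T i)" for i using T finite_subset[of "T i" "{..<L}"] by (simp add: dual_net_def digit_sets_iff)
  have fJ: "finite (J i)" for i using fT by (simp add: J_def)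
  have top: "top_sum 2 (J i) \<le> weight2 T" for i
    unfolding weight2_def J_def by (rule member_le_sum) auto
  obtain i0 l0 where l0: "l0 \<in> T i0" using T(2) by fastforce
  have "Suc l0 \<le> weight2 T"
    using le_top_sum[OF fJ, of "Suc l0" i0] top[of i0] l0 by (auto simp: J_def)
  \<comment> \<open>The natural subtraction \<open>2 * n - t\<close> might be truncated to 0. Since
    the weight is at least \<open>Suc l0\<close>, the assumption rules this out, and the bound can
    be read over the integers as the net property requires.\<close>
  then have tn: "t \<le> 2 * n" using le by linarith
  have "J i \<subseteq> {1..2 * n}" for i
  proof
    fix l assume l: "l \<in> J i"
    then have "l \<le> 2 * n" using le_top_sum[OF fJ l] top[of i] le by linarith
    then show "l \<in> {1..2 * n}" using l by (auto simp: J_def)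
  qed
  moreover have "card (J i) \<le> n" for i
    by (rule top_sum_ge_card[OF fJ]) (use top[of i] le in \<open>auto simp: J_def\<close>)
  moreover have "int (\<Sum>i\<in>UNIV. top_sum 2 (J i)) \<le> int (2 * n) - int t"
    using le tn unfolding weight2_def J_def by linarith
  ultimately have "rows_independent n Cm (Sigma UNIV J)"
    using net unfolding is_order_digital_net_def by blast
  moreover have "Sigma UNIV J \<noteq> {}" using l0 unfolding J_def by blast
  ultimately obtain r where r: "r < n" "odd (card {p \<in> Sigma UNIV J. Cm (fst p) (snd p) r})"
    unfolding rows_independent_def by blast
  have "bij_betw (\<lambda>p. (fst p, Suc (snd p))) {p \<in> Sigma UNIV T. net_row n Cm r p} {p \<in> Sigma UNIV J. Cm (fst p) (snd p) r}"
  proof (rule bij_betw_imageI)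
    show "inj_on (\<lambda>p. (fst p, Suc (snd p))) {p \<in> Sigma UNIV T. net_row n Cm r p}"
      by (auto simp: inj_on_def prod_eq_iff)
    \<comment> \<open>All positions lie below the cutoff in \<open>net_row\<close>, so the cutoff
      discards nothing and both row families coincide up to the shift by one.\<close>
    have "l < 2 * n" if "l \<in> T i" for i l
      using \<open>\<And>i. J i \<subseteq> {1..2 * n}\<close>[of i] that by (auto simp: J_def)
    then show "(\<lambda>p. (fst p, Suc (snd p))) ` {p \<in> Sigma UNIV T. net_row n Cm r p} = {p \<in> Sigma UNIV J. Cm (fst p) (snd p) r}"
      by (auto simp: J_def net_row_def image_iff Bex_def)
  qed
  then have "card {p \<in> Sigma UNIV T. net_row n Cm r p} = card {p \<in> Sigma UNIV J. Cm (fst p) (snd p) r}"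
    by (rule bij_betw_same_card)
  then show False using r T by (auto simp: dual_net_def)
qed

section \<open>Summation over the dual net\<close>

text \<open>The default 0 stands for a missing digit; no confusion arises because it is applied to
  sets of 1-based positions.\<close>

definition top1 :: "nat set \<Rightarrow> nat" where
  "top1 J = (if J = {} then 0 else Max J)"

definition top2 :: "nat set \<Rightarrow> nat" where
  "top2 J = top1 (J - {top1 J})"

lemma top1_eqI: "finite J \<Longrightarrow> a \<in> J \<Longrightarrow> (\<And>c. c \<in> J \<Longrightarrow> c \<le> a) \<Longrightarrow> top1 J = a"
  by (auto simp: top1_def intro: Max_eqI)

text \<open>The membership statement recovers \<open>J\<close> from its largest element and its part
  up to the second largest one. The condition \<open>c \<noteq> 0\<close> discards the default value
  of an empty \<open>J\<close>.\<close>

lemma top12: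
  assumes J: "finite J" "0 \<notin> J"
  shows "top_sum 2 J = top1 J + top2 J" "top2 J \<le> top1 J"
    "c \<in> J \<longleftrightarrow> c \<in> J \<inter> {..top2 J} \<or> (c = top1 J \<and> c \<noteq> 0)"
proof -
  have "top_sum 2 J = top1 J + top2 J \<and> top2 J \<le> top1 J \<and>
    (c \<in> J \<longleftrightarrow> c \<in> J \<inter> {..top2 J} \<or> (c = top1 J \<and> c \<noteq> 0))"
    using J(1)
  proof (cases rule: top_sum_cases)
    case 1
    then show ?thesis by (auto simp: top1_def top2_def)
  next
    case (2 a)
    then show ?thesis using J(2) by (auto simp: top1_def top2_def)
  next
    case (3 a b)
    have 1: "top1 J = a" using J(1) 3 by (intro top1_eqI) auto
    have 2: "top2 J = b" unfolding top2_def 1 using J(1) 3 by (intro top1_eqI) auto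
    show ?thesis using 3 J(2) unfolding 1 2 by auto
  qed
  then show "top_sum 2 J = top1 J + top2 J" "top2 J \<le> top1 J"
    "c \<in> J \<longleftrightarrow> c \<in> J \<inter> {..top2 J} \<or> (c = top1 J \<and> c \<noteq> 0)" by auto
qed

lemma top_sum_le:
  assumes "J \<subseteq> {..c}"
  shows "top_sum 2 J \<le> 2 * c"
proof -
  have "finite J" using assms finite_subset by blast
  then show ?thesis by (cases rule: top_sum_cases) (use assms in auto)
qed

text \<open>Raises one coordinate that still has slack at a time. In \<open>card_fibre\<close> it
  distributes the cut levels among the coordinates.\<close>

lemma exists_le_with_sum:
  fixes b :: "'d::finite \<Rightarrow> nat"
  assumes "q \<le> (\<Sum>i\<in>UNIV. b i)"
  obtains c where "\<And>i. c i \<le> b i" "(\<Sum>i\<in>UNIV. c i) = q"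
  using assms
proof (induction q arbitrary: thesis)
  case 0
  show ?case by (rule 0(1)[of "\<lambda>_. 0"]) auto
next
  case (Suc q)
  then obtain c where c: "\<And>i. c i \<le> b i" "(\<Sum>i\<in>UNIV. c i) = q" by (metis Suc_leD)
  have "\<exists>i. c i < b i"
  proof (rule ccontr)
    assume "\<nexists>i. c i < b i"
    then have "(\<Sum>i\<in>UNIV. b i) \<le> (\<Sum>i\<in>UNIV. c i)" by (intro sum_mono) (simp add: not_less)
    then show False using c Suc.prems by simp
  qed
  then obtain i where i: "c i < b i" by blast
  show ?case
  proof (rule Suc.prems(1)[of "c(i := Suc (c i))"])
    show "(c(i := Suc (c i))) j \<le> b j" for j using c i by auto
    have "(\<Sum>j\<in>UNIV. (c(i := Suc (c i))) j) = Suc (c i) + (\<Sum>j\<in>UNIV - {i}. c j)"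
      by (subst sum.remove[of _ i]) auto
    also have "\<dots> = Suc (\<Sum>j\<in>UNIV. c j)" by (subst sum.remove[of UNIV i c]) auto
    finally show "(\<Sum>j\<in>UNIV. (c(i := Suc (c i))) j) = Suc q" using c by simp
  qed
qed

text \<open>Two elements with the same two leading digits per coordinate that also agree above \<open>c i\<close> differ
  only in digits up to \<open>c i\<close>, so their difference has weight at most \<open>2 * sum c\<close>, which is below the
  minimal distance.\<close>

lemma card_fibre:
  fixes D :: "('d::finite \<Rightarrow> nat set) set" and a b :: "'d \<Rightarrow> nat"
  assumes fin: "\<And>T i. T \<in> D \<Longrightarrow> finite (T i)"
    and sep: "\<And>S T. S \<in> D \<Longrightarrow> T \<in> D \<Longrightarrow> S \<noteq> T \<Longrightarrow> weight2 (symdiff S T) > M"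
    and pat: "\<And>T i. T \<in> D \<Longrightarrow> top1 (Suc ` T i) = a i" "\<And>T i. T \<in> D \<Longrightarrow> top2 (Suc ` T i) = b i"
  shows "card D \<le> 2 ^ ((\<Sum>i\<in>UNIV. b i) - M div 2)"
proof -
  \<comment> \<open>\<open>M div 2\<close> is the largest total for which \<open>2 * sum c\<close>
    stays within \<open>M\<close>; the minimum covers the case that the \<open>b i\<close> do not
    reach it.\<close>
  obtain c where c: "\<And>i. c i \<le> b i" "(\<Sum>i\<in>UNIV. c i) = min (\<Sum>i\<in>UNIV. b i) (M div 2)"
    using exists_le_with_sum[of "min (\<Sum>i\<in>UNIV. b i) (M div 2)" b] by auto
  define r where "r T = (\<lambda>i. Suc ` T i \<inter> {c i<..b i})" for T :: "'d \<Rightarrow> nat set"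
  have mem: "l \<in> T i \<longleftrightarrow> Suc l \<in> Suc ` T i \<inter> {..b i} \<or> Suc l = a i" if "T \<in> D" for T i l
    using top12(3)[of "Suc ` T i" "Suc l"] fin[OF that] pat[OF that] by auto
  have "inj_on r D"
  proof (rule inj_onI, rule ccontr)
    fix S T assume ST: "S \<in> D" "T \<in> D" "r S = r T" "S \<noteq> T"
    have rr: "Suc l \<in> Suc ` S i \<inter> {c i<..b i} \<longleftrightarrow> Suc l \<in> Suc ` T i \<inter> {c i<..b i}" for i l
      using ST(3) unfolding r_def by metis
    have "Suc ` symdiff S T i \<subseteq> {..c i}" for i
    proof
      fix k assume "k \<in> Suc ` symdiff S T i"
      then obtain l where l: "k = Suc l" "(l \<in> S i) \<noteq> (l \<in> T i)" by (auto simp: symdiff_def)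
      then have "Suc l \<le> b i" using mem[OF ST(1), of l i] mem[OF ST(2), of l i] by auto
      moreover have "\<not> Suc l \<in> {c i<..b i}" using rr[of l i] l by auto
      ultimately show "k \<in> {..c i}" using l by simp
    qed
    then have "weight2 (symdiff S T) \<le> (\<Sum>i\<in>UNIV. 2 * c i)"
      unfolding weight2_def by (intro sum_mono top_sum_le)
    also have "\<dots> = 2 * min (\<Sum>i\<in>UNIV. b i) (M div 2)" by (simp add: c flip: sum_distrib_left)
    also have "\<dots> \<le> M" by linarith
    finally show False using sep[OF ST(1,2,4)] by simp
  qed
  moreover have "r ` D \<subseteq> PiE UNIV (\<lambda>i. Pow {c i<..b i})"
    by (auto simp: r_def)
  ultimately have "card D \<le> card (PiE UNIV (\<lambda>i. Pow {c i<..b i}))"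
    by (intro card_inj_on_le) (auto intro!: finite_PiE)
  \<comment> \<open>An element of the fibre is determined by its digits in the windows from
    \<open>c i + 1\<close> to \<open>b i\<close>.\<close>
  also have "\<dots> = (\<Prod>i\<in>UNIV. 2 ^ (b i - c i))" by (simp add: card_PiE card_Pow)
  also have "\<dots> = 2 ^ (\<Sum>i\<in>UNIV. b i - c i)" by (simp add: power_sum)
  also have "(\<Sum>i\<in>UNIV. b i - c i) = (\<Sum>i\<in>UNIV. b i) - (\<Sum>i\<in>UNIV. c i)"
    using c(1) by (intro sum_subtractf_nat) auto
  also have "\<dots> = (\<Sum>i\<in>UNIV. b i) - M div 2" by (simp add: c(2))
  finally show ?thesis .
qed

text \<open>Since the total is fixed, one coordinate can be forgotten; each of the others is at most
  \<open>m\<close>. Applied to the index type \<open>'d \<times> bool\<close>, this produces the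
  exponent 2d - 1.\<close>

lemma card_compositions:
  "finite {p :: 'a::finite \<Rightarrow> nat. (\<Sum>x\<in>UNIV. p x) = m}"
  "card {p :: 'a::finite \<Rightarrow> nat. (\<Sum>x\<in>UNIV. p x) = m} \<le> (m + 1) ^ (CARD('a) - 1)"
proof -
  let ?P = "{p :: 'a \<Rightarrow> nat. (\<Sum>x\<in>UNIV. p x) = m}"
  fix x0 :: 'a
  define r where "r p = restrict p (UNIV - {x0})" for p :: "'a \<Rightarrow> nat"
  have inj: "inj_on r ?P"
  proof (rule inj_onI)
    fix p q assume pq: "p \<in> ?P" "q \<in> ?P" "r p = r q"
    have eq: "p x = q x" if "x \<noteq> x0" for x
      using fun_cong[OF pq(3), of x] that by (simp add: r_def)
    have "p x0 + (\<Sum>x\<in>UNIV - {x0}. p x) = q x0 + (\<Sum>x\<in>UNIV - {x0}. q x)"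
      using pq by (simp add: sum.remove[symmetric])
    moreover have "(\<Sum>x\<in>UNIV - {x0}. p x) = (\<Sum>x\<in>UNIV - {x0}. q x)"
      by (rule sum.cong) (auto simp: eq)
    ultimately have "p x0 = q x0" by simp
    with eq show "p = q" by (metis ext)
  qed
  have sub: "r ` ?P \<subseteq> PiE (UNIV - {x0}) (\<lambda>_. {..m})"
  proof clarify
    fix p :: "'a \<Rightarrow> nat"
    have "p x \<le> (\<Sum>x\<in>UNIV. p x)" for x by (rule member_le_sum) auto
    then show "r p \<in> PiE (UNIV - {x0}) (\<lambda>_. {..\<Sum>x\<in>UNIV. p x})" by (auto simp: r_def)
  qed
  have finP: "finite (PiE (UNIV - {x0}) (\<lambda>_. {..m}))" by (intro finite_PiE) auto
  show "finite ?P" using inj_on_finite[OF inj sub finP] .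
  have "card ?P \<le> card (PiE (UNIV - {x0}) (\<lambda>_. {..m}))"
    by (rule card_inj_on_le[OF inj sub finP])
  also have "\<dots> = (m + 1) ^ (CARD('a) - 1)" by (simp add: card_PiE card_Diff_singleton)
  finally show "card ?P \<le> (m + 1) ^ (CARD('a) - 1)" .
qed

lemma summable_poly_geometric: "summable (\<lambda>j. (real j + 1) ^ q * (1/2) ^ (j div 2))"
proof (rule summable_comparison_test_bigo)
  show "summable (\<lambda>j. norm ((7/8::real) ^ j))" by (simp add: summable_geometric)
  have "(\<lambda>j. (real j + 1) ^ q * (1/2) ^ (j div 2)) \<in> O(\<lambda>j. (real j + 1) ^ q * (3/4) ^ j)"
  proof (rule landau_o.big.mult[OF landau_o.big_refl], rule bigoI[of _ 2], rule always_eventually, rule allI)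
    fix j :: nat
    \<comment> \<open>1/2 is raised to 9/16, the square of 3/4, so that the halved exponent becomes
      an exponent \<open>j\<close> up to parity, at the cost of a factor at most 2. The ratio 7/8
      then leaves room for the polynomial.\<close>
    have "(1/2::real) ^ (j div 2) \<le> (9/16) ^ (j div 2)" by (intro power_mono) auto
    also have "\<dots> = (3/4) ^ (2 * (j div 2))" by (simp add: power_mult power2_eq_square)
    also have "\<dots> \<le> 2 * (3/4) ^ j"
    proof -
      have "(3/4::real) ^ (2 * (j div 2)) \<le> 2 * (3/4) ^ (2 * (j div 2) + j mod 2)"
      proof (cases "j mod 2 = 0")
        case False
        then have "j mod 2 = 1" by simp
        then show ?thesis by (simp only: power_add) simp
      qed simp
      then show ?thesis by simp
    qed
    finally show "norm ((1/2::real) ^ (j div 2)) \<le> 2 * norm ((3/4::real) ^ j)" by simp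
  qed
  also have "(\<lambda>j. (real j + 1) ^ q * (3/4) ^ j) \<in> O(\<lambda>j. (7/8) ^ j)"
    by real_asymp
  finally show "(\<lambda>j. (real j + 1) ^ q * (1/2) ^ (j div 2)) \<in> O(\<lambda>j. (7/8) ^ j)" .
qed

text \<open>The series over the excess \<open>j\<close> of a weight above the minimal distance:
  polynomially many patterns, with half of the decay already spent on the fibre sizes.\<close>

definition lattice_const :: "nat \<Rightarrow> real" where
  "lattice_const q = (\<Sum>j. (real j + 1) ^ q * (1/2) ^ (j div 2))"

text \<open>Elements are grouped by the pattern of their 2d leading positions, whose total is the
  weight. By \<open>card_fibre\<close> a pattern of total M + j has at most 2^((j + 1) div 2)
  elements, since the second positions make up at most half of the total; its contribution is thus
  at most 2^(-M) 2^(-(j div 2)). Counting patterns by \<open>card_compositions\<close> and summing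
  over \<open>j\<close> gives the bound.\<close>

lemma sum_weight_bound:
  fixes D E :: "('d::finite \<Rightarrow> nat set) set"
  assumes finD: "finite D" and fin: "\<And>T i. T \<in> D \<Longrightarrow> finite (T i)"
    and sep: "\<And>S T. S \<in> D \<Longrightarrow> T \<in> D \<Longrightarrow> S \<noteq> T \<Longrightarrow> weight2 (symdiff S T) > M"
    and E: "E \<subseteq> D" "\<And>T. T \<in> E \<Longrightarrow> weight2 T > M"
  shows "(\<Sum>T\<in>E. (1/2) ^ weight2 T) \<le> lattice_const (2 * CARD('d) - 1) * (1/2) ^ M * (real M + 1) ^ (2 * CARD('d) - 1)"
proof -
  define q where "q = 2 * CARD('d) - 1"
  define pat where "pat T = (\<lambda>(i, u). if u then top1 (Suc ` T i) else top2 (Suc ` T i))" for T :: "'d \<Rightarrow> nat set"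
  define tot where "tot p = (\<Sum>x\<in>UNIV. p x)" for p :: "'d \<times> bool \<Rightarrow> nat"
  define P where "P = pat ` E"
  have finE: "finite E" using finD E(1) finite_subset by blast
  have finP: "finite P" using finE by (simp add: P_def)
  have tot_split: "tot p = (\<Sum>i\<in>UNIV. p (i, True)) + (\<Sum>i\<in>UNIV. p (i, False))" for p
  proof -
    have "tot p = (\<Sum>i\<in>UNIV. \<Sum>u\<in>UNIV. p (i, u))"
      unfolding tot_def sum.cartesian_product by simp
    then show ?thesis by (simp add: UNIV_bool sum.distrib)
  qed
  have tot_pat: "tot (pat T) = weight2 T" "(\<Sum>i\<in>UNIV. pat T (i, False)) \<le> (\<Sum>i\<in>UNIV. pat T (i, True))" if "T \<in> D" for T
  proof -
    have t: "top_sum 2 (Suc ` T i) = top1 (Suc ` T i) + top2 (Suc ` T i)" "top2 (Suc ` T i) \<le> top1 (Suc ` T i)" for i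
      using top12[of "Suc ` T i"] fin[OF that] by auto
    show "tot (pat T) = weight2 T" by (simp add: tot_split pat_def weight2_def t(1) sum.distrib)
    show "(\<Sum>i\<in>UNIV. pat T (i, False)) \<le> (\<Sum>i\<in>UNIV. pat T (i, True))" by (auto simp: pat_def intro!: sum_mono t(2))
  qed
  have Pgt: "tot p > M" if "p \<in> P" for p using that E tot_pat by (auto simp: P_def)
  have fibre: "(\<Sum>T\<in>{T \<in> E. pat T = p}. (1/2::real) ^ weight2 T) \<le> (1/2) ^ M * (1/2) ^ ((tot p - M) div 2)" if p: "p \<in> P" for p
  proof -
    let ?b = "\<Sum>i\<in>UNIV. p (i, False)"
    define j where "j = tot p - M"
    have "card {T \<in> E. pat T = p} \<le> 2 ^ (?b - M div 2)"
    proof (rule card_fibre[where a = "\<lambda>i. p (i, True)" and b = "\<lambda>i. p (i, False)"])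
      fix T i assume "T \<in> {T \<in> E. pat T = p}"
      then have "pat T = p" by simp
      from fun_cong[OF this, of "(i, True)"] fun_cong[OF this, of "(i, False)"]
      show "top1 (Suc ` T i) = p (i, True)" "top2 (Suc ` T i) = p (i, False)" by (auto simp: pat_def)
    qed (use E(1) in \<open>auto intro!: fin sep\<close>)
    also have "\<dots> \<le> 2 ^ ((j + 1) div 2)"
    proof -
      have "2 * ?b \<le> tot p" using p tot_pat(2) E(1) by (auto simp: P_def tot_split)
      then have "?b - M div 2 \<le> (j + 1) div 2" using Pgt[OF p] unfolding j_def by linarith
      then show ?thesis by (intro power_increasing) auto
    qed
    finally have "real (card {T \<in> E. pat T = p}) \<le> real (2 ^ ((j + 1) div 2))"
      by (simp only: of_nat_le_iff)
    then have card: "real (card {T \<in> E. pat T = p}) \<le> 2 ^ ((j + 1) div 2)" by simp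
    have "(\<Sum>T\<in>{T \<in> E. pat T = p}. (1/2::real) ^ weight2 T) = (\<Sum>T\<in>{T \<in> E. pat T = p}. (1/2) ^ tot p)"
      by (rule sum.cong) (use E tot_pat in auto)
    also have "\<dots> = real (card {T \<in> E. pat T = p}) * (1/2) ^ tot p" by simp
    also have "\<dots> \<le> 2 ^ ((j + 1) div 2) * (1/2) ^ tot p" by (intro mult_right_mono card) auto
    \<comment> \<open>The two rounded halves of \<open>j\<close> add up to \<open>j\<close>; one
      cancels against the fibre size, the other is the remaining decay.\<close>
    also have "tot p = M + (j div 2 + (j + 1) div 2)" using Pgt[OF p] unfolding j_def by linarith
    also have "2 ^ ((j + 1) div 2) * (1/2::real) ^ (M + (j div 2 + (j + 1) div 2)) = (1/2) ^ M * (1/2) ^ (j div 2)"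
      by (simp add: power_add power_one_over field_simps)
    finally show ?thesis by (simp add: j_def)
  qed
  have "(\<Sum>T\<in>E. (1/2::real) ^ weight2 T) = (\<Sum>p\<in>P. \<Sum>T\<in>{T \<in> E. pat T = p}. (1/2) ^ weight2 T)"
    unfolding P_def by (rule sum.image_gen[OF finE])
  also have "\<dots> \<le> (\<Sum>p\<in>P. (1/2) ^ M * (1/2) ^ ((tot p - M) div 2))"
    by (rule sum_mono) (rule fibre)
  also have "\<dots> = (\<Sum>m\<in>tot ` P. \<Sum>p\<in>{p \<in> P. tot p = m}. (1/2) ^ M * (1/2) ^ ((tot p - M) div 2))"
    by (rule sum.image_gen[OF finP])
  also have "\<dots> \<le> (\<Sum>m\<in>tot ` P. (1/2) ^ M * (real M + 1) ^ q * ((real (m - M) + 1) ^ q * (1/2) ^ ((m - M) div 2)))"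
  proof (rule sum_mono)
    fix m assume "m \<in> tot ` P"
    then have m: "m > M" using Pgt by auto
    have "card {p \<in> P. tot p = m} \<le> card {p :: 'd \<times> bool \<Rightarrow> nat. (\<Sum>x\<in>UNIV. p x) = m}"
      by (rule card_mono[OF card_compositions(1)]) (auto simp: tot_def)
    also have "\<dots> \<le> (m + 1) ^ q"
      using card_compositions(2)[where 'a = "'d \<times> bool", of m] by (simp add: q_def mult.commute)
    \<comment> \<open>Separates the power of \<open>M\<close>, which becomes the logarithmic factor,
      from the power of the excess, which goes into the convergent series.\<close>
    also have "m + 1 \<le> (M + 1) * ((m - M) + 1)"
      using le_Suc_ex[OF less_imp_le[OF m]] by auto
    then have "(m + 1) ^ q \<le> ((M + 1) * ((m - M) + 1)) ^ q" by (intro power_mono) auto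
    finally have "real (card {p \<in> P. tot p = m}) \<le> real (((M + 1) * ((m - M) + 1)) ^ q)" by (simp only: of_nat_le_iff)
    also have "\<dots> = (real M + 1) ^ q * (real (m - M) + 1) ^ q"
      by (simp only: of_nat_power of_nat_mult of_nat_add of_nat_1 power_mult_distrib)
    finally have card: "real (card {p \<in> P. tot p = m}) \<le> (real M + 1) ^ q * (real (m - M) + 1) ^ q" .
    have "(\<Sum>p\<in>{p \<in> P. tot p = m}. (1/2::real) ^ M * (1/2) ^ ((tot p - M) div 2))
        = real (card {p \<in> P. tot p = m}) * ((1/2) ^ M * (1/2) ^ ((m - M) div 2))"
      by simp
    also have "\<dots> \<le> ((real M + 1) ^ q * (real (m - M) + 1) ^ q) * ((1/2) ^ M * (1/2) ^ ((m - M) div 2))"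
      by (intro mult_right_mono card) auto
    finally show "(\<Sum>p\<in>{p \<in> P. tot p = m}. (1/2::real) ^ M * (1/2) ^ ((tot p - M) div 2))
      \<le> (1/2) ^ M * (real M + 1) ^ q * ((real (m - M) + 1) ^ q * (1/2) ^ ((m - M) div 2))"
      by (simp add: mult_ac)
  qed
  also have "\<dots> = (1/2) ^ M * (real M + 1) ^ q * (\<Sum>m\<in>tot ` P. (real (m - M) + 1) ^ q * (1/2) ^ ((m - M) div 2))"
    by (simp add: sum_distrib_left)
  also have "(\<Sum>m\<in>tot ` P. (real (m - M) + 1) ^ q * (1/2) ^ ((m - M) div 2))
      = (\<Sum>j\<in>(\<lambda>m. m - M) ` tot ` P. (real j + 1) ^ q * (1/2) ^ (j div 2))"
  proof (rule sum.reindex_cong[symmetric, OF _ refl refl])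
    show "inj_on (\<lambda>m. m - M) (tot ` P)"
      using Pgt by (auto intro!: inj_onI) (metis diff_add_inverse2 le_add_diff_inverse2 less_imp_le)
  qed
  also have "(1/2) ^ M * (real M + 1) ^ q * \<dots> \<le> (1/2) ^ M * (real M + 1) ^ q * lattice_const q"
    unfolding lattice_const_def using finP
    by (intro mult_left_mono sum_le_suminf[OF summable_poly_geometric]) auto
  finally show ?thesis by (simp add: q_def mult_ac)
qed

lemma lattice_const_nonneg: "lattice_const q \<ge> 0"
  unfolding lattice_const_def by (rule suminf_nonneg[OF summable_poly_geometric]) auto

section \<open>A smooth convex ramp\<close>

text \<open>Provides the derivative at the points 1 and -1, where the two pieces of the bump
  meet.\<close>

lemma DERIV_zero_if_quadratic:
  fixes f :: "real \<Rightarrow> real"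
  assumes "\<And>u. \<bar>f u\<bar> \<le> C * (u - a)\<^sup>2"
  shows "(f has_real_derivative 0) (at a)"
proof -
  have fa: "f a = 0" using assms[of a] by simp
  have "((\<lambda>y. (f y - f a) / (y - a)) \<longlongrightarrow> 0) (at a)"
  proof (rule Lim_null_comparison)
    show "\<forall>\<^sub>F y in at a. norm ((f y - f a) / (y - a)) \<le> C * \<bar>y - a\<bar>"
      unfolding eventually_at_filter
    proof (rule always_eventually, intro allI impI)
      fix y assume "y \<noteq> a"
      then have "\<bar>y - a\<bar> > 0" by simp
      moreover have "\<bar>f y\<bar> \<le> (C * \<bar>y - a\<bar>) * \<bar>y - a\<bar>" using assms[of y] by (simp add: power2_eq_square)
      ultimately show "norm ((f y - f a) / (y - a)) \<le> C * \<bar>y - a\<bar>"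
        by (simp add: fa abs_divide divide_le_eq)
    qed
    show "((\<lambda>y. C * \<bar>y - a\<bar>) \<longlongrightarrow> 0) (at a)" by (rule tendsto_eq_intros refl | simp)+
  qed
  then show ?thesis by (simp add: has_field_derivative_iff)
qed

text \<open>The family \<open>p(u) (1 - u^2)^(-k) exp (-2/(1 - u^2))\<close> on (-1,1) is closed under differentiation.\<close>

definition bump :: "real poly \<Rightarrow> nat \<Rightarrow> real \<Rightarrow> real" where
  "bump p k u = (if \<bar>u\<bar> < 1 then poly p u * (1 / (1 - u\<^sup>2)) ^ k * exp (- 2 / (1 - u\<^sup>2)) else 0)"

text \<open>Product rule with everything put over (1 - u^2)^(k + 2); \<open>[:1, 0, -1:]\<close> is
  1 - u^2. The summands come from differentiating the polynomial, the power and the exponential, in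
  this order.\<close>

definition bump_deriv_poly :: "real poly \<Rightarrow> nat \<Rightarrow> real poly" where
  "bump_deriv_poly p k = pderiv p * [:1, 0, -1:] ^ 2 + [:0, 2 * real k:] * p * [:1, 0, -1:] - [:0, 4:] * p"

text \<open>A single term of the exponential series; it lets the exponential absorb the pole of
  \<open>bump\<close>.\<close>

lemma power_le_fact_exp:
  fixes x :: real
  assumes "x \<ge> 0"
  shows "x ^ m \<le> fact m * exp x"
proof -
  have "x ^ m /\<^sub>R fact m \<le> (\<Sum>n. x ^ n /\<^sub>R fact n)"
    using sum_le_suminf[OF summable_exp_generic[of x], of "{m}"] assms by auto
  then have "x ^ m / fact m \<le> exp x" by (simp add: exp_def field_simps)
  then show ?thesis by (simp add: field_simps)
qed

text \<open>With w = 1/(1 - u^2), one factor exp(-w) absorbs \<open>w ^ (k + 2)\<close>. The two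
  extra powers of w leave a multiple of (1 - u)^2 (1 + u)^2, in which either square is at most
  4.\<close>

lemma bump_quadratic: "\<exists>C. \<forall>u. \<bar>bump p k u\<bar> \<le> C * (u - 1)\<^sup>2 \<and> \<bar>bump p k u\<bar> \<le> C * (u + 1)\<^sup>2"
proof -
  have "bounded (poly p ` {-1..1})"
    by (intro compact_imp_bounded compact_continuous_image continuous_intros) auto
  then obtain B where B: "B > 0" "\<And>u. u \<in> {-1..1} \<Longrightarrow> \<bar>poly p u\<bar> \<le> B"
    unfolding bounded_pos by auto
  define C where "C = B * fact (k + 2) * 4"
  have C: "C > 0" using B by (simp add: C_def)
  have main: "\<bar>bump p k u\<bar> \<le> B * fact (k + 2) * ((1 - u)\<^sup>2 * (1 + u)\<^sup>2)" if u: "\<bar>u\<bar> < 1" for u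
  proof -
    define w where "w = 1 / (1 - u\<^sup>2)"
    have pos: "1 - u\<^sup>2 > 0" using u by (simp add: abs_square_less_1)
    then have w: "w > 0" by (simp add: w_def)
    have "w ^ (k + 2) * exp (- 2 * w) \<le> (fact (k + 2) * exp w) * exp (- 2 * w)"
      using w by (intro mult_right_mono power_le_fact_exp) auto
    also have "\<dots> = fact (k + 2) * exp (- w)" by (simp add: mult.assoc flip: exp_add)
    also have "\<dots> \<le> fact (k + 2) * 1" using w by (intro mult_left_mono) auto
    finally have e: "w ^ (k + 2) * exp (- 2 * w) \<le> fact (k + 2)" by simp
    have "\<bar>bump p k u\<bar> = \<bar>poly p u\<bar> * (w ^ k * exp (- 2 * w))"
      using u w by (simp add: bump_def w_def abs_mult power_abs)
    also have "\<dots> \<le> B * (w ^ k * exp (- 2 * w))"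
      using w B(2)[of u] u by (intro mult_right_mono) (auto simp: abs_less_iff)
    also have "w ^ k * exp (- 2 * w) = w ^ (k + 2) * exp (- 2 * w) * (1 - u\<^sup>2)\<^sup>2"
    proof -
      have "w\<^sup>2 * (1 - u\<^sup>2)\<^sup>2 = 1" using pos by (simp add: w_def power_divide)
      then have "w ^ k * exp (- 2 * w) = w ^ k * exp (- 2 * w) * (w\<^sup>2 * (1 - u\<^sup>2)\<^sup>2)" by simp
      then show ?thesis by (simp only: power_add mult_ac)
    qed
    also have "B * \<dots> \<le> B * (fact (k + 2) * (1 - u\<^sup>2)\<^sup>2)"
      using B e by (intro mult_left_mono mult_right_mono) auto
    also have "(1 - u\<^sup>2)\<^sup>2 = (1 - u)\<^sup>2 * (1 + u)\<^sup>2" by (simp add: power2_eq_square algebra_simps)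
    finally show ?thesis by (simp add: mult.assoc)
  qed
  have sq: "(1 - u)\<^sup>2 \<le> 4" "(1 + u)\<^sup>2 \<le> 4" if "\<bar>u\<bar> < 1" for u :: real
    using that power_mono[of "1 - u" 2 2] power_mono[of "1 + u" 2 2] by auto
  have "\<bar>bump p k u\<bar> \<le> C * (u - 1)\<^sup>2 \<and> \<bar>bump p k u\<bar> \<le> C * (u + 1)\<^sup>2" for u
  proof (cases "\<bar>u\<bar> < 1")
    case True
    have "B * fact (k + 2) * ((1 - u)\<^sup>2 * (1 + u)\<^sup>2) \<le> B * fact (k + 2) * ((1 - u)\<^sup>2 * 4)"
      "B * fact (k + 2) * ((1 - u)\<^sup>2 * (1 + u)\<^sup>2) \<le> B * fact (k + 2) * (4 * (1 + u)\<^sup>2)"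
      using B sq[OF True] by (intro mult_left_mono mult_right_mono; simp)+
    note order_trans[OF main[OF True] this(1)] order_trans[OF main[OF True] this(2)]
    moreover have "(u - 1)\<^sup>2 = (1 - u)\<^sup>2" "(u + 1)\<^sup>2 = (1 + u)\<^sup>2"
      by (simp_all add: power2_commute add.commute)
    ultimately show ?thesis unfolding C_def by (simp only: mult_ac simp_thms)
  next
    case False
    then show ?thesis using C by (simp add: bump_def)
  qed
  then show ?thesis by blast
qed

lemma bump_DERIV: "(bump p k has_real_derivative bump (bump_deriv_poly p k) (k + 2) u) (at u)"
proof -
  consider "\<bar>u\<bar> < 1" | "\<bar>u\<bar> > 1" | "u = 1" | "u = -1" by linarith
  then show ?thesis
  proof cases
    case 1
    have pos: "1 - u\<^sup>2 > 0" using 1 by (simp add: abs_square_less_1)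
    define w where "w = 1 / (1 - u\<^sup>2)"
    have "((\<lambda>u. 1 / (1 - u\<^sup>2)) has_real_derivative 2 * u * w\<^sup>2) (at u)"
      using pos by (auto intro!: derivative_eq_intros simp: w_def power2_eq_square)
    note dw = this
    have "((\<lambda>u. (1 / (1 - u\<^sup>2)) ^ k) has_real_derivative real k * w ^ (k - 1) * (2 * u * w\<^sup>2)) (at u)"
      using DERIV_power[OF dw, of k] by (simp add: w_def mult_ac)
    note dwk = this
    have "((\<lambda>u. exp (- 2 * (1 / (1 - u\<^sup>2)))) has_real_derivative exp (- 2 * w) * (- 2 * (2 * u * w\<^sup>2))) (at u)"
      by (rule DERIV_fun_exp[THEN DERIV_cong], rule DERIV_cmult[OF dw]) (simp add: w_def)
    note de = this
    have "((\<lambda>u. poly p u * (1 / (1 - u\<^sup>2)) ^ k * exp (- 2 * (1 / (1 - u\<^sup>2)))) has_real_derivative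
        (poly (pderiv p) u * w ^ k + real k * w ^ (k - 1) * (2 * u * w\<^sup>2) * poly p u) * exp (- 2 * w)
         + exp (- 2 * w) * (- 2 * (2 * u * w\<^sup>2)) * (poly p u * w ^ k)) (at u)"
      unfolding w_def by (rule DERIV_mult[OF DERIV_mult[OF poly_DERIV dwk[unfolded w_def]] de[unfolded w_def]])
    moreover have "(poly (pderiv p) u * w ^ k + real k * w ^ (k - 1) * (2 * u * w\<^sup>2) * poly p u) * exp (- 2 * w)
         + exp (- 2 * w) * (- 2 * (2 * u * w\<^sup>2)) * (poly p u * w ^ k) = bump (bump_deriv_poly p k) (k + 2) u"
    proof -
      have i: "1 - u\<^sup>2 = 1 / w" "w \<noteq> 0" using pos by (auto simp: w_def)
      \<comment> \<open>The case distinction covers \<open>k = 0\<close>, where the exponent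
        \<open>k - 1\<close> is truncated but the factor \<open>real k\<close> vanishes.\<close>
      have kk: "real k * w ^ (k - 1) * w = real k * w ^ k" by (cases k) auto
      have "bump (bump_deriv_poly p k) (k + 2) u =
          (poly (pderiv p) u * (1 - u\<^sup>2)\<^sup>2 + 2 * real k * u * poly p u * (1 - u\<^sup>2) - 4 * u * poly p u) * (w ^ k * w\<^sup>2) * exp (- 2 * w)"
        using 1 by (simp add: bump_def bump_deriv_poly_def w_def power_add algebra_simps power2_eq_square)
      also have "\<dots> = (poly (pderiv p) u * w ^ k + 2 * (real k * w ^ k) * w * u * poly p u - 4 * u * poly p u * w ^ k * w\<^sup>2) * exp (- 2 * w)"
        unfolding i(1) using i(2) by (simp add: field_simps power2_eq_square)
      also have "\<dots> = (poly (pderiv p) u * w ^ k + 2 * (real k * w ^ (k - 1) * w) * w * u * poly p u - 4 * u * poly p u * w ^ k * w\<^sup>2) * exp (- 2 * w)"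
        by (simp only: kk)
      finally show ?thesis by (simp add: algebra_simps power2_eq_square)
    qed
    ultimately have "((\<lambda>u. poly p u * (1 / (1 - u\<^sup>2)) ^ k * exp (- 2 * (1 / (1 - u\<^sup>2)))) has_real_derivative
        bump (bump_deriv_poly p k) (k + 2) u) (at u)" by simp
    then show ?thesis
      by (rule has_field_derivative_transform_within_open[of _ _ _ "{-1<..<1}"]) (use 1 in \<open>auto simp: bump_def\<close>)
  next
    case 2
    have "((\<lambda>_. 0) has_real_derivative bump (bump_deriv_poly p k) (k + 2) u) (at u)"
      using 2 by (simp add: bump_def)
    then show ?thesis
      by (rule has_field_derivative_transform_within_open[of _ _ _ "{..<-1} \<union> {1<..}"]) (use 2 in \<open>auto simp: bump_def\<close>)
  next
    case 3
    then show ?thesis using bump_quadratic[of p k] DERIV_zero_if_quadratic[of "bump p k" _ 1] by (auto simp: bump_def)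
  next
    case 4
    then show ?thesis using bump_quadratic[of p k] DERIV_zero_if_quadratic[of "bump p k" _ "-1"] by (auto simp: bump_def)
  qed
qed

text \<open>The lower limit -2 lies strictly left of the support of \<open>g\<close>, so every
  \<open>u \<ge> -1\<close> is interior to an interval on which the fundamental theorem applies, and
  further left everything is zero.\<close>

lemma DERIV_integral_from_left:
  fixes g :: "real \<Rightarrow> real"
  assumes cont: "continuous_on UNIV g" and zero: "\<And>u. u \<le> -1 \<Longrightarrow> g u = 0"
  shows "((\<lambda>u. integral {-2..u} g) has_real_derivative g u) (at u)"
    and "u \<le> -1 \<Longrightarrow> integral {-2..u} g = 0"
proof -
  have z: "integral {-2..u} g = 0" if "u \<le> -1" for u
  proof -
    have "integral {-2..u} g = integral {-2..u} (\<lambda>_. 0)"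
      using zero that by (intro integral_cong) auto
    then show ?thesis by simp
  qed
  then show "u \<le> -1 \<Longrightarrow> integral {-2..u} g = 0" .
  show "((\<lambda>u. integral {-2..u} g) has_real_derivative g u) (at u)"
  proof (cases "u < -1")
    case True
    have "((\<lambda>_. 0) has_real_derivative g u) (at u)" using zero True by simp
    then show ?thesis
      by (rule has_field_derivative_transform_within_open[of _ _ _ "{..<-1}"]) (use True z in auto)
  next
    case False
    have "((\<lambda>u. integral {-2..u} g) has_real_derivative g u) (at u within {-2..u+1})"
      using False cont by (intro integral_has_real_derivative) (auto intro: continuous_on_subset)
    then show ?thesis
      using False by (subst (asm) at_within_interior) auto
  qed
qed

text \<open>The ramp is the second antiderivative of an even bump. Evenness makes the step function
  \<open>G\<close> symmetric, which forces \<open>H u - H (- u) = G 1 * u\<close>; hence the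
  normalised ramp equals \<open>u\<close> for \<open>u \<ge> 1\<close> without any additive
  constant, as the cancellation in \<open>kern_support\<close> requires.\<close>

lemma smooth_ramp_exists:
  "\<exists>D :: nat \<Rightarrow> real \<Rightarrow> real. (\<forall>n u. (D n has_real_derivative D (Suc n) u) (at u)) \<and>
     (\<forall>u\<le>-1. D 0 u = 0) \<and> (\<forall>u\<ge>1. D 0 u = u) \<and> (\<forall>u. 0 \<le> D 1 u \<and> D 1 u \<le> 1) \<and>
     (\<forall>u. D 2 u \<ge> 0) \<and> (\<forall>u. \<bar>u\<bar> \<ge> 1 \<longrightarrow> D 2 u = 0)"
proof -
  \<comment> \<open>Iterates the pair of polynomial and exponent, so that \<open>b n\<close> is the
    n-th derivative of the initial bump.\<close>
  define ps where "ps = rec_nat (1 :: real poly, 0 :: nat) (\<lambda>_ q. (bump_deriv_poly (fst q) (snd q), snd q + 2))"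
  define b where "b n = bump (fst (ps n)) (snd (ps n))" for n
  have b_DERIV: "(b n has_real_derivative b (Suc n) u) (at u)" for n u
    unfolding b_def ps_def using bump_DERIV by simp
  have b0: "b 0 = bump 1 0" by (simp add: b_def ps_def)
  have b0_out: "b 0 u = 0" if "\<bar>u\<bar> \<ge> 1" for u using that by (simp add: b0 bump_def)
  have b0_nonneg: "b 0 u \<ge> 0" for u by (simp add: b0 bump_def)
  have b0_even: "b 0 (- u) = b 0 u" for u by (simp add: b0 bump_def)
  have cont: "continuous_on UNIV (b 0)"
    by (rule DERIV_continuous_on) (use b_DERIV has_field_derivative_at_within in blast)
  define G where "G u = integral {-2..u} (b 0)" for u
  have G_DERIV: "(G has_real_derivative b 0 u) (at u)" for u
    unfolding G_def by (rule DERIV_integral_from_left[OF cont]) (use b0_out in auto)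
  have G_left: "G u = 0" if "u \<le> -1" for u
    unfolding G_def by (rule DERIV_integral_from_left[OF cont]) (use b0_out that in auto)
  have G_mono: "G u \<le> G v" if "u \<le> v" for u v
    using that by (rule DERIV_nonneg_imp_nondecreasing) (use G_DERIV b0_nonneg in blast)
  \<comment> \<open>Otherwise \<open>G\<close> would vanish on (-1, 1) and so would its derivative
    at 0, but the bump is positive there. This makes the division by \<open>G 1\<close>
    legitimate.\<close>
  have G1: "G 1 > 0"
  proof (rule ccontr)
    assume "\<not> G 1 > 0"
    then have "G u = 0" if "\<bar>u\<bar> < 1" for u
      using G_mono[of "-1" u] G_mono[of u 1] G_left[of "-1"] that by (auto simp: abs_less_iff)
    then have "(G has_real_derivative 0) (at 0)"
      by (intro has_field_derivative_transform_within_open[of "\<lambda>_. 0" 0 0 "{-1<..<1}" G]) auto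
    then have "b 0 0 = 0" using G_DERIV[of 0] DERIV_unique by blast
    then show False by (simp add: b0 bump_def)
  qed
  have G_right: "G u = G 1" if "u \<ge> 1" for u
  proof -
    have "G u \<le> G 1"
    proof (rule DERIV_nonpos_imp_nonincreasing[OF that])
      fix x :: real assume "1 \<le> x" "x \<le> u"
      then show "\<exists>y. (G has_real_derivative y) (at x) \<and> y \<le> 0"
        by (intro exI[of _ "b 0 x"] conjI G_DERIV) (simp add: b0_out)
    qed
    then show ?thesis using G_mono[OF that] by simp
  qed
  have G_sym: "G u + G (- u) = G 1" for u
  proof -
    have "((\<lambda>u. G u + G (- u)) has_real_derivative 0) (at u)" for u
    proof -
      have "((\<lambda>u. G (- u)) has_real_derivative b 0 (- u) * (-1)) (at u)"
        by (rule DERIV_chain2[OF G_DERIV]) (auto intro!: derivative_eq_intros)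
      from DERIV_add[OF G_DERIV[of u] this] show ?thesis by (simp add: b0_even)
    qed
    from DERIV_isconst_all[of "\<lambda>u. G u + G (- u)"] this
    have "G u + G (- u) = G 1 + G (- 1)" by blast
    then show ?thesis using G_left[of "-1"] by simp
  qed
  have contG: "continuous_on UNIV G"
    by (rule DERIV_continuous_on) (use G_DERIV has_field_derivative_at_within in blast)
  define H where "H u = integral {-2..u} G" for u
  have H_DERIV: "(H has_real_derivative G u) (at u)" for u
    unfolding H_def by (rule DERIV_integral_from_left[OF contG]) (use G_left in auto)
  have H_left: "H u = 0" if "u \<le> -1" for u
    unfolding H_def by (rule DERIV_integral_from_left[OF contG]) (use G_left that in auto)
  have H_sym: "H u - H (- u) = G 1 * u" for u
  proof -
    have "((\<lambda>u. H u - H (- u) - G 1 * u) has_real_derivative 0) (at u)" for u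
    proof -
      have "((\<lambda>u. H (- u)) has_real_derivative G (- u) * (-1)) (at u)"
        by (rule DERIV_chain2[OF H_DERIV]) (auto intro!: derivative_eq_intros)
      from DERIV_diff[OF DERIV_diff[OF H_DERIV[of u] this] DERIV_cmult[OF DERIV_ident, of "G 1"]]
      show ?thesis using G_sym[of u] by simp
    qed
    from DERIV_isconst_all[of "\<lambda>u. H u - H (- u) - G 1 * u"] this
    have "H u - H (- u) - G 1 * u = H 0 - H (- 0) - G 1 * 0" by blast
    then show ?thesis by simp
  qed
  define D where "D n u = (case n of 0 \<Rightarrow> H u | Suc 0 \<Rightarrow> G u | Suc (Suc m) \<Rightarrow> b m u) / G 1" for n u
  have D: "D 0 = (\<lambda>u. H u / G 1)" "D 1 = (\<lambda>u. G u / G 1)" "D (Suc 0) = (\<lambda>u. G u / G 1)"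
      "D (Suc (Suc n)) = (\<lambda>u. b n u / G 1)" for n
    by (auto simp: D_def)
  have "(D n has_real_derivative D (Suc n) u) (at u)" for n u
  proof -
    consider "n = 0" | "n = Suc 0" | m where "n = Suc (Suc m)" by (metis not0_implies_Suc)
    then show ?thesis by cases (simp_all add: D DERIV_cdivide H_DERIV G_DERIV b_DERIV)
  qed
  moreover have "D 0 u = 0" if "u \<le> -1" for u using H_left[OF that] by (simp add: D)
  moreover have "D 0 u = u" if "u \<ge> 1" for u using H_left[of "-u"] H_sym[of u] that G1 by (simp add: D)
  moreover have "0 \<le> D 1 u \<and> D 1 u \<le> 1" for u
  proof -
    have "0 \<le> G u" using G_mono[of "min u (-1)" u] G_left[of "min u (-1)"] by simp
    moreover have "G u \<le> G 1" using G_mono[of u "max u 1"] G_right[of "max u 1"] by simp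
    ultimately show ?thesis using G1 unfolding D by simp
  qed
  moreover have "D 2 u \<ge> 0" "\<bar>u\<bar> \<ge> 1 \<longrightarrow> D 2 u = 0" for u
    using b0_nonneg[of u] b0_out[of u] G1 by (auto simp: D numeral_2_eq_2)
  ultimately show ?thesis by blast
qed

text \<open>\<^term>\<open>ramp n\<close> is the \<open>n\<close>-th derivative of a smooth convex version of the positive part \<open>max u 0\<close>.\<close>

definition ramp :: "nat \<Rightarrow> real \<Rightarrow> real" where
  "ramp = (SOME D. (\<forall>n u. (D n has_real_derivative D (Suc n) u) (at u)) \<and>
     (\<forall>u\<le>-1. D 0 u = 0) \<and> (\<forall>u\<ge>1. D 0 u = u) \<and> (\<forall>u. 0 \<le> D 1 u \<and> D 1 u \<le> 1) \<and>
     (\<forall>u. D 2 u \<ge> 0) \<and> (\<forall>u. \<bar>u\<bar> \<ge> 1 \<longrightarrow> D 2 u = 0))"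

lemma ramp_DERIV: "(ramp n has_real_derivative ramp (Suc n) u) (at u)"
  and ramp_left: "u \<le> -1 \<Longrightarrow> ramp 0 u = 0"
  and ramp_right: "u \<ge> 1 \<Longrightarrow> ramp 0 u = u"
  and ramp1: "0 \<le> ramp 1 u" "ramp 1 u \<le> 1"
  and ramp2_nonneg: "ramp 2 u \<ge> 0"
  and ramp2_out: "\<bar>u\<bar> \<ge> 1 \<Longrightarrow> ramp 2 u = 0"
  using someI_ex[OF smooth_ramp_exists, folded ramp_def] by auto

section \<open>Representation by weak derivatives\<close>

lemma has_DERIV_pd_prod:
  fixes D :: "'d::finite \<Rightarrow> nat \<Rightarrow> real \<Rightarrow> real"
  assumes D: "\<And>i n u. (D i n has_real_derivative D i (Suc n) u) (at u)"
  shows "((\<lambda>s. \<Prod>i\<in>UNIV. D i (m i) ((x + s *\<^sub>R axis j 1) $ i)) has_real_derivative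
     (\<Prod>i\<in>UNIV. D i ((m(j := Suc (m j))) i) (x $ i))) (at 0)"
proof -
  have "(\<Prod>i\<in>UNIV. D i (m i) ((x + s *\<^sub>R axis j 1) $ i))
      = D j (m j) (x $ j + s) * (\<Prod>i\<in>UNIV - {j}. D i (m i) (x $ i))" for s
    by (subst prod.remove[of UNIV j]) (auto simp: axis_def intro!: prod.cong)
  moreover have "((\<lambda>s. D j (m j) (x $ j + s) * (\<Prod>i\<in>UNIV - {j}. D i (m i) (x $ i))) has_real_derivative
     D j (Suc (m j)) (x $ j) * (\<Prod>i\<in>UNIV - {j}. D i (m i) (x $ i))) (at 0)"
  proof (rule DERIV_cmult_right)
    have "(D j (m j) has_real_derivative D j (Suc (m j)) (x $ j)) (at (0 + x $ j))" using D by simp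
    then show "((\<lambda>s. D j (m j) (x $ j + s)) has_real_derivative D j (Suc (m j)) (x $ j)) (at 0)"
      by (subst (asm) DERIV_shift) (simp add: add.commute)
  qed
  moreover have "(\<Prod>i\<in>UNIV. D i ((m(j := Suc (m j))) i) (x $ i))
      = D j (Suc (m j)) (x $ j) * (\<Prod>i\<in>UNIV - {j}. D i (m i) (x $ i))"
    by (subst prod.remove[of UNIV j]) (auto intro!: prod.cong)
  ultimately show ?thesis by simp
qed

text \<open>For products only the number of derivatives per direction matters, not their order,
  which fits the formulation of \<open>is_weak_mixed2\<close> by counts.\<close>

lemma iter_pd_prod:
  fixes D :: "'d::finite \<Rightarrow> nat \<Rightarrow> real \<Rightarrow> real"
  assumes D: "\<And>i n u. (D i n has_real_derivative D i (Suc n) u) (at u)"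
  shows "iter_pd is (\<lambda>x. \<Prod>i\<in>UNIV. D i 0 (x $ i)) = (\<lambda>x. \<Prod>i\<in>UNIV. D i (count (mset is) i) (x $ i))"
proof (induction "is")
  case Nil
  then show ?case by simp
next
  case (Cons j "is")
  have "(count (mset is))(j := Suc (count (mset is) j)) = count (mset (j # is))" by auto
  then show ?case
    using DERIV_imp_deriv[OF has_DERIV_pd_prod[where D = D, OF D, of "count (mset is)" _ j]]
    by (simp add: Cons pd_def fun_eq_iff)
qed

lemma continuous_prod_coords:
  fixes h :: "'d::finite \<Rightarrow> real \<Rightarrow> real"
  assumes "\<And>i. continuous_on UNIV (h i)"
  shows "continuous_on S (\<lambda>x :: real^'d. \<Prod>i\<in>UNIV. h i (x $ i))"
  by (intro continuous_on_prod continuous_on_compose2[OF assms] continuous_intros) auto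

lemma test_fn_prod:
  fixes D :: "'d::finite \<Rightarrow> nat \<Rightarrow> real \<Rightarrow> real"
  assumes D: "\<And>i n u. (D i n has_real_derivative D i (Suc n) u) (at u)"
    and a: "a > 0" and supp: "\<And>i u. u \<le> a \<or> 1 - a \<le> u \<Longrightarrow> D i 0 u = 0"
  shows "test_fn (\<lambda>x. \<Prod>i\<in>UNIV. D i 0 (x $ i))"
  unfolding test_fn_def
proof (intro conjI allI exI)
  fix "is" :: "'d list"
  have "continuous_on UNIV (D i n)" for i n
    by (rule DERIV_continuous_on) (use D has_field_derivative_at_within in blast)
  then show "continuous_on UNIV (iter_pd is (\<lambda>x. \<Prod>i\<in>UNIV. D i 0 (x $ i)))"
    unfolding iter_pd_prod[where D = D, OF D] by (intro continuous_prod_coords)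
  show "(\<lambda>s. iter_pd is (\<lambda>x. \<Prod>i\<in>UNIV. D i 0 (x $ i)) (x + s *\<^sub>R axis j 1)) field_differentiable at 0" for j x
    unfolding iter_pd_prod[where D = D, OF D] field_differentiable_def using has_DERIV_pd_prod[where D = D, OF D] by blast
next
  let ?K = "cbox (\<chi> i. a) (\<chi> i. 1 - a) :: (real^'d) set"
  show "compact ?K" by simp
  show "?K \<subseteq> box 0 1" using a by (auto simp: mem_box_cart) (metis add.commute diff_add_cancel less_add_same_cancel2 order_le_less_trans)+
  fix x :: "real^'d"
  show "x \<notin> ?K \<longrightarrow> (\<Prod>i\<in>UNIV. D i 0 (x $ i)) = 0"
  proof
    assume "x \<notin> ?K"
    then obtain i where "x $ i < a \<or> 1 - a < x $ i" by (auto simp: mem_box_cart not_le)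
    then have "D i 0 (x $ i) = 0" using supp by auto
    then show "(\<Prod>i\<in>UNIV. D i 0 (x $ i)) = 0" by (auto intro!: prod_zero)
  qed
qed

text \<open>The n-th derivative of \<open>\<epsilon> * ramp 0 (u / \<epsilon>)\<close>. This scaling
  keeps the slope between 0 and 1, and index 2 is a bump of unit mass and width of order
  \<epsilon>.\<close>

definition ramps :: "real \<Rightarrow> nat \<Rightarrow> real \<Rightarrow> real" where
  "ramps \<epsilon> n u = \<epsilon> * (1 / \<epsilon>) ^ n * ramp n (u / \<epsilon>)"

lemma ramps_DERIV: "(ramps \<epsilon> n has_real_derivative ramps \<epsilon> (Suc n) u) (at u)"
proof -
  have "((\<lambda>u. ramp n (u / \<epsilon>)) has_real_derivative ramp (Suc n) (u / \<epsilon>) * (1 / \<epsilon>)) (at u)"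
    by (rule DERIV_chain2[OF ramp_DERIV DERIV_cdivide[OF DERIV_ident]])
  from DERIV_cmult[OF this, of "\<epsilon> * (1 / \<epsilon>) ^ n"] show ?thesis
    by (simp only: ramps_def[abs_def] power_Suc mult_ac)
qed

lemma ramps_shift_DERIV: "((\<lambda>s. ramps \<epsilon> n (s - c)) has_real_derivative ramps \<epsilon> (Suc n) (s - c)) (at s)"
proof -
  have "((\<lambda>s. ramps \<epsilon> n (s - c)) has_real_derivative ramps \<epsilon> (Suc n) (s - c) * 1) (at s)"
    by (rule DERIV_chain2[OF ramps_DERIV]) (auto intro!: derivative_eq_intros)
  then show ?thesis by simp
qed

context
  fixes \<epsilon> :: real assumes eps: "\<epsilon> > 0"
begin

lemma ramps_left: "u \<le> - \<epsilon> \<Longrightarrow> ramps \<epsilon> 0 u = 0"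
  using eps by (simp add: ramps_def ramp_left divide_le_eq)

lemma ramps_right: "u \<ge> \<epsilon> \<Longrightarrow> ramps \<epsilon> 0 u = u"
  using eps by (simp add: ramps_def ramp_right)

lemma ramps1: "0 \<le> ramps \<epsilon> 1 u" "ramps \<epsilon> 1 u \<le> 1"
  using eps ramp1 by (simp_all add: ramps_def)

lemma ramps2_nonneg: "0 \<le> ramps \<epsilon> 2 u"
  using eps ramp2_nonneg by (simp add: ramps_def)

lemma ramps2_out: "\<bar>u\<bar> \<ge> \<epsilon> \<Longrightarrow> ramps \<epsilon> 2 u = 0"
  using eps by (simp add: ramps_def ramp2_out abs_divide)

lemma ramps1_mono: "mono (ramps \<epsilon> 1)"
proof (rule monoI)
  fix x y :: real assume "x \<le> y"
  then show "ramps \<epsilon> 1 x \<le> ramps \<epsilon> 1 y"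
    by (rule DERIV_nonneg_imp_nondecreasing)
      (use ramps_DERIV[of \<epsilon> 1] ramps2_nonneg in \<open>auto simp: numeral_2_eq_2\<close>)
qed

lemma ramps0_bounds: "0 \<le> ramps \<epsilon> 0 u" "ramps \<epsilon> 0 u \<le> \<bar>u\<bar> + \<epsilon>"
proof -
  have mono: "ramps \<epsilon> 0 x \<le> ramps \<epsilon> 0 y" if "x \<le> y" for x y
    using that by (rule DERIV_nonneg_imp_nondecreasing) (use ramps_DERIV[of \<epsilon> 0] ramps1(1) in auto)
  show "0 \<le> ramps \<epsilon> 0 u" using mono[of "min u (- \<epsilon>)" u] ramps_left[of "min u (- \<epsilon>)"] by simp
  show "ramps \<epsilon> 0 u \<le> \<bar>u\<bar> + \<epsilon>" using mono[of u "\<bar>u\<bar> + \<epsilon>"] ramps_right[of "\<bar>u\<bar> + \<epsilon>"] eps by simp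
qed

lemma ramps1_left: "u < - \<epsilon> \<Longrightarrow> ramps \<epsilon> 1 u = 0"
proof -
  assume u: "u < - \<epsilon>"
  have "((\<lambda>_. 0) has_real_derivative 0) (at u)" by simp
  then have "(ramps \<epsilon> 0 has_real_derivative 0) (at u)"
    by (rule has_field_derivative_transform_within_open[of _ _ _ "{..<- \<epsilon>}"]) (use u ramps_left in auto)
  then show ?thesis using ramps_DERIV[of \<epsilon> 0 u] DERIV_unique by fastforce
qed

lemma ramps1_right: "u > \<epsilon> \<Longrightarrow> ramps \<epsilon> 1 u = 1"
proof -
  assume u: "u > \<epsilon>"
  have "((\<lambda>u. u) has_real_derivative 1) (at u)" by simp
  then have "(ramps \<epsilon> 0 has_real_derivative 1) (at u)"
    by (rule has_field_derivative_transform_within_open[of _ _ _ "{\<epsilon><..}"]) (use u ramps_right in auto)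
  then show ?thesis using ramps_DERIV[of \<epsilon> 0 u] DERIV_unique by fastforce
qed

lemma continuous_ramps: "continuous_on S (ramps \<epsilon> n)"
  by (rule DERIV_continuous_on) (use ramps_DERIV has_field_derivative_at_within in blast)

text \<open>The mass is the increase of the slope from 0 to 1. It is stated as a nonnegative
  integral so that the product formula for Lebesgue measure applies coordinatewise.\<close>

lemma nn_integral_ramps2: "(\<integral>\<^sup>+ s. ennreal (ramps \<epsilon> 2 (s - x)) \<partial>lborel) = 1"
proof -
  have d: "((\<lambda>s. ramps \<epsilon> 1 (s - x)) has_real_derivative ramps \<epsilon> 2 (s - x)) (at s)" for s
    using ramps_shift_DERIV[of \<epsilon> 1] by (simp add: numeral_2_eq_2)
  \<comment> \<open>The end points at distance \<open>2 * \<epsilon>\<close> meet the strict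
    inequalities in \<open>ramps1_left\<close> and \<open>ramps1_right\<close>.\<close>
  have "((\<lambda>s. ramps \<epsilon> 2 (s - x)) has_integral (ramps \<epsilon> 1 (x + 2 * \<epsilon> - x) - ramps \<epsilon> 1 (x - 2 * \<epsilon> - x))) {x - 2 * \<epsilon>..x + 2 * \<epsilon>}"
    using eps d by (intro fundamental_theorem_of_calculus)
      (auto simp: has_real_derivative_iff_has_vector_derivative[symmetric] intro: has_field_derivative_at_within)
  then have "((\<lambda>s. ramps \<epsilon> 2 (s - x)) has_integral 1) {x - 2 * \<epsilon>..x + 2 * \<epsilon>}"
  proof -
    have "ramps \<epsilon> 1 (x + 2 * \<epsilon> - x) = 1" "ramps \<epsilon> 1 (x - 2 * \<epsilon> - x) = 0"
      using eps by (auto intro!: ramps1_left ramps1_right simp del: One_nat_def)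
    then show ?thesis using \<open>(_ has_integral (_ - _)) _\<close> by (simp only: diff_zero)
  qed
  then have "((\<lambda>s. ramps \<epsilon> 2 (s - x)) has_integral 1) UNIV"
    by (rule has_integral_on_superset) (use eps in \<open>auto intro!: ramps2_out\<close>)
  then have "(\<integral>\<^sup>+ s. ennreal (ramps \<epsilon> 2 (s - x)) \<partial>lborel) = ennreal 1"
    by (intro nn_integral_has_integral_lborel borel_measurable_continuous_onI ramps2_nonneg
        continuous_on_compose2[OF continuous_ramps[of UNIV]] continuous_intros) auto
  then show ?thesis by simp
qed

end

section \<open>Product mollifiers on the cube\<close>

lemma Basis_vec_real: "(Basis :: (real^'d) set) = (\<lambda>i. axis i 1) ` UNIV"
  by (auto simp: Basis_vec_def)

lemma prod_Basis_vec:
  "(\<Prod>b\<in>(Basis :: (real^'d::finite) set). F b) = (\<Prod>i\<in>UNIV. F (axis i 1))"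
  unfolding Basis_vec_real by (subst prod.reindex) (auto intro!: inj_onI simp: axis_eq_axis)

definition mollifier :: "real \<Rightarrow> real^'d::finite \<Rightarrow> real^'d \<Rightarrow> real" where
  "mollifier \<epsilon> x s = (\<Prod>i\<in>UNIV. ramps \<epsilon> 2 (s $ i - x $ i))"

lemma continuous_mollifier: "\<epsilon> > 0 \<Longrightarrow> continuous_on S (mollifier \<epsilon> x)"
  unfolding mollifier_def
  by (intro continuous_prod_coords continuous_on_compose2[OF continuous_ramps[of _ UNIV]] continuous_intros) auto

lemma mollifier_nonneg: "\<epsilon> > 0 \<Longrightarrow> mollifier \<epsilon> x s \<ge> 0"
  unfolding mollifier_def by (intro prod_nonneg ramps2_nonneg) auto

lemma mollifier_out: "\<epsilon> > 0 \<Longrightarrow> \<bar>s $ i - x $ i\<bar> \<ge> \<epsilon> \<Longrightarrow> mollifier \<epsilon> x s = 0"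
  unfolding mollifier_def by (intro prod_zero) (auto intro: ramps2_out)

lemma integral_mollifier:
  assumes eps: "\<epsilon> > 0" and x: "\<And>i. \<epsilon> \<le> x $ i \<and> x $ i \<le> 1 - \<epsilon>"
  shows "(LINT s|lebesgue_on unit_cube. mollifier \<epsilon> x s) = 1"
proof -
  have out: "mollifier \<epsilon> x s = 0" if "s \<notin> unit_cube" for s
  proof -
    have "\<exists>i. s $ i < 0 \<or> 1 < s $ i" using that by (auto simp: unit_cube_def mem_box_cart not_le)
    then obtain i where "s $ i < 0 \<or> 1 < s $ i" ..
    then show ?thesis using x[of i] by (intro mollifier_out[OF eps, of _ i]) auto
  qed
  have meas: "mollifier \<epsilon> x \<in> borel_measurable borel"
    by (intro borel_measurable_continuous_onI continuous_mollifier eps)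
  have "(LINT s|lebesgue_on unit_cube. mollifier \<epsilon> x s) = (LINT s|lebesgue. indicator unit_cube s *\<^sub>R mollifier \<epsilon> x s)"
    by (rule integral_restrict_space) (simp add: unit_cube_def)
  also have "\<dots> = (LINT s|lebesgue. mollifier \<epsilon> x s)"
    by (rule Bochner_Integration.integral_cong) (auto simp: indicator_def out)
  also have "\<dots> = (LINT s|lborel. mollifier \<epsilon> x s)"
    using meas by (intro integral_completion) simp
  also have "\<dots> = enn2real (\<integral>\<^sup>+ s. ennreal (mollifier \<epsilon> x s) \<partial>lborel)"
    using meas mollifier_nonneg[OF eps] by (intro integral_eq_nn_integral) auto
  also have "(\<integral>\<^sup>+ s. ennreal (mollifier \<epsilon> x s) \<partial>lborel)
      = (\<integral>\<^sup>+ s. (\<Prod>b\<in>Basis. ennreal (ramps \<epsilon> 2 (s \<bullet> b - x \<bullet> b))) \<partial>lborel)"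
    unfolding mollifier_def using ramps2_nonneg[OF eps]
    by (simp add: prod_Basis_vec inner_axis prod_ennreal)
  also have "\<dots> = (\<Prod>b\<in>Basis. (\<integral>\<^sup>+ s. ennreal (ramps \<epsilon> 2 (s - x \<bullet> b)) \<partial>lborel))"
  proof (rule nn_integral_lborel_prod)
    show "(\<lambda>s. ennreal (ramps \<epsilon> 2 (s - x \<bullet> b))) \<in> borel_measurable borel" for b
      by (intro measurable_compose[OF _ measurable_ennreal] borel_measurable_continuous_onI
          continuous_on_compose2[OF continuous_ramps[OF eps, of UNIV]] continuous_intros) auto
  qed simp
  also have "\<dots> = 1" by (simp add: nn_integral_ramps2[OF eps])
  finally show ?thesis by simp
qed

lemma mollifier_tendsto:
  fixes f :: "real^'d::finite \<Rightarrow> real"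
  assumes f: "continuous_on unit_cube f" and x: "\<And>i. 0 < x $ i \<and> x $ i < 1"
  shows "((\<lambda>\<epsilon>. LINT s|lebesgue_on unit_cube. f s * mollifier \<epsilon> x s) \<longlongrightarrow> f x) (at_right 0)"
proof (rule tendstoI)
  fix \<eta> :: real assume \<eta>: "\<eta> > 0"
  have xc: "x \<in> unit_cube" using x by (auto simp: unit_cube_def mem_box_cart less_imp_le)
  have "\<forall>e>0. \<exists>d>0. \<forall>s\<in>unit_cube. dist s x < d \<longrightarrow> dist (f s) (f x) < e"
    using f xc unfolding continuous_on_iff by blast
  then obtain \<delta> where \<delta>: "\<delta> > 0" "\<And>s. s \<in> unit_cube \<Longrightarrow> dist s x < \<delta> \<Longrightarrow> dist (f s) (f x) < \<eta> / 2"
    using half_gt_zero[OF \<eta>] by blast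
  define m where "m = Min ((\<lambda>i. min (x $ i) (1 - x $ i)) ` UNIV)"
  have m: "m > 0" "\<And>i. m \<le> x $ i" "\<And>i. x $ i \<le> 1 - m"
  proof -
    show "m > 0" using x by (auto simp: m_def)
    have "m \<le> min (x $ i) (1 - x $ i)" for i unfolding m_def by (rule Min_le) auto
    then show "m \<le> x $ i" "x $ i \<le> 1 - m" for i by (simp_all add: le_diff_eq algebra_simps)
  qed
  \<comment> \<open>The bound \<open>m\<close> keeps the support of the mollifier inside the cube;
    the other one makes the l1 norm, and with it the distance from \<open>x\<close>, smaller than
    \<delta> on the support.\<close>
  define r where "r = min m (\<delta> / (real CARD('d) + 1))"
  have r: "r > 0" "r \<le> m" "r * real CARD('d) < \<delta>"
  proof -
    show "r > 0" "r \<le> m" using m \<delta> by (auto simp: r_def)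
    have "r * real CARD('d) \<le> \<delta> / (real CARD('d) + 1) * real CARD('d)" by (intro mult_right_mono) (auto simp: r_def)
    also have "\<dots> < \<delta>" using \<delta> by (simp add: field_simps)
    finally show "r * real CARD('d) < \<delta>" .
  qed
  have "dist (LINT s|lebesgue_on unit_cube. f s * mollifier \<epsilon> x s) (f x) < \<eta>" if e: "0 < \<epsilon>" "\<epsilon> < r" for \<epsilon>
  proof -
    have int1: "integrable (lebesgue_on unit_cube) (mollifier \<epsilon> x)"
      unfolding unit_cube_def by (intro continuous_imp_integrable continuous_mollifier e)
    have int2: "integrable (lebesgue_on unit_cube) (\<lambda>s. f s * mollifier \<epsilon> x s)"
      using f unfolding unit_cube_def
      by (intro continuous_imp_integrable continuous_mollifier e continuous_on_mult)
    have one: "(LINT s|lebesgue_on unit_cube. mollifier \<epsilon> x s) = 1"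
    proof (rule integral_mollifier[OF e(1)])
      fix i show "\<epsilon> \<le> x $ i \<and> x $ i \<le> 1 - \<epsilon>" using m(2,3)[of i] r(2) e by linarith
    qed
    have "(LINT s|lebesgue_on unit_cube. f s * mollifier \<epsilon> x s) - f x
        = (LINT s|lebesgue_on unit_cube. f s * mollifier \<epsilon> x s - f x * mollifier \<epsilon> x s)"
      using int1 int2 one by simp
    also have "\<bar>\<dots>\<bar> \<le> (LINT s|lebesgue_on unit_cube. \<bar>f s * mollifier \<epsilon> x s - f x * mollifier \<epsilon> x s\<bar>)"
      by (rule integral_abs_bound)
    also have "\<dots> \<le> (LINT s|lebesgue_on unit_cube. \<eta> / 2 * mollifier \<epsilon> x s)"
    proof (rule integral_mono)
      show "integrable (lebesgue_on unit_cube) (\<lambda>s. \<bar>f s * mollifier \<epsilon> x s - f x * mollifier \<epsilon> x s\<bar>)"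
        using int1 int2 by auto
      show "integrable (lebesgue_on unit_cube) (\<lambda>s. \<eta> / 2 * mollifier \<epsilon> x s)" using int1 by simp
      fix s :: "real^'d" assume "s \<in> space (lebesgue_on unit_cube)"
      then have s: "s \<in> unit_cube" by simp
      have "\<bar>f s - f x\<bar> * mollifier \<epsilon> x s \<le> \<eta> / 2 * mollifier \<epsilon> x s"
      proof (cases "\<forall>i. \<bar>s $ i - x $ i\<bar> < \<epsilon>")
        case True
        have "dist s x \<le> (\<Sum>i\<in>UNIV. \<bar>(s - x) $ i\<bar>)" unfolding dist_norm by (rule norm_le_l1_cart)
        also have "\<dots> \<le> (\<Sum>i\<in>(UNIV :: 'd set). r)" 
        proof (rule sum_mono)
          fix i
          show "\<bar>(s - x) $ i\<bar> \<le> r" using spec[OF True, of i] e by simp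
        qed
        also have "\<dots> < \<delta>" using r by (simp add: mult.commute)
        finally have "\<bar>f s - f x\<bar> \<le> \<eta> / 2" using \<delta>(2)[OF s] by (simp add: dist_real_def)
        then show ?thesis by (intro mult_right_mono mollifier_nonneg e)
      next
        case False
        then show ?thesis using mollifier_out[OF e(1), of s _ x] by (auto simp: not_less)
      qed
      then show "\<bar>f s * mollifier \<epsilon> x s - f x * mollifier \<epsilon> x s\<bar> \<le> \<eta> / 2 * mollifier \<epsilon> x s"
        using mollifier_nonneg[OF e(1), of x s] by (simp add: abs_mult flip: left_diff_distrib)
    qed
    also have "\<dots> = \<eta> / 2" by (simp add: one)
    finally show ?thesis using \<eta> by (simp add: dist_real_def)
  qed
  then show "\<forall>\<^sub>F \<epsilon> in at_right 0. dist (LINT s|lebesgue_on unit_cube. f s * mollifier \<epsilon> x s) (f x) < \<eta>"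
    using r(1) unfolding eventually_at_right_field by (intro exI[of _ r]) auto
qed

text \<open>In the variable \<open>s\<close>, \<open>n\<close> counts derivatives. The two bumps at 1/4 and 3/4 are weighted so that
  they have the same moments of order 0 and 1 as the mollifier centred at \<open>x\<close>; therefore the
  difference of the two has a compactly supported second antiderivative, which is the kernel for \<open>u = True\<close>.\<close>

definition kern :: "bool \<Rightarrow> real \<Rightarrow> real \<Rightarrow> nat \<Rightarrow> real \<Rightarrow> real" where
  "kern u \<epsilon> x n s = (if u
     then ramps \<epsilon> n (s - x) - (3/2 - 2 * x) * ramps (1/8) n (s - 1/4) - (2 * x - 1/2) * ramps (1/8) n (s - 3/4)
     else (3/2 - 2 * x) * ramps (1/8) (n + 2) (s - 1/4) + (2 * x - 1/2) * ramps (1/8) (n + 2) (s - 3/4))"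

lemma kern_DERIV: "(kern u \<epsilon> x n has_real_derivative kern u \<epsilon> x (Suc n) s) (at s)"
proof -
  have sh: "((\<lambda>s. ramps \<delta> m (s - c)) has_real_derivative ramps \<delta> (Suc m) (s - c)) (at s)" for \<delta> c m
    by (rule ramps_shift_DERIV)
  show ?thesis
    unfolding kern_def[abs_def]
    by (cases u) (auto intro!: DERIV_diff DERIV_add DERIV_cmult sh)
qed

text \<open>For \<open>u = False\<close> index 0 is already the pair of bumps, as no derivative is
  moved in that coordinate; for \<open>u = True\<close> index 2 is the mollifier minus this
  pair.\<close>

lemma kern_split: "ramps \<epsilon> 2 (s - x) = kern True \<epsilon> x 2 s + kern False \<epsilon> x 0 s"
  by (simp add: kern_def numeral_2_eq_2)

text \<open>For \<open>u = True\<close> all ramps vanish on the left, and on the right each of them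
  is the identity. There they cancel because the weights \<open>3/2 - 2 * x\<close> and
  \<open>2 * x - 1/2\<close> sum to 1 and average 1/4 and 3/4 to \<open>x\<close>. For
  \<open>u = False\<close> the bumps of radius 1/8 stay within [1/8, 7/8].\<close>

lemma kern_support:
  assumes "0 < \<epsilon>" "\<epsilon> \<le> 1/8" "a \<le> 1/8" "a + \<epsilon> \<le> x" "x \<le> 1 - \<epsilon> - a" "s \<le> a \<or> 1 - a \<le> s"
  shows "kern u \<epsilon> x 0 s = 0"
  using assms(6)
proof
  assume "s \<le> a"
  then show ?thesis using assms(1-5)
    by (cases u) (auto simp: kern_def ramps_left ramps2_out numeral_2_eq_2[symmetric])
next
  assume "1 - a \<le> s"
  then show ?thesis using assms(1-5)
    by (cases u) (auto simp: kern_def ramps_right ramps2_out numeral_2_eq_2[symmetric] algebra_simps)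
qed

text \<open>As functions of \<open>x\<close> the bump terms are affine, and the only other term is a
  reflected ramp: convex with slope in [-1, 0], whatever \<epsilon> is. \<open>4 * B\<close> covers
  the slope of the pair of bumps and 5 the ramps, which are at most 9/8 and 1.\<close>

lemma kern_smooth_convex:
  "\<exists>C\<ge>0. \<forall>u \<epsilon> s. 0 < \<epsilon> \<longrightarrow> \<epsilon> \<le> 1/8 \<longrightarrow> 0 \<le> s \<longrightarrow> s \<le> 1 \<longrightarrow> smooth_convex C (\<lambda>x. kern u \<epsilon> x 0 s)"
proof -
  have "bounded (ramps (1/8) 2 ` {-1..1})"
    by (intro compact_imp_bounded compact_continuous_image continuous_ramps) auto
  then obtain B where B: "B > 0" "\<And>v. v \<in> {-1..1} \<Longrightarrow> \<bar>ramps (1/8) 2 v\<bar> \<le> B"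
    unfolding bounded_pos by auto
  have "smooth_convex (4 * B + 5) (\<lambda>x. kern u \<epsilon> x 0 s)"
    if a: "0 < \<epsilon>" "\<epsilon> \<le> 1/8" "0 \<le> s" "s \<le> 1" for u \<epsilon> s
  proof -
    have lin: "\<bar>(3/2 - 2 * x) * p + (2 * x - 1/2) * q\<bar> \<le> 3 * Q" if "\<bar>p\<bar> \<le> Q" "\<bar>q\<bar> \<le> Q" "0 \<le> x" "x \<le> 1" for x p q Q :: real
    proof -
      have "\<bar>3/2 - 2 * x\<bar> \<le> 3/2" "\<bar>2 * x - 1/2\<bar> \<le> 3/2" using that by (intro abs_leI; linarith)+
      then have "\<bar>3/2 - 2 * x\<bar> * \<bar>p\<bar> \<le> 3/2 * Q" "\<bar>2 * x - 1/2\<bar> * \<bar>q\<bar> \<le> 3/2 * Q"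
        using that by (intro mult_mono; linarith)+
      then show ?thesis
        using abs_triangle_ineq[of "(3/2 - 2 * x) * p" "(2 * x - 1/2) * q"] by (simp add: abs_mult)
    qed
    show ?thesis
    proof (cases u)
      case False
      define p q where "p = ramps (1/8) 2 (s - 1/4)" and "q = ramps (1/8) 2 (s - 3/4)"
      have pq: "\<bar>p\<bar> \<le> B" "\<bar>q\<bar> \<le> B" unfolding p_def q_def using a by (auto intro!: B)
      have eq: "(\<lambda>x. kern u \<epsilon> x 0 s) = (\<lambda>x. (3/2 - 2 * x) * p + (2 * x - 1/2) * q)"
        using False by (auto simp: kern_def p_def q_def numeral_2_eq_2)
      show ?thesis
        unfolding smooth_convex_def eq
      proof (intro exI[of _ "\<lambda>_. 2 * q - 2 * p"] conjI allI impI)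
        show "((\<lambda>x. (3/2 - 2 * x) * p + (2 * x - 1/2) * q) has_real_derivative 2 * q - 2 * p) (at x)" for x
          by (auto intro!: derivative_eq_intros)
        show "mono (\<lambda>_::real. 2 * q - 2 * p)" by (simp add: mono_def)
        fix x :: real assume x: "0 \<le> x" "x \<le> 1"
        show "\<bar>(3/2 - 2 * x) * p + (2 * x - 1/2) * q\<bar> \<le> 4 * B + 5"
          using lin[OF pq x] B(1) by linarith
        show "\<bar>2 * q - 2 * p\<bar> \<le> 4 * B + 5" using pq by linarith
      qed
    next
      case True
      define p q where "p = ramps (1/8) 0 (s - 1/4)" and "q = ramps (1/8) 0 (s - 3/4)"
      have pq: "0 \<le> p" "p \<le> 1" "0 \<le> q" "q \<le> 1"
        unfolding p_def q_def using ramps0_bounds[of "1/8" "s - 1/4"] ramps0_bounds[of "1/8" "s - 3/4"] a by auto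
      have eq: "(\<lambda>x. kern u \<epsilon> x 0 s) = (\<lambda>x. ramps \<epsilon> 0 (s - x) - ((3/2 - 2 * x) * p + (2 * x - 1/2) * q))"
        using True by (auto simp: kern_def p_def q_def)
      show ?thesis
        unfolding smooth_convex_def eq
      proof (intro exI[of _ "\<lambda>x. - ramps \<epsilon> 1 (s - x) - (2 * q - 2 * p)"] conjI allI impI)
        show "((\<lambda>x. ramps \<epsilon> 0 (s - x) - ((3/2 - 2 * x) * p + (2 * x - 1/2) * q)) has_real_derivative
            - ramps \<epsilon> 1 (s - x) - (2 * q - 2 * p)) (at x)" for x
        proof (rule DERIV_diff)
          show "((\<lambda>x. ramps \<epsilon> 0 (s - x)) has_real_derivative - ramps \<epsilon> 1 (s - x)) (at x)"
          proof -
            have "((\<lambda>x. ramps \<epsilon> 0 (s - x)) has_real_derivative ramps \<epsilon> (Suc 0) (s - x) * (-1)) (at x)"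
              by (rule DERIV_chain2[OF ramps_DERIV]) (auto intro!: derivative_eq_intros)
            then show ?thesis by simp
          qed
          show "((\<lambda>x. (3/2 - 2 * x) * p + (2 * x - 1/2) * q) has_real_derivative 2 * q - 2 * p) (at x)"
            by (auto intro!: derivative_eq_intros)
        qed
        show "mono (\<lambda>x. - ramps \<epsilon> 1 (s - x) - (2 * q - 2 * p))"
          using ramps1_mono[OF a(1)] by (auto simp: mono_def)
        fix x :: real assume x: "0 \<le> x" "x \<le> 1"
        have "\<bar>(3/2 - 2 * x) * p + (2 * x - 1/2) * q\<bar> \<le> 3 * 1" using pq x by (intro lin) auto
        then show "\<bar>ramps \<epsilon> 0 (s - x) - ((3/2 - 2 * x) * p + (2 * x - 1/2) * q)\<bar> \<le> 4 * B + 5"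
          using ramps0_bounds[OF a(1), of "s - x"] a x B(1) by linarith
        show "\<bar>- ramps \<epsilon> 1 (s - x) - (2 * q - 2 * p)\<bar> \<le> 4 * B + 5"
          using ramps1[OF a(1), of "s - x"] pq B(1) by linarith
      qed
    qed
  qed
  then show ?thesis using B(1) by (intro exI[of _ "4 * B + 5"]) auto
qed

text \<open>Each factor of the mollifier is split by \<open>kern_split\<close> and the product is
  expanded over subsets \<open>e\<close>. The term of \<open>e\<close> is the mixed second
  derivative in the directions of \<open>e\<close> of a product test function, so the weak
  derivative takes these derivatives over.\<close>

lemma mollified_representation:
  fixes f :: "real^'d::finite \<Rightarrow> real" and g :: "'d set \<Rightarrow> real^'d \<Rightarrow> real"
  assumes f: "continuous_on unit_cube f" and weak: "\<And>e. is_weak_mixed2 e f (g e)"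
    and eps: "0 < \<epsilon>" "\<epsilon> \<le> 1/8" and x: "\<And>i. \<epsilon> < x $ i \<and> x $ i < 1 - \<epsilon>"
  shows "(LINT s|lebesgue_on unit_cube. f s * mollifier \<epsilon> x s)
       = (\<Sum>e\<in>UNIV. LINT s|lebesgue_on unit_cube. g e s * (\<Prod>i\<in>UNIV. kern (i \<in> e) \<epsilon> (x $ i) 0 (s $ i)))"
proof -
  have cont: "continuous_on UNIV (kern u \<epsilon> y n)" for u y n
    by (rule DERIV_continuous_on) (use kern_DERIV has_field_derivative_at_within in blast)
  have split: "mollifier \<epsilon> x s = (\<Sum>e\<in>UNIV. \<Prod>i\<in>UNIV. kern (i \<in> e) \<epsilon> (x $ i) (if i \<in> e then 2 else 0) (s $ i))" for s
  proof -
    have "mollifier \<epsilon> x s = (\<Prod>i\<in>UNIV. kern True \<epsilon> (x $ i) 2 (s $ i) + kern False \<epsilon> (x $ i) 0 (s $ i))"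
      by (simp add: mollifier_def kern_split)
    also have "\<dots> = (\<Sum>e\<in>Pow UNIV. (\<Prod>i\<in>e. kern True \<epsilon> (x $ i) 2 (s $ i)) * (\<Prod>i\<in>UNIV - e. kern False \<epsilon> (x $ i) 0 (s $ i)))"
      by (rule prod_add) simp
    also have "\<dots> = (\<Sum>e\<in>UNIV. \<Prod>i\<in>UNIV. kern (i \<in> e) \<epsilon> (x $ i) (if i \<in> e then 2 else 0) (s $ i))"
      unfolding Pow_UNIV
    proof (rule sum.cong[OF refl])
      fix e :: "'d set"
      have "(\<Prod>i\<in>UNIV. kern (i \<in> e) \<epsilon> (x $ i) (if i \<in> e then 2 else 0) (s $ i))
         = (\<Prod>i\<in>UNIV - e. kern (i \<in> e) \<epsilon> (x $ i) (if i \<in> e then 2 else 0) (s $ i))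
           * (\<Prod>i\<in>e. kern (i \<in> e) \<epsilon> (x $ i) (if i \<in> e then 2 else 0) (s $ i))"
        by (rule prod.subset_diff) auto
      then show "(\<Prod>i\<in>e. kern True \<epsilon> (x $ i) 2 (s $ i)) * (\<Prod>i\<in>UNIV - e. kern False \<epsilon> (x $ i) 0 (s $ i))
         = (\<Prod>i\<in>UNIV. kern (i \<in> e) \<epsilon> (x $ i) (if i \<in> e then 2 else 0) (s $ i))"
        by (simp add: mult.commute)
    qed
    finally show ?thesis .
  qed
  define m where "m = Min ((\<lambda>i. min (x $ i - \<epsilon>) (1 - \<epsilon> - x $ i)) ` UNIV)"
  have m0: "m > 0" using x by (auto simp: m_def)
  have mi: "m \<le> x $ i - \<epsilon>" "m \<le> 1 - \<epsilon> - x $ i" for i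
  proof -
    have "m \<le> min (x $ i - \<epsilon>) (1 - \<epsilon> - x $ i)" unfolding m_def by (rule Min_le) auto
    then show "m \<le> x $ i - \<epsilon>" "m \<le> 1 - \<epsilon> - x $ i" by auto
  qed
  \<comment> \<open>A common margin of all supports from the boundary; the cap 1/8 is what the fixed
    bumps at 1/4 and 3/4 permit.\<close>
  define a where "a = min m (1/8)"
  have "(LINT s|lebesgue_on unit_cube. f s * mollifier \<epsilon> x s)
      = (LINT s|lebesgue_on unit_cube. (\<Sum>e\<in>UNIV. f s * (\<Prod>i\<in>UNIV. kern (i \<in> e) \<epsilon> (x $ i) (if i \<in> e then 2 else 0) (s $ i))))"
    by (simp add: split sum_distrib_left)
  also have "\<dots> = (\<Sum>e\<in>UNIV. LINT s|lebesgue_on unit_cube. f s * (\<Prod>i\<in>UNIV. kern (i \<in> e) \<epsilon> (x $ i) (if i \<in> e then 2 else 0) (s $ i)))"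
    using f unfolding unit_cube_def
    by (intro Bochner_Integration.integral_sum continuous_imp_integrable continuous_on_mult continuous_prod_coords cont)
  also have "\<dots> = (\<Sum>e\<in>UNIV. LINT s|lebesgue_on unit_cube. g e s * (\<Prod>i\<in>UNIV. kern (i \<in> e) \<epsilon> (x $ i) 0 (s $ i)))"
  proof (rule sum.cong[OF refl])
    fix e :: "'d set"
    obtain xs where xs: "set xs = e" "distinct xs" using finite_distinct_list[of e] by auto
    \<comment> \<open>Lists every direction of \<open>e\<close> exactly twice.\<close>
    let ?is = "xs @ xs"
    have cnt: "count (mset ?is) i = (if i \<in> e then 2 else 0)" for i
      using xs by (auto simp: distinct_count_atmost_1)
    have D: "(kern (i \<in> e) \<epsilon> (x $ i) n has_real_derivative kern (i \<in> e) \<epsilon> (x $ i) (Suc n) v) (at v)" for i n v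
      by (rule kern_DERIV)
    have "test_fn (\<lambda>s. \<Prod>i\<in>UNIV. kern (i \<in> e) \<epsilon> (x $ i) 0 (s $ i))"
    proof (rule test_fn_prod[where D = "\<lambda>i. kern (i \<in> e) \<epsilon> (x $ i)" and a = a])
      show "a > 0" using m0 by (simp add: a_def)
      fix i v assume "v \<le> a \<or> 1 - a \<le> v"
      then show "kern (i \<in> e) \<epsilon> (x $ i) 0 v = 0"
        by (intro kern_support[OF eps, of a]) (use mi[of i] in \<open>auto simp: a_def\<close>)
    qed (rule D)
    then have "(LINT s|lebesgue_on unit_cube. f s * iter_pd ?is (\<lambda>s. \<Prod>i\<in>UNIV. kern (i \<in> e) \<epsilon> (x $ i) 0 (s $ i)) s)
        = (LINT s|lebesgue_on unit_cube. g e s * (\<Prod>i\<in>UNIV. kern (i \<in> e) \<epsilon> (x $ i) 0 (s $ i)))"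
      using weak[of e] cnt unfolding is_weak_mixed2_def by blast
    then show "(LINT s|lebesgue_on unit_cube. f s * (\<Prod>i\<in>UNIV. kern (i \<in> e) \<epsilon> (x $ i) (if i \<in> e then 2 else 0) (s $ i)))
        = (LINT s|lebesgue_on unit_cube. g e s * (\<Prod>i\<in>UNIV. kern (i \<in> e) \<epsilon> (x $ i) 0 (s $ i)))"
      using iter_pd_prod[of "\<lambda>i. kern (i \<in> e) \<epsilon> (x $ i)", OF D, of ?is] by (simp only: cnt)
  qed
  finally show ?thesis .
qed

section \<open>Riemann sums on tent-transformed grids\<close>

text \<open>Position 0 is the most significant digit, whereas \<open>set_encode\<close> gives it
  weight 1; reversing the positions makes the code the number of the dyadic interval from left to
  right.\<close>

definition grid_code :: "nat \<Rightarrow> nat set \<Rightarrow> nat" where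
  "grid_code L A = set_encode ((\<lambda>l. L - 1 - l) ` A)"

lemma bij_betw_code: "bij_betw (grid_code L) (Pow {..<L}) {..<2 ^ L}"
proof -
  have "bij_betw (\<lambda>l. L - 1 - l) {..<L} {..<L}"
    by (rule bij_betwI[where g = "\<lambda>l. L - 1 - l"]) auto
  then have 1: "bij_betw ((`) (\<lambda>l. L - 1 - l)) (Pow {..<L}) (Pow {..<L})"
    by (rule bij_betw_Pow)
  have 2: "bij_betw set_encode (Pow {..<L}) {..<2 ^ L}"
  proof (rule bij_betwI[where g = set_decode])
    show "set_encode \<in> Pow {..<L} \<rightarrow> {..<2 ^ L}"
    proof
      fix A assume "A \<in> Pow {..<L}"
      then obtain k where "k < 2 ^ L" "A = set_decode k"
        using bij_betw_set_decode[of L] by (auto simp: bij_betw_def image_iff set_eq_iff dest!: spec[of _ A])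
      then show "set_encode A \<in> {..<2 ^ L}" by simp
    qed
    show "set_decode \<in> {..<2 ^ L} \<rightarrow> Pow {..<L}"
      using bij_betw_set_decode[of L] by (auto simp: bij_betw_def)
    show "set_decode (set_encode A) = A" if "A \<in> Pow {..<L}" for A
      using that finite_subset[of A "{..<L}"] by simp
  qed simp
  show ?thesis
    using bij_betw_trans[OF 1 2] by (simp add: grid_code_def[abs_def] o_def)
qed

lemma pt_code:
  assumes "A \<subseteq> {..<L}"
  shows "pt L A = (real (grid_code L A) + 1/2) / 2 ^ L"
proof -
  have inj: "inj_on (\<lambda>l. L - 1 - l) A"
  proof (rule inj_onI)
    fix x y assume "x \<in> A" "y \<in> A" "L - 1 - x = L - 1 - y"
    moreover from this have "x < L" "y < L" using assms by auto
    ultimately show "x = y" by linarith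
  qed
  have "real (grid_code L A) = (\<Sum>l\<in>A. 2 ^ (L - 1 - l))"
    using sum.reindex[OF inj, of "(^) (2::nat)"] unfolding grid_code_def set_encode_def o_def by simp
  then have "real (grid_code L A) / 2 ^ L = (\<Sum>l\<in>A. 2 ^ (L - 1 - l) / 2 ^ L)"
    by (simp add: sum_divide_distrib)
  also have "\<dots> = (\<Sum>l\<in>A. (1/2) ^ Suc l)"
  proof (rule sum.cong[OF refl])
    fix l assume "l \<in> A"
    then have "L = (L - 1 - l) + Suc l" using assms by auto
    then have "(2::real) ^ L = 2 ^ ((L - 1 - l) + Suc l)" by (rule arg_cong)
    then have "(2::real) ^ L = 2 ^ (L - 1 - l) * 2 ^ Suc l" by (simp only: power_add)
    then show "2 ^ (L - 1 - l) / 2 ^ L = (1/2::real) ^ Suc l" by (simp add: power_one_over field_simps)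
  qed
  finally show ?thesis by (simp add: pt_def add_divide_distrib power_one_over)
qed

text \<open>The tent acting on intervals of level \<open>Suc K\<close>: those of the right half are
  shifted to the origin, those of the left half are reflected.\<close>

definition fold_index :: "nat \<Rightarrow> nat set \<Rightarrow> nat" where
  "fold_index K A = (let k = grid_code (Suc K) A in if 2 ^ K \<le> k then k - 2 ^ K else 2 ^ K - 1 - k)"

definition mid :: "nat \<Rightarrow> nat \<Rightarrow> real" where
  "mid K j = (real j + 1/2) / 2 ^ K"

lemma fold_index_less:
  assumes "A \<subseteq> {..<Suc K}"
  shows "fold_index K A < 2 ^ K"
proof -
  have "grid_code (Suc K) A < 2 * 2 ^ K" using bij_betw_code[of "Suc K"] assms by (auto simp: bij_betw_def)
  then show ?thesis by (auto simp: fold_index_def Let_def)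
qed

text \<open>The half-integer offset is preserved by the reflection, so midpoints of level
  \<open>Suc K\<close> go to midpoints of level \<open>K\<close>.\<close>

lemma tent_pt:
  assumes "A \<subseteq> {..<Suc K}"
  shows "\<bar>2 * pt (Suc K) A - 1\<bar> = mid K (fold_index K A)"
proof -
  define k where "k = grid_code (Suc K) A"
  have e: "2 * pt (Suc K) A - 1 = (real k + 1/2 - 2 ^ K) / 2 ^ K"
    unfolding pt_code[OF assms] k_def by (simp add: field_simps)
  show ?thesis
  proof (cases "2 ^ K \<le> k")
    case True
    then have "real (2 ^ K) \<le> real k" by (simp only: of_nat_le_iff)
    then have "2 ^ K \<le> real k" by (simp only: of_nat_power of_nat_numeral)
    then have "0 \<le> real k + 1/2 - 2 ^ K" by linarith
    then have "0 \<le> (real k + 1/2 - 2 ^ K) / 2 ^ K" by (rule divide_nonneg_pos) simp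
    then have "\<bar>2 * pt (Suc K) A - 1\<bar> = (real k - 2 ^ K + 1/2) / 2 ^ K"
      unfolding e by (simp only: abs_of_nonneg) (simp add: algebra_simps)
    then show ?thesis using True by (simp add: mid_def fold_index_def k_def[symmetric] of_nat_diff)
  next
    case False
    then have k: "k + 1 \<le> 2 ^ K" by simp
    then have "real (k + 1) \<le> real (2 ^ K)" by (simp only: of_nat_le_iff)
    then have "(real k + 1/2 - 2 ^ K) / 2 ^ K \<le> 0" by (intro divide_nonpos_pos) auto
    then have "\<bar>2 * pt (Suc K) A - 1\<bar> = (2 ^ K - real k - 1/2) / 2 ^ K"
      unfolding e by (simp only: abs_of_nonpos minus_divide_left) (simp add: algebra_simps)
    moreover have "real (2 ^ K - 1 - k) = 2 ^ K - 1 - real k" using k by (simp add: of_nat_diff)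
    ultimately show ?thesis using False by (simp add: mid_def fold_index_def k_def[symmetric])
  qed
qed

lemma mid_bounds:
  assumes "j < 2 ^ K"
  shows "(1/2) ^ Suc K \<le> mid K j" "mid K j \<le> 1 - (1/2) ^ Suc K"
proof -
  show "(1/2) ^ Suc K \<le> mid K j" by (simp add: mid_def power_one_over field_simps)
  have "real (j + 1) \<le> real (2 ^ K)" using assms by (simp only: of_nat_le_iff)
  then have "mid K j \<le> (2 ^ K - 1/2) / 2 ^ K" unfolding mid_def by (intro divide_right_mono) auto
  also have "\<dots> = 1 - (1/2) ^ Suc K" by (simp add: diff_divide_distrib power_one_over)
  finally show "mid K j \<le> 1 - (1/2) ^ Suc K" .
qed

text \<open>The tent is two-to-one: \<open>j\<close> comes from \<open>2 ^ K + j\<close> and from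
  its mirror image \<open>2 ^ K - 1 - j\<close>.\<close>

lemma card_fold_fibre:
  assumes "j < 2 ^ K"
  shows "card {A \<in> Pow {..<Suc K}. fold_index K A = j} = 2"
proof -
  let ?P = "\<lambda>k. (if 2 ^ K \<le> k then k - 2 ^ K else 2 ^ K - 1 - k) = j"
  note b = bij_betw_code[of "Suc K"]
  have "{k \<in> {..<2 ^ Suc K}. ?P k} = grid_code (Suc K) ` {A \<in> Pow {..<Suc K}. fold_index K A = j}"
    unfolding bij_betw_imp_surj_on[OF b, symmetric] by (auto simp: fold_index_def Let_def)
  moreover have "inj_on (grid_code (Suc K)) {A \<in> Pow {..<Suc K}. fold_index K A = j}"
    by (rule inj_on_subset[OF bij_betw_imp_inj_on[OF b]]) auto
  ultimately have "card {A \<in> Pow {..<Suc K}. fold_index K A = j} = card {k \<in> {..<2 ^ Suc K}. ?P k}"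
    by (simp only: card_image)
  also have "{k \<in> {..<2 ^ Suc K}. ?P k} = {2 ^ K + j, 2 ^ K - 1 - j}"
    using assms by (auto split: if_splits)
  also have "card \<dots> = 2" using assms by (subst card_2_iff) force
  finally show ?thesis .
qed

text \<open>A discrete form of measure preservation: every fibre has \<open>2 ^ CARD('d)\<close>
  elements, which is exactly the quotient of the two normalisations.\<close>

lemma tent_grid_sum:
  fixes f :: "real^'d::finite \<Rightarrow> real"
  shows "(\<Sum>A\<in>digit_sets (Suc K). f (\<chi> i. \<bar>2 * pt (Suc K) (A i) - 1\<bar>)) / 2 ^ (Suc K * CARD('d))
       = (\<Sum>j\<in>PiE UNIV (\<lambda>_. {..<2 ^ K}). f (\<chi> i. mid K (j i))) / 2 ^ (K * CARD('d))"
proof -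
  define J where "J = PiE (UNIV :: 'd set) (\<lambda>_. {..<2 ^ K :: nat})"
  define \<tau> where "\<tau> A = (\<lambda>i. fold_index K (A i))" for A :: "'d \<Rightarrow> nat set"
  have "(\<Sum>A\<in>digit_sets (Suc K). f (\<chi> i. \<bar>2 * pt (Suc K) (A i) - 1\<bar>)) = (\<Sum>A\<in>digit_sets (Suc K). f (\<chi> i. mid K (\<tau> A i)))"
    by (rule sum.cong) (simp_all add: digit_sets_iff tent_pt \<tau>_def)
  also have "\<dots> = (\<Sum>j\<in>J. \<Sum>A\<in>{A \<in> digit_sets (Suc K). \<tau> A = j}. f (\<chi> i. mid K (\<tau> A i)))"
    by (rule sum.group[symmetric])
      (auto simp: finite_digit_sets J_def finite_PiE \<tau>_def digit_sets_iff fold_index_less)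
  also have "\<dots> = (\<Sum>j\<in>J. 2 ^ CARD('d) * f (\<chi> i. mid K (j i)))"
  proof (rule sum.cong[OF refl])
    fix j assume j: "j \<in> J"
    have "{A \<in> digit_sets (Suc K). \<tau> A = j} = PiE UNIV (\<lambda>i. {B \<in> Pow {..<Suc K}. fold_index K B = j i})"
      by (auto simp: digit_sets_iff \<tau>_def PiE_iff)
    then have "card {A \<in> digit_sets (Suc K). \<tau> A = j} = (\<Prod>i\<in>(UNIV :: 'd set). 2)"
      using j by (simp add: card_PiE card_fold_fibre J_def PiE_iff del: Pow_iff lessThan_Suc)
    moreover have "(\<Sum>A\<in>{A \<in> digit_sets (Suc K). \<tau> A = j}. f (\<chi> i. mid K (\<tau> A i)))
        = (\<Sum>A\<in>{A \<in> digit_sets (Suc K). \<tau> A = j}. f (\<chi> i. mid K (j i)))"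
      by (rule sum.cong) auto
    ultimately show "(\<Sum>A\<in>{A \<in> digit_sets (Suc K). \<tau> A = j}. f (\<chi> i. mid K (\<tau> A i))) = 2 ^ CARD('d) * f (\<chi> i. mid K (j i))"
      by simp
  qed
  also have "\<dots> = 2 ^ CARD('d) * (\<Sum>j\<in>J. f (\<chi> i. mid K (j i)))" by (simp add: sum_distrib_left)
  finally show ?thesis by (simp add: J_def power_add)
qed

text \<open>The minimum puts the face \<open>x = 1\<close> into the last cell, so that the cells partition the closed cube.\<close>

definition cell_index :: "nat \<Rightarrow> real \<Rightarrow> nat" where
  "cell_index K x = min (2 ^ K - 1) (nat \<lfloor>2 ^ K * x\<rfloor>)"

lemma cell_index_less: "cell_index K x < 2 ^ K"
  by (simp add: cell_index_def min_less_iff_disj)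

lemma cell_index_le:
  assumes "0 \<le> x" "x \<le> 1"
  shows "real (cell_index K x) / 2 ^ K \<le> x" "x \<le> (real (cell_index K x) + 1) / 2 ^ K"
proof -
  define m where "m = nat \<lfloor>2 ^ K * x\<rfloor>"
  have m: "real m \<le> 2 ^ K * x" "2 ^ K * x < real m + 1"
    using assms unfolding m_def by (auto simp: of_nat_nat)
  have le: "real (cell_index K x) \<le> real m" by (simp add: cell_index_def m_def)
  show "real (cell_index K x) / 2 ^ K \<le> x" using le m by (simp add: field_simps)
  have "2 ^ K * x \<le> real (cell_index K x) + 1"
  proof (cases "m \<le> 2 ^ K - 1")
    case True
    then show ?thesis using m by (simp add: cell_index_def m_def[symmetric])
  next
    case False
    then have "real (cell_index K x) + 1 = 2 ^ K" by (simp add: cell_index_def m_def[symmetric] of_nat_diff)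
    then show ?thesis using assms by simp
  qed
  then show "x \<le> (real (cell_index K x) + 1) / 2 ^ K" by (simp add: field_simps)
qed

lemma cell_index_eq:
  assumes "j < 2 ^ K" "real j / 2 ^ K < x" "x < (real j + 1) / 2 ^ K"
  shows "cell_index K x = j"
proof -
  have "\<lfloor>2 ^ K * x\<rfloor> = int j" using assms by (intro floor_unique) (auto simp: field_simps)
  then show ?thesis using assms(1) by (simp add: cell_index_def)
qed

section \<open>Riemann sums as integrals of step functions\<close>

definition cell :: "nat \<Rightarrow> ('d::finite \<Rightarrow> nat) \<Rightarrow> (real^'d) set" where
  "cell K j = {s \<in> unit_cube. \<forall>i. cell_index K (s $ i) = j i}"

lemma mem_unit_cube: "s \<in> unit_cube \<longleftrightarrow> (\<forall>i. 0 \<le> s $ i \<and> s $ i \<le> 1)"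
  by (auto simp: unit_cube_def mem_box_cart)

text \<open>A cell contains some of its faces and not others, but it lies between an open box and
  its closure, which differ by a negligible set.\<close>

lemma cell_measure:
  fixes j :: "'d::finite \<Rightarrow> nat"
  assumes j: "\<And>i. j i < 2 ^ K"
  shows "cell K j \<in> sets lebesgue" "measure lebesgue (cell K j) = 1 / 2 ^ (K * CARD('d))"
proof -
  let ?a = "\<chi> i. real (j i) / 2 ^ K :: real^'d" and ?b = "\<chi> i. (real (j i) + 1) / 2 ^ K :: real^'d"
  have in_cube: "box ?a ?b \<subseteq> unit_cube"
  proof
    fix s assume s: "s \<in> box ?a ?b"
    show "s \<in> unit_cube" unfolding mem_unit_cube
    proof
      fix i
      have "real (j i) / 2 ^ K < s $ i" "s $ i < (real (j i) + 1) / 2 ^ K" using s by (auto simp: mem_box_cart)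
      moreover have "real (j i + 1) \<le> real (2 ^ K)" using j[of i] by (simp only: of_nat_le_iff)
      then have "(real (j i) + 1) / 2 ^ K \<le> 1" by simp
      moreover have "0 \<le> real (j i) / 2 ^ K" by simp
      ultimately show "0 \<le> s $ i \<and> s $ i \<le> 1" by linarith
    qed
  qed
  have lo: "box ?a ?b \<subseteq> cell K j"
    using in_cube j by (auto simp: cell_def mem_box_cart intro!: cell_index_eq)
  have hi: "cell K j \<subseteq> cbox ?a ?b"
  proof
    fix s assume "s \<in> cell K j"
    then have "0 \<le> s $ i" "s $ i \<le> 1" "cell_index K (s $ i) = j i" for i by (auto simp: cell_def mem_unit_cube)
    then show "s \<in> cbox ?a ?b" using cell_index_le[of "s $ _" K] by (force simp: mem_box_cart)
  qed
  have "negligible (cell K j - box ?a ?b)"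
    by (rule negligible_subset[OF negligible_frontier_interval[of ?a ?b]]) (use hi in auto)
  then have "box ?a ?b \<union> (cell K j - box ?a ?b) \<in> sets lebesgue"
    by (intro sets.Un) (auto intro: negligible_imp_sets)
  then show sets: "cell K j \<in> sets lebesgue" using lo by (simp add: Un_absorb1)
  have prod: "(\<Prod>b\<in>(Basis :: (real^'d) set). (?b - ?a) \<bullet> b) = 1 / 2 ^ (K * CARD('d))"
    by (simp add: prod_Basis_vec inner_axis add_divide_distrib power_mult power_one_over)
  have le: "\<forall>b\<in>(Basis :: (real^'d) set). ?a \<bullet> b \<le> ?b \<bullet> b"
    by (auto simp: Basis_vec_real inner_axis divide_right_mono)
  have "emeasure lebesgue (cell K j) \<le> emeasure lebesgue (cbox ?a ?b)" using hi by (intro emeasure_mono) auto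
  moreover have "emeasure lebesgue (box ?a ?b) \<le> emeasure lebesgue (cell K j)" using lo sets by (intro emeasure_mono)
  ultimately have "emeasure lebesgue (cell K j) = ennreal (1 / 2 ^ (K * CARD('d)))"
    using le prod by (simp add: emeasure_lborel_cbox_eq emeasure_lborel_box_eq)
  then show "measure lebesgue (cell K j) = 1 / 2 ^ (K * CARD('d))"
    by (simp add: measure_def)
qed

text \<open>Written as the integral of a step function, the Riemann sum becomes accessible to
  dominated convergence.\<close>

lemma riemann_sum_eq:
  fixes f :: "real^'d::finite \<Rightarrow> real"
  shows "(\<lambda>s. f (\<chi> i. mid K (cell_index K (s $ i)))) \<in> borel_measurable (lebesgue_on unit_cube)"
    and "(LINT s|lebesgue_on unit_cube. f (\<chi> i. mid K (cell_index K (s $ i))))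
      = (\<Sum>j\<in>PiE UNIV (\<lambda>_. {..<2 ^ K}). f (\<chi> i. mid K (j i))) / 2 ^ (K * CARD('d))"
proof -
  define J where "J = PiE (UNIV :: 'd set) (\<lambda>_. {..<2 ^ K :: nat})"
  have finJ: "finite J" by (simp add: J_def finite_PiE)
  have cube: "unit_cube \<in> sets (lebesgue :: (real^'d) measure)" by (simp add: unit_cube_def)
  have eq: "f (\<chi> i. mid K (cell_index K (s $ i))) = (\<Sum>j\<in>J. f (\<chi> i. mid K (j i)) * indicator (cell K j) s)"
    if s: "s \<in> space (lebesgue_on unit_cube)" for s
  proof -
    let ?j = "\<lambda>i. cell_index K (s $ i)"
    have "(\<Sum>j\<in>J. f (\<chi> i. mid K (j i)) * indicator (cell K j) s) = (\<Sum>j\<in>J. if j = ?j then f (\<chi> i. mid K (j i)) else 0)"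
      using s by (intro sum.cong) (auto simp: cell_def indicator_def fun_eq_iff)
    also have "\<dots> = f (\<chi> i. mid K (?j i))"
      using finJ by (subst sum.delta) (auto simp: J_def cell_index_less)
    finally show ?thesis by simp
  qed
  have Jlt: "j i < 2 ^ K" if "j \<in> J" for j i using that by (auto simp: J_def)
  have cs: "cell K j \<in> sets (lebesgue_on unit_cube)" if "j \<in> J" for j
    using cell_measure(1)[OF Jlt[OF that]] cube by (auto simp: sets_restrict_space_iff cell_def)
  have cm: "measure (lebesgue_on unit_cube) (cell K j) = 1 / 2 ^ (K * CARD('d))" if "j \<in> J" for j
    using cell_measure(2)[OF Jlt[OF that]] cube by (subst measure_restrict_space) (auto simp: cell_def)
  have fin: "emeasure (lebesgue_on unit_cube) (cell K j) < \<infinity>" for j :: "'d \<Rightarrow> nat"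
  proof -
    have "finite_measure (lebesgue_on (unit_cube :: (real^'d) set))"
      by (rule finite_measure_lebesgue_on) (simp add: unit_cube_def)
    then show ?thesis by (simp add: finite_measure.emeasure_finite less_top[symmetric])
  qed
  have "(\<lambda>s. \<Sum>j\<in>J. f (\<chi> i. mid K (j i)) * indicator (cell K j) s) \<in> borel_measurable (lebesgue_on unit_cube)"
    using cs by (intro borel_measurable_sum borel_measurable_times borel_measurable_const borel_measurable_indicator)
  then show "(\<lambda>s. f (\<chi> i. mid K (cell_index K (s $ i)))) \<in> borel_measurable (lebesgue_on unit_cube)"
    by (subst measurable_cong[OF eq])
  have "(LINT s|lebesgue_on unit_cube. f (\<chi> i. mid K (cell_index K (s $ i))))
      = (LINT s|lebesgue_on unit_cube. (\<Sum>j\<in>J. f (\<chi> i. mid K (j i)) * indicator (cell K j) s))"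
    by (rule Bochner_Integration.integral_cong[OF refl eq])
  also have "\<dots> = (\<Sum>j\<in>J. LINT s|lebesgue_on unit_cube. f (\<chi> i. mid K (j i)) * indicator (cell K j) s)"
    using cs fin by (intro Bochner_Integration.integral_sum integrable_mult_right integrable_real_indicator)
  also have "\<dots> = (\<Sum>j\<in>J. f (\<chi> i. mid K (j i)) * (1 / 2 ^ (K * CARD('d))))"
  proof (rule sum.cong[OF refl])
    fix j assume j: "j \<in> J"
    have "cell K j \<inter> space (lebesgue_on unit_cube) = cell K j" by (auto simp: cell_def)
    then show "(LINT s|lebesgue_on unit_cube. f (\<chi> i. mid K (j i)) * indicator (cell K j) s) = f (\<chi> i. mid K (j i)) * (1 / 2 ^ (K * CARD('d)))"
      using cm[OF j] by simp
  qed
  finally show "(LINT s|lebesgue_on unit_cube. f (\<chi> i. mid K (cell_index K (s $ i))))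
      = (\<Sum>j\<in>PiE UNIV (\<lambda>_. {..<2 ^ K}). f (\<chi> i. mid K (j i))) / 2 ^ (K * CARD('d))"
    by (simp add: J_def sum_divide_distrib)
qed

lemma tent_grid_sum_tendsto:
  fixes f :: "real^'d::finite \<Rightarrow> real"
  assumes f: "continuous_on unit_cube f"
  shows "(\<lambda>L. (\<Sum>A\<in>digit_sets L. f (\<chi> i. \<bar>2 * pt L (A i) - 1\<bar>)) / 2 ^ (L * CARD('d)))
     \<longlonglongrightarrow> (LINT s|lebesgue_on unit_cube. f s)"
proof -
  have "bounded (f ` unit_cube)"
    using f by (intro compact_imp_bounded compact_continuous_image) (simp_all add: unit_cube_def)
  then obtain B where B: "\<And>s. s \<in> unit_cube \<Longrightarrow> \<bar>f s\<bar> \<le> B" unfolding bounded_iff by auto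
  have mid_in: "(\<chi> i. mid K (cell_index K (s $ i))) \<in> unit_cube" for K and s :: "real^'d"
    using mid_bounds[OF cell_index_less, of K]
    by (auto simp: mem_unit_cube intro: order_trans[OF _ mid_bounds(1)] order_trans[OF mid_bounds(2)] cell_index_less)
  have "(\<lambda>K. LINT s|lebesgue_on unit_cube. f (\<chi> i. mid K (cell_index K (s $ i)))) \<longlonglongrightarrow> (LINT s|lebesgue_on unit_cube. f s)"
  proof (rule integral_dominated_convergence[where w = "\<lambda>_. B"])
    show "f \<in> borel_measurable (lebesgue_on unit_cube)"
      using f by (rule continuous_imp_measurable_on_sets_lebesgue) (simp add: unit_cube_def)
    show "integrable (lebesgue_on (unit_cube :: (real^'d) set)) (\<lambda>_. B)"
      unfolding unit_cube_def by (intro continuous_imp_integrable continuous_intros)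
    show "AE s in lebesgue_on unit_cube. norm (f (\<chi> i. mid K (cell_index K (s $ i)))) \<le> B" for K
      using B[OF mid_in] by simp
    show "AE s in lebesgue_on unit_cube. (\<lambda>K. f (\<chi> i. mid K (cell_index K (s $ i)))) \<longlonglongrightarrow> f s"
    proof (rule AE_I2)
      fix s :: "real^'d" assume "s \<in> space (lebesgue_on unit_cube)"
      then have s: "s \<in> unit_cube" by simp
      have "(\<lambda>K. \<chi> i. mid K (cell_index K (s $ i))) \<longlonglongrightarrow> s"
      proof (rule vec_tendstoI)
        fix i
        have "(\<lambda>K. mid K (cell_index K (s $ i))) \<longlonglongrightarrow> s $ i"
        proof (rule Lim_transform_bound[where g = "\<lambda>K. (1/2::real) ^ K", of "\<lambda>K. mid K (cell_index K (s $ i)) - s $ i" for i, THEN LIM_zero_cancel])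
          show "\<forall>\<^sub>F K in sequentially. norm (mid K (cell_index K (s $ i)) - s $ i) \<le> norm ((1/2::real) ^ K)"
          proof (rule always_eventually, rule allI)
            fix K
            have "0 \<le> s $ i" "s $ i \<le> 1" using s by (auto simp: mem_unit_cube)
            from cell_index_le[OF this, of K]
            show "norm (mid K (cell_index K (s $ i)) - s $ i) \<le> norm ((1/2::real) ^ K)"
              by (auto simp: mid_def power_one_over abs_le_iff field_simps)
          qed
          show "(\<lambda>K. (1/2::real) ^ K) \<longlonglongrightarrow> 0" by (rule LIMSEQ_realpow_zero) auto
        qed
        then show "(\<lambda>K. (\<chi> i. mid K (cell_index K (s $ i))) $ i) \<longlonglongrightarrow> s $ i" by simp
      qed
      then show "(\<lambda>K. f (\<chi> i. mid K (cell_index K (s $ i)))) \<longlonglongrightarrow> f s"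
        using f s mid_in by (intro continuous_on_tendsto_compose[OF f]) auto
    qed
  qed (rule riemann_sum_eq(1))
  then have "(\<lambda>K. (\<Sum>A\<in>digit_sets (Suc K). f (\<chi> i. \<bar>2 * pt (Suc K) (A i) - 1\<bar>)) / 2 ^ (Suc K * CARD('d)))
     \<longlonglongrightarrow> (LINT s|lebesgue_on unit_cube. f s)"
    by (simp only: riemann_sum_eq(2) tent_grid_sum)
  then show ?thesis by (rule LIMSEQ_imp_Suc)
qed

section \<open>The error bound\<close>

definition tent_pt_vec :: "nat \<Rightarrow> ('d::finite \<Rightarrow> nat set) \<Rightarrow> real^'d" where
  "tent_pt_vec L A = (\<chi> i. \<bar>2 * pt L (A i) - 1\<bar>)"

text \<open>A finite linear combination of point evaluations. It therefore commutes with integration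
  in the parameter \<open>s\<close> and with limits in \<epsilon>.\<close>

definition grid_error :: "nat \<Rightarrow> ('d::finite \<Rightarrow> nat \<Rightarrow> nat \<Rightarrow> bool) \<Rightarrow> nat \<Rightarrow> (real^'d \<Rightarrow> real) \<Rightarrow> real" where
  "grid_error n Cm L F = (\<Sum>k<2 ^ n. F (tent_pt_vec L (net_digits n Cm k))) / 2 ^ n
     - (\<Sum>A\<in>digit_sets L. F (tent_pt_vec L A)) / 2 ^ (L * CARD('d))"

text \<open>The coordinate bounds of \<open>walsh_coeff_tent\<close> multiply to
  (1/2)^\<open>weight2 T\<close>. Then \<open>sum_weight_bound\<close> is used with
  \<open>M = 2 * n - t\<close>, which by linearity of the dual net bounds both weights and distances
  from below.\<close>

lemma grid_error_prod:
  fixes Cm :: "'d::finite \<Rightarrow> nat \<Rightarrow> nat \<Rightarrow> bool" and h :: "'d \<Rightarrow> real \<Rightarrow> real"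
  assumes net: "is_order_digital_net 2 t n Cm" and L: "2 * n \<le> L"
    and h: "\<And>i. smooth_convex C (h i)" and C: "C \<ge> 0"
  shows "\<bar>grid_error n Cm L (\<lambda>x. \<Prod>i\<in>UNIV. h i (x $ i))\<bar>
     \<le> (8 * C) ^ CARD('d) * (lattice_const (2 * CARD('d) - 1) * (1/2) ^ (2 * n - t) * (real (2 * n - t) + 1) ^ (2 * CARD('d) - 1))"
proof -
  let ?D = "dual_net n Cm L" and ?E = "dual_net n Cm L - {\<lambda>_. {}}"
  have dig: "T i \<subseteq> {..<L}" if "T \<in> ?D" for T i using that by (auto simp: dual_net_def digit_sets_iff)
  have "grid_error n Cm L (\<lambda>x. \<Prod>i\<in>UNIV. h i (x $ i))
      = (\<Sum>T\<in>?E. \<Prod>i\<in>UNIV. walsh_coeff L (T i) (\<lambda>y. h i \<bar>2 * y - 1\<bar>))"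
    using net_error_expansion[OF L, of "\<lambda>i y. h i \<bar>2 * y - 1\<bar>" Cm]
    by (simp add: grid_error_def tent_pt_vec_def)
  also have "\<bar>\<dots>\<bar> \<le> (\<Sum>T\<in>?E. \<bar>\<Prod>i\<in>UNIV. walsh_coeff L (T i) (\<lambda>y. h i \<bar>2 * y - 1\<bar>)\<bar>)"
    by (rule sum_abs)
  also have "\<dots> \<le> (\<Sum>T\<in>?E. (8 * C) ^ CARD('d) * (1/2) ^ weight2 T)"
  proof (rule sum_mono)
    fix T assume T: "T \<in> ?E"
    have "\<bar>\<Prod>i\<in>UNIV. walsh_coeff L (T i) (\<lambda>y. h i \<bar>2 * y - 1\<bar>)\<bar> = (\<Prod>i\<in>UNIV. \<bar>walsh_coeff L (T i) (\<lambda>y. h i \<bar>2 * y - 1\<bar>)\<bar>)"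
      by (rule abs_prod)
    also have "\<dots> \<le> (\<Prod>i\<in>UNIV. 8 * C * (1/2) ^ top_sum 2 (Suc ` T i))"
      using T dig by (intro prod_mono conjI walsh_coeff_tent h) auto
    also have "\<dots> = (8 * C) ^ CARD('d) * (1/2) ^ weight2 T"
      by (simp add: prod.distrib weight2_def power_sum)
    finally show "\<bar>\<Prod>i\<in>UNIV. walsh_coeff L (T i) (\<lambda>y. h i \<bar>2 * y - 1\<bar>)\<bar> \<le> (8 * C) ^ CARD('d) * (1/2) ^ weight2 T" .
  qed
  also have "\<dots> = (8 * C) ^ CARD('d) * (\<Sum>T\<in>?E. (1/2) ^ weight2 T)"
    by (simp add: sum_distrib_left)
  also have "(\<Sum>T\<in>?E. (1/2) ^ weight2 T) \<le> lattice_const (2 * CARD('d) - 1) * (1/2) ^ (2 * n - t) * (real (2 * n - t) + 1) ^ (2 * CARD('d) - 1)"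
  proof (rule sum_weight_bound)
    show "finite ?D" using finite_digit_sets[where 'd = 'd, of L] by (simp add: dual_net_def)
    show "finite (T i)" if "T \<in> ?D" for T i using dig[OF that] finite_subset by blast
    fix S T assume ST: "S \<in> ?D" "T \<in> ?D" "S \<noteq> T"
    have "symdiff S T \<noteq> (\<lambda>_. {})"
    proof
      assume "symdiff S T = (\<lambda>_. {})"
      then have "S i = T i" for i by (auto simp: symdiff_def dest!: fun_cong[of _ _ i])
      then show False using ST(3) by auto
    qed
    then show "weight2 (symdiff S T) > 2 * n - t"
      by (rule dual_net_weight[OF net symdiff_dual_net[OF ST(1,2)]])
  qed (use dual_net_weight[OF net] in auto)
  finally show ?thesis using C by (simp add: mult_left_mono)
qed

section \<open>From product kernels to functions in the unit ball\<close>

lemma measure_unit_cube: "measure (lebesgue_on unit_cube) (unit_cube :: (real^'d::finite) set) = 1"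
proof -
  have "cbox 0 (1 :: real^'d) \<noteq> {}" by (simp add: interval_ne_empty_cart)
  then have "measure lebesgue (cbox 0 (1 :: real^'d)) = 1" by (simp add: content_cbox_cart)
  then show ?thesis by (simp add: measure_restrict_space unit_cube_def)
qed

text \<open>Follows from \<open>\<bar>g\<bar> \<le> (1 + g^2) / 2\<close>, integrated over a set of
  measure 1.\<close>

lemma in_L2_integrable:
  fixes g :: "real^'d::finite \<Rightarrow> real"
  assumes "in_L2 g"
  shows "integrable (lebesgue_on unit_cube) g"
    and "(LINT s|lebesgue_on unit_cube. (g s)\<^sup>2) \<le> 1 \<Longrightarrow> (LINT s|lebesgue_on unit_cube. \<bar>g s\<bar>) \<le> 1"
proof -
  have m: "g \<in> borel_measurable (lebesgue_on unit_cube)" and i2: "integrable (lebesgue_on unit_cube) (\<lambda>s. (g s)\<^sup>2)"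
    using assms by (auto simp: in_L2_def)
  have i1: "integrable (lebesgue_on (unit_cube :: (real^'d) set)) (\<lambda>_. 1 :: real)"
    unfolding unit_cube_def by (intro continuous_imp_integrable continuous_intros)
  have le: "\<bar>g s\<bar> \<le> (1 + (g s)\<^sup>2) / 2" for s
    using sum_squares_bound[of 1 "\<bar>g s\<bar>"] by simp
  have i3: "integrable (lebesgue_on unit_cube) (\<lambda>s. (1 + (g s)\<^sup>2) / 2)" using i1 i2 by simp
  show int: "integrable (lebesgue_on unit_cube) g"
    by (rule Bochner_Integration.integrable_bound[OF i3 m]) (use le in \<open>auto intro: order_trans[OF _ abs_ge_self]\<close>)
  assume b: "(LINT s|lebesgue_on unit_cube. (g s)\<^sup>2) \<le> 1"
  have "(LINT s|lebesgue_on unit_cube. \<bar>g s\<bar>) \<le> (LINT s|lebesgue_on unit_cube. (1 + (g s)\<^sup>2) / 2)"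
    using int i3 le by (intro integral_mono) auto
  also have "\<dots> = (1 + (LINT s|lebesgue_on unit_cube. (g s)\<^sup>2)) / 2"
    using i1 i2 measure_unit_cube[where 'd = 'd] by simp
  finally show "(LINT s|lebesgue_on unit_cube. \<bar>g s\<bar>) \<le> 1" using b by simp
qed

text \<open>This distance from the boundary is the room that the mollifier and the test functions
  need.\<close>

lemma tent_pt_vec_bounds:
  assumes "A \<in> digit_sets (Suc K)"
  shows "(1/2) ^ Suc K \<le> tent_pt_vec (Suc K) A $ i" "tent_pt_vec (Suc K) A $ i \<le> 1 - (1/2) ^ Suc K"
proof -
  have A: "A i \<subseteq> {..<Suc K}" using assms unfolding digit_sets_iff by blast
  show "(1/2) ^ Suc K \<le> tent_pt_vec (Suc K) A $ i" "tent_pt_vec (Suc K) A $ i \<le> 1 - (1/2) ^ Suc K"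
    using mid_bounds[OF fold_index_less[OF A]] by (simp_all add: tent_pt_vec_def tent_pt[OF A])
qed

text \<open>The representation is inserted and \<open>grid_error\<close> is moved under the integral
  over \<open>s\<close>, where \<open>Bd\<close> bounds it uniformly. Each weak derivative has L1
  norm at most 1, and there are \<open>2 ^ CARD('d)\<close> of them.\<close>

lemma grid_error_mollified:
  fixes f :: "real^'d::finite \<Rightarrow> real" and g :: "'d set \<Rightarrow> real^'d \<Rightarrow> real"
  assumes f: "continuous_on unit_cube f" and weak: "\<And>e. is_weak_mixed2 e f (g e)"
    and L2: "\<And>e. in_L2 (g e)" "\<And>e. (LINT s|lebesgue_on unit_cube. (g e s)\<^sup>2) \<le> 1"
    and eps: "0 < \<epsilon>" "\<epsilon> \<le> 1/8" "\<epsilon> < (1/2) ^ L" and L: "1 \<le> L" "2 * n \<le> L"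
    and Bd: "\<And>e s. s \<in> unit_cube \<Longrightarrow> \<bar>grid_error n Cm L (\<lambda>x. \<Prod>i\<in>UNIV. kern (i \<in> e) \<epsilon> (x $ i) 0 (s $ i))\<bar> \<le> Bd"
  shows "\<bar>grid_error n Cm L (\<lambda>x. LINT s|lebesgue_on unit_cube. f s * mollifier \<epsilon> x s)\<bar> \<le> 2 ^ CARD('d) * Bd"
proof -
  obtain K where K: "L = Suc K" using L by (cases L) auto
  define k where "k e x s = (\<Prod>i\<in>UNIV. kern (i \<in> e) \<epsilon> (x $ i) 0 (s $ i))" for e :: "'d set" and x s :: "real^'d"
  have rep: "(LINT s|lebesgue_on unit_cube. f s * mollifier \<epsilon> (tent_pt_vec L A) s)
      = (\<Sum>e\<in>UNIV. LINT s|lebesgue_on unit_cube. g e s * k e (tent_pt_vec L A) s)" if "A \<in> digit_sets L" for A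
    unfolding k_def
  proof (rule mollified_representation[OF f weak eps(1,2)])
    fix i
    show "\<epsilon> < tent_pt_vec L A $ i \<and> tent_pt_vec L A $ i < 1 - \<epsilon>"
      using tent_pt_vec_bounds[of A K i] that eps(3) unfolding K by auto
  qed
  have int: "integrable (lebesgue_on unit_cube) (\<lambda>s. g e s * k e x s)" for e x
  proof -
    have "continuous_on UNIV (kern u \<epsilon> y 0)" for u y
      by (rule DERIV_continuous_on) (use kern_DERIV has_field_derivative_at_within in blast)
    then have c: "continuous_on unit_cube (k e x)" unfolding k_def by (intro continuous_prod_coords)
    then have "bounded (k e x ` unit_cube)"
      by (intro compact_imp_bounded compact_continuous_image) (simp_all add: unit_cube_def)
    then obtain B where B: "\<And>s. s \<in> unit_cube \<Longrightarrow> \<bar>k e x s\<bar> \<le> B" unfolding bounded_iff by auto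
    have mk: "k e x \<in> borel_measurable (lebesgue_on unit_cube)"
      using c by (rule continuous_imp_measurable_on_sets_lebesgue) (simp add: unit_cube_def)
    have mg: "g e \<in> borel_measurable (lebesgue_on unit_cube)" using L2(1)[of e] by (simp add: in_L2_def)
    show ?thesis
    proof (rule Bochner_Integration.integrable_bound)
      show "integrable (lebesgue_on unit_cube) (\<lambda>s. B * g e s)" using in_L2_integrable(1)[OF L2(1)] by simp
      show "(\<lambda>s. g e s * k e x s) \<in> borel_measurable (lebesgue_on unit_cube)" using mk mg by simp
      show "AE s in lebesgue_on unit_cube. norm (g e s * k e x s) \<le> norm (B * g e s)"
      proof (rule AE_I2)
        fix s :: "real^'d" assume "s \<in> space (lebesgue_on unit_cube)"
        then have "\<bar>k e x s\<bar> \<le> \<bar>B\<bar>" using B[of s] by (simp add: abs_le_iff)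
        then show "norm (g e s * k e x s) \<le> norm (B * g e s)"
          unfolding real_norm_def abs_mult by (subst mult.commute) (rule mult_right_mono, simp_all)
      qed
    qed
  qed
  have "grid_error n Cm L (\<lambda>x. LINT s|lebesgue_on unit_cube. f s * mollifier \<epsilon> x s)
      = grid_error n Cm L (\<lambda>x. \<Sum>e\<in>UNIV. LINT s|lebesgue_on unit_cube. g e s * k e x s)"
    unfolding grid_error_def by (simp add: rep net_digits_in[OF L(2)])
  also have "\<dots> = (\<Sum>e\<in>UNIV. grid_error n Cm L (\<lambda>x. LINT s|lebesgue_on unit_cube. g e s * k e x s))"
    unfolding grid_error_def sum_subtractf sum_divide_distrib[symmetric]
    by (subst (1 2) sum.swap) simp
  also have "\<dots> = (\<Sum>e\<in>UNIV. LINT s|lebesgue_on unit_cube. g e s * grid_error n Cm L (\<lambda>x. k e x s))"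
  proof (rule sum.cong[OF refl])
    fix e :: "'d set"
    have "(LINT s|lebesgue_on unit_cube. g e s * grid_error n Cm L (\<lambda>x. k e x s))
        = (LINT s|lebesgue_on unit_cube. (\<Sum>j<2 ^ n. g e s * k e (tent_pt_vec L (net_digits n Cm j)) s) / 2 ^ n
            - (\<Sum>A\<in>digit_sets L. g e s * k e (tent_pt_vec L A) s) / 2 ^ (L * CARD('d)))"
      unfolding grid_error_def by (simp add: right_diff_distrib sum_distrib_left)
    also have "\<dots> = (LINT s|lebesgue_on unit_cube. (\<Sum>j<2 ^ n. g e s * k e (tent_pt_vec L (net_digits n Cm j)) s) / 2 ^ n)
            - (LINT s|lebesgue_on unit_cube. (\<Sum>A\<in>digit_sets L. g e s * k e (tent_pt_vec L A) s) / 2 ^ (L * CARD('d)))"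
      using int by (intro Bochner_Integration.integral_diff integrable_divide_zero Bochner_Integration.integrable_sum) auto
    also have "\<dots> = grid_error n Cm L (\<lambda>x. LINT s|lebesgue_on unit_cube. g e s * k e x s)"
      unfolding grid_error_def using int by (simp add: Bochner_Integration.integral_sum)
    finally show "grid_error n Cm L (\<lambda>x. LINT s|lebesgue_on unit_cube. g e s * k e x s)
        = (LINT s|lebesgue_on unit_cube. g e s * grid_error n Cm L (\<lambda>x. k e x s))" by simp
  qed
  also have "\<bar>\<dots>\<bar> \<le> (\<Sum>e\<in>UNIV. \<bar>LINT s|lebesgue_on unit_cube. g e s * grid_error n Cm L (\<lambda>x. k e x s)\<bar>)"
    by (rule sum_abs)
  also have "\<dots> \<le> (\<Sum>e\<in>(UNIV :: 'd set set). Bd)"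
  proof (rule sum_mono)
    fix e :: "'d set"
    have Bd0: "Bd \<ge> 0" using Bd[of 0 e] by (auto simp: mem_unit_cube intro: order_trans[OF abs_ge_zero])
    have ig: "integrable (lebesgue_on unit_cube) (\<lambda>s. \<bar>g e s\<bar> * Bd)"
      using in_L2_integrable(1)[OF L2(1)] by simp
    have "\<bar>LINT s|lebesgue_on unit_cube. g e s * grid_error n Cm L (\<lambda>x. k e x s)\<bar> \<le> (LINT s|lebesgue_on unit_cube. \<bar>g e s\<bar> * Bd)"
    proof (rule order_trans[OF integral_abs_bound integral_mono_AE'])
      show "integrable (lebesgue_on unit_cube) (\<lambda>s. \<bar>g e s\<bar> * Bd)" by (rule ig)
      show "AE s in lebesgue_on unit_cube. \<bar>g e s * grid_error n Cm L (\<lambda>x. k e x s)\<bar> \<le> \<bar>g e s\<bar> * Bd"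
        using Bd unfolding k_def by (intro AE_I2) (auto simp: abs_mult intro!: mult_left_mono)
      show "AE s in lebesgue_on unit_cube. 0 \<le> \<bar>g e s\<bar> * Bd" using Bd0 by simp
    qed
    also have "\<dots> \<le> 1 * Bd"
      using in_L2_integrable(2)[OF L2(1,2), of e] Bd0 by (simp add: mult_left_le_one_le mult_right_mono)
    finally show "\<bar>LINT s|lebesgue_on unit_cube. g e s * grid_error n Cm L (\<lambda>x. k e x s)\<bar> \<le> Bd" by simp
  qed
  also have "\<dots> = 2 ^ CARD('d) * Bd" by (simp add: card_Pow flip: Pow_UNIV)
  finally show ?thesis .
qed


lemma tendsto_grid_error:
  assumes "\<And>A. A \<in> digit_sets L \<Longrightarrow> ((\<lambda>\<epsilon>. F \<epsilon> (tent_pt_vec L A)) \<longlongrightarrow> f (tent_pt_vec L A)) G" and L: "2 * n \<le> L"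
  shows "((\<lambda>\<epsilon>. grid_error n Cm L (F \<epsilon>)) \<longlongrightarrow> grid_error n Cm L f) G"
  unfolding grid_error_def using assms(1) net_digits_in[OF L]
  by (intro tendsto_diff tendsto_divide tendsto_sum tendsto_const) auto

text \<open>For fixed \<open>L\<close> the parameter \<epsilon> tends to 0. The bound obtained is
  independent of \<open>L\<close>, so the later limit in \<open>L\<close> preserves it.\<close>

lemma H2mix_grid_error:
  "\<exists>C0\<ge>0. \<forall>n t Cm f L. is_order_digital_net 2 t n (Cm :: 'd::finite \<Rightarrow> nat \<Rightarrow> nat \<Rightarrow> bool) \<longrightarrow>
     f \<in> H2mix \<longrightarrow> continuous_on unit_cube f \<longrightarrow> H2mix_norm f \<le> 1 \<longrightarrow> 1 \<le> L \<longrightarrow> 2 * n \<le> L \<longrightarrow>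
     \<bar>grid_error n Cm L f\<bar> \<le> C0 * ((1/2) ^ (2 * n - t) * (real (2 * n - t) + 1) ^ (2 * CARD('d) - 1))"
proof -
  let ?q = "2 * CARD('d) - 1"
  obtain C where C: "C \<ge> 0" and kern: "\<And>u \<epsilon> s. 0 < \<epsilon> \<Longrightarrow> \<epsilon> \<le> 1/8 \<Longrightarrow> 0 \<le> s \<Longrightarrow> s \<le> 1 \<Longrightarrow> smooth_convex C (\<lambda>x. kern u \<epsilon> x 0 s)"
    using kern_smooth_convex by blast
  define C0 where "C0 = 2 ^ CARD('d) * ((8 * C) ^ CARD('d) * lattice_const ?q)"
  show ?thesis
  proof (intro exI[of _ C0] conjI allI impI)
    show "C0 \<ge> 0" using C lattice_const_nonneg by (simp add: C0_def)
    fix n t L and Cm :: "'d \<Rightarrow> nat \<Rightarrow> nat \<Rightarrow> bool" and f :: "real^'d \<Rightarrow> real"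
    assume net: "is_order_digital_net 2 t n Cm" and fH: "f \<in> H2mix" and f: "continuous_on unit_cube f"
      and norm: "H2mix_norm f \<le> 1" and L: "1 \<le> L" "2 * n \<le> L"
    have wD: "in_L2 (weak_D e f) \<and> is_weak_mixed2 e f (weak_D e f)" for e
    proof -
      have "\<exists>g. in_L2 g \<and> is_weak_mixed2 e f g" using fH by (simp add: H2mix_def)
      then show ?thesis unfolding weak_D_def by (rule someI_ex)
    qed
    have nn: "0 \<le> (LINT s|lebesgue_on unit_cube. (weak_D e f s)\<^sup>2)" for e by simp
    have "(\<Sum>e\<in>UNIV. LINT s|lebesgue_on unit_cube. (weak_D e f s)\<^sup>2) \<le> 1"
      using norm unfolding H2mix_norm_def by (simp add: real_sqrt_le_1_iff)
    then have g1: "(LINT s|lebesgue_on unit_cube. (weak_D e f s)\<^sup>2) \<le> 1" for e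
      using member_le_sum[of e UNIV "\<lambda>e. LINT s|lebesgue_on unit_cube. (weak_D e f s)\<^sup>2"] nn by force
    define Bd where "Bd = (8 * C) ^ CARD('d) * (lattice_const ?q * (1/2) ^ (2 * n - t) * (real (2 * n - t) + 1) ^ ?q)"
    \<comment> \<open>1/8 is demanded by the kernels, \<open>(1/2) ^ L\<close> by the distance of
      the evaluation points from the boundary.\<close>
    define r :: real where "r = min (1/8) ((1/2) ^ L)"
    have r: "r > 0" by (simp add: r_def)
    obtain K where K: "L = Suc K" using L by (cases L) auto
    have bound: "\<bar>grid_error n Cm L (\<lambda>x. LINT s|lebesgue_on unit_cube. f s * mollifier \<epsilon> x s)\<bar> \<le> 2 ^ CARD('d) * Bd"
      if e: "0 < \<epsilon>" "\<epsilon> < r" for \<epsilon>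
    proof (rule grid_error_mollified[where g = "\<lambda>e. weak_D e f"])
      fix e and s :: "real^'d" assume s: "s \<in> unit_cube"
      show "\<bar>grid_error n Cm L (\<lambda>x. \<Prod>i\<in>UNIV. kern (i \<in> e) \<epsilon> (x $ i) 0 (s $ i))\<bar> \<le> Bd"
        unfolding Bd_def
        by (rule grid_error_prod[where h = "\<lambda>i x. kern (i \<in> e) \<epsilon> x 0 (s $ i)", OF net L(2) kern C])
          (use e s in \<open>auto simp: r_def mem_unit_cube\<close>)
    qed (use f wD g1 e L in \<open>auto simp: r_def\<close>)
    have "((\<lambda>\<epsilon>. grid_error n Cm L (\<lambda>x. LINT s|lebesgue_on unit_cube. f s * mollifier \<epsilon> x s)) \<longlongrightarrow> grid_error n Cm L f) (at_right 0)"
    proof (rule tendsto_grid_error[OF _ L(2)], rule mollifier_tendsto[OF f])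
      fix A :: "'d \<Rightarrow> nat set" and i assume A: "A \<in> digit_sets L"
      have "(0::real) < (1/2) ^ Suc K" by simp
      then show "0 < tent_pt_vec L A $ i \<and> tent_pt_vec L A $ i < 1"
        using tent_pt_vec_bounds[of A K i] A unfolding K by linarith
    qed
    then have "((\<lambda>\<epsilon>. \<bar>grid_error n Cm L (\<lambda>x. LINT s|lebesgue_on unit_cube. f s * mollifier \<epsilon> x s)\<bar>) \<longlongrightarrow> \<bar>grid_error n Cm L f\<bar>) (at_right 0)"
      by (rule tendsto_rabs)
    moreover have "\<forall>\<^sub>F \<epsilon> in at_right 0. \<bar>grid_error n Cm L (\<lambda>x. LINT s|lebesgue_on unit_cube. f s * mollifier \<epsilon> x s)\<bar> \<le> 2 ^ CARD('d) * Bd"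
      unfolding eventually_at_right_field using r bound by (intro exI[of _ r]) auto
    ultimately have "\<bar>grid_error n Cm L f\<bar> \<le> 2 ^ CARD('d) * Bd"
      by (rule tendsto_upperbound) simp
    then show "\<bar>grid_error n Cm L f\<bar> \<le> C0 * ((1/2) ^ (2 * n - t) * (real (2 * n - t) + 1) ^ ?q)"
      by (simp add: Bd_def C0_def mult_ac)
  qed
qed

text \<open>A net point is the lower end of its dyadic interval, so it differs from the midpoint by
  an offset that disappears as \<open>L\<close> grows.\<close>

lemma net_point_pt:
  assumes "2 * n \<le> L"
  shows "pt L (net_digits n Cm k i) = net_point 2 n Cm k $ i + (1/2) ^ Suc L"
proof -
  have "net_point 2 n Cm k $ i = (\<Sum>l<2 * n. if digit n Cm i (Suc l) k then (1/2) ^ Suc l else 0)"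
  proof -
    have "(\<Sum>l=1..2 * n. (if digit n Cm i l k then 1 else 0) * (1/2::real) ^ l)
        = (\<Sum>l=Suc 0..<Suc (2 * n). if digit n Cm i l k then (1/2) ^ l else 0)"
      by (rule sum.cong) auto
    also have "\<dots> = (\<Sum>l=0..<2 * n. if digit n Cm i (Suc l) k then (1/2) ^ Suc l else 0)"
      by (rule sum.shift_bounds_Suc_ivl)
    finally show ?thesis by (simp add: net_point_def atLeast0LessThan)
  qed
  also have "\<dots> = (\<Sum>l\<in>net_digits n Cm k i. (1/2) ^ Suc l)"
    by (subst sum.inter_filter[symmetric]) (auto simp: net_digits_def)
  finally show ?thesis by (simp add: pt_def)
qed

lemma grid_error_tendsto:
  fixes f :: "real^'d::finite \<Rightarrow> real"
  assumes f: "continuous_on unit_cube f"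
  shows "(\<lambda>L. grid_error n Cm L f) \<longlonglongrightarrow>
    (\<Sum>k<2 ^ n. f (tent (net_point 2 n Cm k))) / 2 ^ n - (LINT s|lebesgue_on unit_cube. f s)"
  unfolding grid_error_def
proof (intro tendsto_diff tendsto_divide tendsto_sum tendsto_const)
  show "(\<lambda>L. (\<Sum>A\<in>digit_sets L. f (tent_pt_vec L A)) / 2 ^ (L * CARD('d))) \<longlonglongrightarrow> (LINT s|lebesgue_on unit_cube. f s)"
    unfolding tent_pt_vec_def by (rule tent_grid_sum_tendsto[OF f])
  fix k
  have ev: "\<forall>\<^sub>F L in sequentially. Suc (2 * n) \<le> L" by (rule eventually_ge_at_top)
  have lim: "(\<lambda>L. tent_pt_vec L (net_digits n Cm k)) \<longlonglongrightarrow> tent (net_point 2 n Cm k)"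
  proof (rule vec_tendstoI)
    fix i
    have "(\<lambda>L. (1/2::real) ^ Suc L) \<longlonglongrightarrow> 0" by (rule LIMSEQ_Suc[OF LIMSEQ_realpow_zero]) auto
    then have "(\<lambda>L. \<bar>2 * (net_point 2 n Cm k $ i + (1/2) ^ Suc L) - 1\<bar>) \<longlonglongrightarrow> \<bar>2 * (net_point 2 n Cm k $ i + 0) - 1\<bar>"
      by (intro tendsto_intros)
    moreover have "\<forall>\<^sub>F L in sequentially. \<bar>2 * (net_point 2 n Cm k $ i + (1/2) ^ Suc L) - 1\<bar> = tent_pt_vec L (net_digits n Cm k) $ i"
      using ev by eventually_elim (simp add: tent_pt_vec_def net_point_pt)
    ultimately show "(\<lambda>L. tent_pt_vec L (net_digits n Cm k) $ i) \<longlonglongrightarrow> tent (net_point 2 n Cm k) $ i"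
      by (simp add: tent_def tendsto_cong)
  qed
  have in_cube: "\<forall>\<^sub>F L in sequentially. tent_pt_vec L (net_digits n Cm k) \<in> unit_cube"
    using ev
  proof eventually_elim
    case (elim L)
    then obtain K where K: "L = Suc K" by (cases L) auto
    have "net_digits n Cm k \<in> digit_sets (Suc K)" using elim unfolding K by (intro net_digits_in) auto
    then have b: "(1/2) ^ Suc K \<le> tent_pt_vec (Suc K) (net_digits n Cm k) $ i" "tent_pt_vec (Suc K) (net_digits n Cm k) $ i \<le> 1 - (1/2) ^ Suc K" for i
      by (rule tent_pt_vec_bounds)+
    have "(0::real) \<le> (1/2) ^ Suc K" by simp
    then show ?case unfolding K mem_unit_cube using b by (meson diff_le_eq le_add_same_cancel1 order_trans)
  qed
  \<comment> \<open>The limit may lie on the boundary; continuity of \<open>f\<close> on the closed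
    cube still applies because the cube is closed.\<close>
  have "tent (net_point 2 n Cm k) \<in> unit_cube"
    by (rule Lim_in_closed_set[OF _ in_cube _ lim]) (auto simp: unit_cube_def)
  then show "(\<lambda>L. f (tent_pt_vec L (net_digits n Cm k))) \<longlonglongrightarrow> f (tent (net_point 2 n Cm k))"
    by (rule continuous_on_tendsto_compose[OF f lim _ in_cube])
qed simp

text \<open>(1/2)^(2n - t) equals 2^t N^(-2) unless the subtraction is truncated, and then the
  latter is at least 1. The base \<open>2 * n - t + 1\<close> is at most \<open>3 * n\<close>, which
  is \<open>3 / ln 2\<close> times the logarithm of N.\<close>

lemma rate_bound:
  assumes n: "n \<ge> 1"
  shows "(1/2) ^ (2 * n - t) * (real (2 * n - t) + 1) ^ q
     \<le> (3 / ln 2) ^ q * (2 ^ t * (2 ^ n) powr (-2) * ln (2 ^ n) ^ q)"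
proof -
  have "(1/2::real) ^ (2 * n - t) \<le> 2 ^ t * (1/2) ^ (2 * n)"
  proof (cases "t \<le> 2 * n")
    case True
    then have "(1/2::real) ^ (2 * n) = (1/2) ^ t * (1/2) ^ (2 * n - t)" by (simp flip: power_add)
    then show ?thesis by (simp add: power_one_over)
  next
    case False
    then have "(1::real) \<le> 2 ^ (t - 2 * n)" by simp
    also have "\<dots> = 2 ^ t * (1/2) ^ (2 * n)" using False by (simp add: power_diff power_one_over)
    finally show ?thesis using False by simp
  qed
  also have "(1/2::real) ^ (2 * n) = (2 ^ n) powr (-2)"
    by (simp add: powr_minus power_one_over power_mult power_commutes inverse_eq_divide flip: power_mult)
  finally have 1: "(1/2::real) ^ (2 * n - t) \<le> 2 ^ t * (2 ^ n) powr (-2)" .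
  have "real (2 * n - t) + 1 \<le> 3 * real n" using n by linarith
  then have "(real (2 * n - t) + 1) ^ q \<le> (3 * real n) ^ q" by (intro power_mono) auto
  also have "3 * real n = 3 / ln 2 * ln (2 ^ n)" by (simp add: ln_realpow)
  finally have 2: "(real (2 * n - t) + 1) ^ q \<le> (3 / ln 2) ^ q * ln (2 ^ n) ^ q" by (simp only: power_mult_distrib)
  have "(1/2) ^ (2 * n - t) * (real (2 * n - t) + 1) ^ q \<le> (2 ^ t * (2 ^ n) powr (-2)) * ((3 / ln 2) ^ q * ln (2 ^ n) ^ q)"
    by (rule mult_mono[OF 1 2]) auto
  then show ?thesis by (simp only: mult_ac)
qed

text \<open>\<open>n \<ge> 1\<close> excludes N = 1, where the logarithm and with it the right-hand
  side would vanish.\<close>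

theorem theorem5p2:
  shows "\<exists>C>0. \<forall>(n::nat) (t::nat) (Cm :: 'd::finite \<Rightarrow> nat \<Rightarrow> nat \<Rightarrow> bool).
     n \<ge> 1 \<and> is_order_digital_net 2 t n Cm \<longrightarrow>
     qmc_wce (image_mset tent (digital_net 2 n Cm))
       \<le> ereal (C * 2 ^ t * (2 ^ n) powr (-2) * (ln (2 ^ n)) ^ (2 * CARD('d) - 1))"
proof -
  let ?q = "2 * CARD('d) - 1"
  obtain C0 where C0: "C0 \<ge> 0" and err: "\<And>n t (Cm :: 'd \<Rightarrow> nat \<Rightarrow> nat \<Rightarrow> bool) f L. is_order_digital_net 2 t n Cm \<Longrightarrow>
     f \<in> H2mix \<Longrightarrow> continuous_on unit_cube f \<Longrightarrow> H2mix_norm f \<le> 1 \<Longrightarrow> 1 \<le> L \<Longrightarrow> 2 * n \<le> L \<Longrightarrow>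
     \<bar>grid_error n Cm L f\<bar> \<le> C0 * ((1/2) ^ (2 * n - t) * (real (2 * n - t) + 1) ^ ?q)"
    using H2mix_grid_error[where 'd = 'd] by blast
  \<comment> \<open>The summand 1 makes the constant positive even if \<open>C0\<close> is
    0.\<close>
  define C where "C = C0 * (3 / ln 2) ^ ?q + 1"
  show ?thesis
  proof (intro exI[of _ C] conjI allI impI)
    have "C0 * (3 / ln 2) ^ ?q \<ge> 0" using C0 by (intro mult_nonneg_nonneg zero_le_power) auto
    then show "C > 0" by (simp add: C_def)
    fix n t and Cm :: "'d \<Rightarrow> nat \<Rightarrow> nat \<Rightarrow> bool"
    assume "n \<ge> 1 \<and> is_order_digital_net 2 t n Cm"
    then have n: "n \<ge> 1" and net: "is_order_digital_net 2 t n Cm" by auto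
    define R :: real where "R = 2 ^ t * (2 ^ n) powr (-2) * ln (2 ^ n) ^ ?q"
    have R: "R \<ge> 0" unfolding R_def by (intro mult_nonneg_nonneg zero_le_power) auto
    show "qmc_wce (image_mset tent (digital_net 2 n Cm))
       \<le> ereal (C * 2 ^ t * (2 ^ n) powr (-2) * (ln (2 ^ n)) ^ ?q)"
      unfolding qmc_wce_def
    proof (rule SUP_least)
      fix f :: "real^'d \<Rightarrow> real"
      assume "f \<in> {f. f \<in> H2mix \<and> continuous_on unit_cube f \<and> H2mix_norm f \<le> 1}"
      then have fs: "f \<in> H2mix" "continuous_on unit_cube f" "H2mix_norm f \<le> 1" by auto
      have "(\<lambda>L. \<bar>grid_error n Cm L f\<bar>) \<longlonglongrightarrow>
          \<bar>(\<Sum>k<2 ^ n. f (tent (net_point 2 n Cm k))) / 2 ^ n - (LINT s|lebesgue_on unit_cube. f s)\<bar>"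
        by (rule tendsto_rabs[OF grid_error_tendsto[OF fs(2)]])
      moreover have "\<forall>\<^sub>F L in sequentially. \<bar>grid_error n Cm L f\<bar> \<le> C0 * ((1/2) ^ (2 * n - t) * (real (2 * n - t) + 1) ^ ?q)"
        using eventually_ge_at_top[of "Suc (2 * n)"]
        by eventually_elim (rule err[OF net fs], auto)
      ultimately have "\<bar>(\<Sum>k<2 ^ n. f (tent (net_point 2 n Cm k))) / 2 ^ n - (LINT s|lebesgue_on unit_cube. f s)\<bar>
          \<le> C0 * ((1/2) ^ (2 * n - t) * (real (2 * n - t) + 1) ^ ?q)"
        by (rule tendsto_upperbound) simp
      also have "\<dots> \<le> C0 * ((3 / ln 2) ^ ?q * R)"
        unfolding R_def using C0 by (intro mult_left_mono rate_bound n)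
      also have "\<dots> \<le> C * R" using R by (simp add: C_def algebra_simps)
      finally show "ereal \<bar>(\<Sum>x\<in>#image_mset tent (digital_net 2 n Cm). f x) / real (size (image_mset tent (digital_net 2 n Cm)))
          - (LINT x|lebesgue_on unit_cube. f x)\<bar> \<le> ereal (C * 2 ^ t * (2 ^ n) powr (-2) * (ln (2 ^ n)) ^ ?q)"
        by (simp add: digital_net_def multiset.map_comp o_def R_def mult.assoc flip: sum_unfold_sum_mset)
    qed
  qed
qed

end
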